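(* Let $(G,\mu)$ be a weighted, unoriented, infinite, connected graph satisfying (LB), (D), (UE)$_\beta$ for some $\beta\ge2$, and (P$_q$)$_s$ for some $q\in[1,\infty]$ and $s\ge1$. Then, for any $p\in(q,\infty)$ and any $\gamma\in(\frac{s}{\beta},1)$, there exists $C>0$ such that $$\|\Delta^\gamma f\|_{L^p(G)}\le C\,\|\nabla f\|_{L^p(G)}\qquad\text{for all finitely supported functions } f \text{ on } G.$$
   Context: Graphs. $G$ is an infinite set with a symmetric weight $\mu_{xy}=\mu_{yx}\ge0$ on $G\times G$; $E_G=\{(x,y):\mu_{xy}>0\}$; $x\sim y$ means $(x,y)\in E_G$ ($x\sim x$ is allowed). $\delta(x,y)$ is the length of a shortest path from $x$ to $y$, and $G$ is connected ($\delta<\infty$). $m(x):=\sum_{y\sim x}\mu_{xy}$ (finite), $m(E)=\sum_{x\in E}m(x)$, $B(x,r)=\{y:\delta(x,y)<r\}$, $V(x,r)=m(B(x,r))$, and $\|f\|_{L^p(G)}=(\sum_x|f(x)|^pm(x))^{1/p}$. Operators. $|\nabla f|(x)=\big(\frac1{2m(x)}\sum_{y\sim x}\mu_{xy}|f(x)-f(y)|^2\big)^{1/2}$, and $\|\nabla f\|_{L^p(G)}$ means $\|\,|\nabla f|\,\|_{L^p(G)}$. $Pf(x)=\frac1{m(x)}\sum_{y\sim x}\mu_{xy}f(y)$ and $\Delta=I-P$, a bounded nonnegative self-adjoint operator on $L^2(G)$; $\Delta^\gamma$ is defined by functional calculus. The kernels $p_k$ are defined by $P^kf(x)=\sum_y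 p_k(x,y)f(y)m(y)$ for $k\ge0$ (so $p_0(x,y)=\mathbf 1_{x=y}/m(y)$). Conditions. - (LB): $(x,x)\in E_G$ for all $x\in G$ and there is $\epsilon>0$ with $\mu_{xy}\ge\epsilon m(x)$ for all $(x,y)\in E_G$. - (D): there is $C>0$ with $V(x,2r)\le CV(x,r)$ for all $x\in G$, $r>0$. - (UE)$_\beta$: there are $C,c>0$ with $p_{k-1}(x,y)\le \frac{C}{V(x,k^{1/\beta})}\exp\big(-c[\delta(x,y)^\beta/k]^{1/(\beta-1)}\big)$ for all $x,y\in G$ and integers $k\ge1$. - (P$_q$)$_s$: there is $C>0$ such that for all $x\in G$, $r>0$ and all functions $u$ on $G$, $\big(\sum_{z\in B(x,r)}|u(z)-u_{B(x,r)}|^qm(z)\big)^{1/q}\le Cr^s\big(\sum_{z\in B(x,r)}|\nabla u|^q(z)m(z)\big)^{1/q}$, where $u_{B(x,r)}=\frac1{V(x,r)}\sum_{z\in B(x,r)}u(z)m(z)$ (suprema over $B(x,r)$ if $q=\infty$). *)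

theory Defs
  imports "HOL-Analysis.Analysis" "HOL-Computational_Algebra.Polynomial"
begin

section \<open>Weighted graphs\<close>

text \<open>The vertex set is the type \<open>'a\<close>; a graph is given by its weight \<open>\<mu>\<close>. Sums over
  neighbours, balls and vertices are all written as \<open>infsum\<close>.\<close>

definition edges :: "('a \<Rightarrow> 'a \<Rightarrow> real) \<Rightarrow> ('a \<times> 'a) set" where
  "edges \<mu> = {(x, y). \<mu> x y > 0}"

definition nbrs :: "('a \<Rightarrow> 'a \<Rightarrow> real) \<Rightarrow> 'a \<Rightarrow> 'a set" where
  "nbrs \<mu> x = {y. (x, y) \<in> edges \<mu>}"

locale connected_weighted_graph =
  fixes \<mu> :: "'a \<Rightarrow> 'a \<Rightarrow> real"
  assumes infinite_vertices: "infinite (UNIV :: 'a set)"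
    and weight_nonneg: "\<mu> x y \<ge> 0"
    and weight_sym: "\<mu> x y = \<mu> y x"
    and weight_summable: "\<mu> x summable_on nbrs \<mu> x"
    and connected: "(x, y) \<in> (edges \<mu>)\<^sup>*"

definition vmeas :: "('a \<Rightarrow> 'a \<Rightarrow> real) \<Rightarrow> 'a \<Rightarrow> real" where
  "vmeas \<mu> x = (\<Sum>\<^sub>\<infinity>y\<in>nbrs \<mu> x. \<mu> x y)"

definition gdist :: "('a \<Rightarrow> 'a \<Rightarrow> real) \<Rightarrow> 'a \<Rightarrow> 'a \<Rightarrow> nat" where
  "gdist \<mu> x y = (LEAST n. (x, y) \<in> edges \<mu> ^^ n)"

definition gball :: "('a \<Rightarrow> 'a \<Rightarrow> real) \<Rightarrow> 'a \<Rightarrow> real \<Rightarrow> 'a set" where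
  "gball \<mu> x r = {y. real (gdist \<mu> x y) < r}"

definition vol :: "('a \<Rightarrow> 'a \<Rightarrow> real) \<Rightarrow> 'a \<Rightarrow> real \<Rightarrow> real" where
  "vol \<mu> x r = (\<Sum>\<^sub>\<infinity>y\<in>gball \<mu> x r. vmeas \<mu> y)"


section \<open>Weighted Lebesgue spaces\<close>

definition Lp_space :: "('a \<Rightarrow> real) \<Rightarrow> real \<Rightarrow> ('a \<Rightarrow> 'b::real_normed_vector) set" where
  "Lp_space m p = {f. (\<lambda>x. norm (f x) powr p * m x) summable_on UNIV}"

text \<open>Only meaningful on \<open>Lp_space m p\<close>; elsewhere the infinite sum defaults to \<open>0\<close>.\<close>

definition Lp_norm :: "('a \<Rightarrow> real) \<Rightarrow> real \<Rightarrow> ('a \<Rightarrow> 'b::real_normed_vector) \<Rightarrow> real" where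
  "Lp_norm m p f = (\<Sum>\<^sub>\<infinity>x. norm (f x) powr p * m x) powr (1 / p)"


section \<open>Gradient, Markov operator and Laplacian\<close>

definition grad :: "('a \<Rightarrow> 'a \<Rightarrow> real) \<Rightarrow> ('a \<Rightarrow> 'b::real_normed_vector) \<Rightarrow> 'a \<Rightarrow> real" where
  "grad \<mu> f x = sqrt (1 / (2 * vmeas \<mu> x) * (\<Sum>\<^sub>\<infinity>y\<in>nbrs \<mu> x. \<mu> x y * (norm (f x - f y))\<^sup>2))"

definition markov :: "('a \<Rightarrow> 'a \<Rightarrow> real) \<Rightarrow> ('a \<Rightarrow> 'b::real_normed_vector) \<Rightarrow> 'a \<Rightarrow> 'b" where
  "markov \<mu> f x = (1 / vmeas \<mu> x) *\<^sub>R (\<Sum>\<^sub>\<infinity>y\<in>nbrs \<mu> x. \<mu> x y *\<^sub>R f y)"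

definition laplacian :: "('a \<Rightarrow> 'a \<Rightarrow> real) \<Rightarrow> ('a \<Rightarrow> 'b::real_normed_vector) \<Rightarrow> 'a \<Rightarrow> 'b" where
  "laplacian \<mu> f x = f x - markov \<mu> f x"

text \<open>The kernel of \<open>P\<^sup>k\<close> with respect to \<open>m\<close>: testing
  \<open>P\<^sup>k f x = (\<Sum>y. p\<^sub>k x y * f y * m y)\<close> on the indicator of \<open>{y}\<close> leaves this as the only
  candidate; \<open>markov_power_kernel\<close> below shows that it has the defining property.\<close>

definition heat_kernel :: "('a \<Rightarrow> 'a \<Rightarrow> real) \<Rightarrow> nat \<Rightarrow> 'a \<Rightarrow> 'a \<Rightarrow> real" where
  "heat_kernel \<mu> k x y = (markov \<mu> ^^ k) (indicator {y}) x / vmeas \<mu> y"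

lemma markov_power_kernel:
  fixes f :: "'a \<Rightarrow> real"
  assumes fin: "\<And>x. finite (nbrs \<mu> x)" and pos: "\<And>x. vmeas \<mu> x \<noteq> 0"
  shows "(markov \<mu> ^^ k) f x = (\<Sum>\<^sub>\<infinity>y. heat_kernel \<mu> k x y * f y * vmeas \<mu> y)"
proof -
  have "\<exists>S c. finite S \<and> (\<forall>f :: 'a \<Rightarrow> real. (markov \<mu> ^^ k) f x = (\<Sum>y\<in>S. c y * f y))" for k x
  proof (induction k)
    case 0
    show ?case by (intro exI[of _ "{x}"] exI[of _ "\<lambda>_. 1"]) simp
  next
    case (Suc k)
    then obtain S c where S: "finite S"
      and c: "\<And>f :: 'a \<Rightarrow> real. (markov \<mu> ^^ k) f x = (\<Sum>y\<in>S. c y * f y)" by blast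
    define U where "U = (\<Union>y\<in>S. nbrs \<mu> y)"
    define d where "d z = (\<Sum>y\<in>S. c y / vmeas \<mu> y * (if z \<in> nbrs \<mu> y then \<mu> y z else 0))" for z
    have U: "finite U" using S fin by (simp add: U_def)
    have "(markov \<mu> ^^ Suc k) f x = (\<Sum>z\<in>U. d z * f z)" for f :: "'a \<Rightarrow> real"
    proof -
      have "(markov \<mu> ^^ Suc k) f x = (\<Sum>y\<in>S. c y * markov \<mu> f y)"
        by (simp add: funpow_swap1 c)
      also have "\<dots> = (\<Sum>y\<in>S. \<Sum>z\<in>U. c y / vmeas \<mu> y * (if z \<in> nbrs \<mu> y then \<mu> y z else 0) * f z)"
      proof (rule sum.cong[OF refl])
        fix y assume "y \<in> S"
        then have "nbrs \<mu> y \<subseteq> U" by (auto simp: U_def)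
        then have "(\<Sum>z\<in>nbrs \<mu> y. \<mu> y z * f z)
            = (\<Sum>z\<in>U. (if z \<in> nbrs \<mu> y then \<mu> y z else 0) * f z)"
          by (intro sum.mono_neutral_cong_left U) auto
        then show "c y * markov \<mu> f y
            = (\<Sum>z\<in>U. c y / vmeas \<mu> y * (if z \<in> nbrs \<mu> y then \<mu> y z else 0) * f z)"
          by (simp add: markov_def fin sum_distrib_left mult.assoc)
      qed
      also have "\<dots> = (\<Sum>z\<in>U. d z * f z)"
        by (subst sum.swap) (simp add: d_def sum_distrib_right)
      finally show ?thesis .
    qed
    with U show ?case by blast
  qed
  then obtain S c where S: "finite S"
    and c: "\<And>f :: 'a \<Rightarrow> real. (markov \<mu> ^^ k) f x = (\<Sum>y\<in>S. c y * f y)" by blast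
  have h: "heat_kernel \<mu> k x y * vmeas \<mu> y = (if y \<in> S then c y else 0)" for y
    using pos[of y] S by (simp add: heat_kernel_def c indicator_def if_distrib sum.delta cong: if_cong)
  have "heat_kernel \<mu> k x y * f y * vmeas \<mu> y = (if y \<in> S then c y * f y else 0)" for y
    using h[of y] by (metis (no_types, lifting) mult.assoc mult.commute mult_zero_left)
  then have "(\<Sum>\<^sub>\<infinity>y. heat_kernel \<mu> k x y * f y * vmeas \<mu> y) = (\<Sum>\<^sub>\<infinity>y\<in>S. c y * f y)"
    by (intro infsum_cong_neutral) auto
  then show ?thesis using S by (simp add: c)
qed


section \<open>Continuous functional calculus on complex \<open>L\<^sup>2\<close>\<close>

definition poly_op :: "complex poly \<Rightarrow> (('a \<Rightarrow> complex) \<Rightarrow> ('a \<Rightarrow> complex)) \<Rightarrow> ('a \<Rightarrow> complex) \<Rightarrow> 'a \<Rightarrow> complex" where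
  "poly_op q T f x = (\<Sum>i\<le>degree q. coeff q i * (T ^^ i) f x)"

definition L2_bounded :: "('a \<Rightarrow> real) \<Rightarrow> (('a \<Rightarrow> complex) \<Rightarrow> ('a \<Rightarrow> complex)) \<Rightarrow> bool" where
  "L2_bounded m R \<longleftrightarrow>
    (\<exists>K. \<forall>f\<in>Lp_space m 2. R f \<in> Lp_space m 2 \<and> Lp_norm m 2 (R f) \<le> K * Lp_norm m 2 f)"

text \<open>\<open>z\<close> is in the resolvent set of a bounded linear \<open>T\<close> iff \<open>z - T\<close> has a bounded two-sided
  inverse on \<open>L\<^sup>2\<close>; such an inverse is automatically linear.\<close>

definition L2_spectrum :: "('a \<Rightarrow> real) \<Rightarrow> (('a \<Rightarrow> complex) \<Rightarrow> ('a \<Rightarrow> complex)) \<Rightarrow> complex set" where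
  "L2_spectrum m T = {z. \<nexists>R. L2_bounded m R \<and>
     (\<forall>f\<in>Lp_space m 2. R (\<lambda>x. z * f x - T f x) = f \<and> (\<lambda>x. z * R f x - T (R f) x) = f)}"

text \<open>For a bounded self-adjoint \<open>T\<close> on \<open>L\<^sup>2\<close> and \<open>h\<close> continuous on its spectrum, \<open>h(T) f\<close> is the
  common limit in \<open>L\<^sup>2\<close> of \<open>q\<^sub>n(T) f\<close> over all sequences of polynomials \<open>q\<^sub>n\<close> that converge to
  \<open>h\<close> uniformly on the spectrum.\<close>

definition L2_fun_calc ::
  "('a \<Rightarrow> real) \<Rightarrow> (('a \<Rightarrow> complex) \<Rightarrow> ('a \<Rightarrow> complex)) \<Rightarrow> (complex \<Rightarrow> complex) \<Rightarrow> ('a \<Rightarrow> complex) \<Rightarrow> 'a \<Rightarrow> complex" where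
  "L2_fun_calc m T h f = (THE g. g \<in> Lp_space m 2 \<and>
     (\<forall>q. uniform_limit (L2_spectrum m T) (\<lambda>n. poly (q n)) h sequentially \<longrightarrow>
        (\<forall>n. (\<lambda>x. poly_op (q n) T f x - g x) \<in> Lp_space m 2) \<and>
        (\<lambda>n. Lp_norm m 2 (\<lambda>x. poly_op (q n) T f x - g x)) \<longlonglongrightarrow> 0))"

text \<open>The spectrum of the Laplacian lies in \<open>[0, \<infinity>)\<close>, where the principal power is the usual
  real power (with value \<open>0\<close> at \<open>0\<close>).\<close>

definition laplacian_power :: "('a \<Rightarrow> 'a \<Rightarrow> real) \<Rightarrow> real \<Rightarrow> ('a \<Rightarrow> complex) \<Rightarrow> 'a \<Rightarrow> complex" where
  "laplacian_power \<mu> \<gamma> = L2_fun_calc (vmeas \<mu>) (laplacian \<mu>) (\<lambda>z. z powr complex_of_real \<gamma>)"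


section \<open>Conditions on the graph\<close>

definition cond_LB :: "('a \<Rightarrow> 'a \<Rightarrow> real) \<Rightarrow> bool" where
  "cond_LB \<mu> \<longleftrightarrow> (\<forall>x. (x, x) \<in> edges \<mu>) \<and>
     (\<exists>\<epsilon>>0. \<forall>x y. (x, y) \<in> edges \<mu> \<longrightarrow> \<mu> x y \<ge> \<epsilon> * vmeas \<mu> x)"

definition cond_D :: "('a \<Rightarrow> 'a \<Rightarrow> real) \<Rightarrow> bool" where
  "cond_D \<mu> \<longleftrightarrow> (\<exists>C>0. \<forall>x. \<forall>r>0. vol \<mu> x (2 * r) \<le> C * vol \<mu> x r)"

definition cond_UE :: "('a \<Rightarrow> 'a \<Rightarrow> real) \<Rightarrow> real \<Rightarrow> bool" where
  "cond_UE \<mu> \<beta> \<longleftrightarrow> (\<exists>C>0. \<exists>c>0. \<forall>x y. \<forall>k\<ge>1.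
     heat_kernel \<mu> (k - 1) x y \<le> C / vol \<mu> x (real k powr (1 / \<beta>)) *
       exp (- c * (real (gdist \<mu> x y) powr \<beta> / real k) powr (1 / (\<beta> - 1))))"

definition ball_avg :: "('a \<Rightarrow> 'a \<Rightarrow> real) \<Rightarrow> ('a \<Rightarrow> real) \<Rightarrow> 'a \<Rightarrow> real \<Rightarrow> real" where
  "ball_avg \<mu> u x r = 1 / vol \<mu> x r * (\<Sum>\<^sub>\<infinity>z\<in>gball \<mu> x r. u z * vmeas \<mu> z)"

text \<open>\<open>L\<^sup>q\<close> norm over a ball, for \<open>q \<in> [1, \<infinity>]\<close>. Balls of positive radius are nonempty, and finite
  on the graphs considered here, so the supremum is that of a finite nonempty set.\<close>

definition ball_norm :: "('a \<Rightarrow> 'a \<Rightarrow> real) \<Rightarrow> ereal \<Rightarrow> 'a \<Rightarrow> real \<Rightarrow> ('a \<Rightarrow> real) \<Rightarrow> real" where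
  "ball_norm \<mu> q x r g =
     (if q = \<infinity> then (SUP z\<in>gball \<mu> x r. \<bar>g z\<bar>)
      else (\<Sum>\<^sub>\<infinity>z\<in>gball \<mu> x r. \<bar>g z\<bar> powr real_of_ereal q * vmeas \<mu> z) powr (1 / real_of_ereal q))"

text \<open>Stated for real-valued functions; the complex-valued version follows by splitting into
  real and imaginary parts.\<close>

definition cond_P :: "('a \<Rightarrow> 'a \<Rightarrow> real) \<Rightarrow> ereal \<Rightarrow> real \<Rightarrow> bool" where
  "cond_P \<mu> q s \<longleftrightarrow> (\<exists>C>0. \<forall>x. \<forall>r>0. \<forall>u :: 'a \<Rightarrow> real.
     ball_norm \<mu> q x r (\<lambda>z. u z - ball_avg \<mu> u x r) \<le> C * r powr s * ball_norm \<mu> q x r (grad \<mu> u))"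

end

theory Submission
  imports Defs "HOL-Computational_Algebra.Fundamental_Theorem_Algebra"
begin

text \<open>Since \<open>(1 - w)\<^bsup>\<gamma> - 1\<^esup> = \<Sum>k. a\<^sub>k w\<^sup>k\<close> with \<open>0 \<le> a\<^sub>k \<le> (k + 1)\<^bsup>- \<gamma>\<^esup>\<close>, one has
  \<open>\<Delta>\<^sup>\<gamma> f = \<Sum>k. a\<^sub>k (P\<^sup>k - P\<^bsup>k + 1\<^esup>) f\<close>, so it suffices that the \<open>L\<^sup>p\<close> norm of \<open>(P\<^sup>k - P\<^bsup>k + 1\<^esup>) f\<close> is
  \<open>O(k\<^bsup>s/\<beta> - \<theta>\<^esup>)\<close> times that of \<open>\<nabla>f\<close> for some \<open>\<theta> < 1\<close> close to 1. The kernel of \<open>P\<^sup>k - P\<^bsup>k + 1\<^esup>\<close> has mean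
  zero, and it is of order \<open>k\<^bsup>- \<theta>\<^esup> / V(x, k\<^bsup>1/\<beta>\<^esup>)\<close> with rapid decay outside \<open>B(x, k\<^bsup>1/\<beta>\<^esup>)\<close>: interpolate the upper
  estimate (UE) with the on-diagonal bound that comes from \<open>\<parallel>P\<^sup>k - P\<^bsup>k + 1\<^esup>\<parallel> = O(1/k)\<close> on \<open>L\<^sup>2\<close>. The latter holds as
  the second differences of \<open>j \<mapsto> \<parallel>P\<^sup>j f\<parallel>\<^sup>2\<close> decrease and (LB) makes \<open>I + P\<close> invertible. Subtracting the mean of \<open>f\<close>
  over \<open>B(x, k\<^bsup>1/\<beta>\<^esup>)\<close> and applying the Poincare inequality on the balls \<open>B(x, 2\<^sup>i k\<^bsup>1/\<beta>\<^esup>)\<close> then bounds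
  \<open>(P\<^sup>k - P\<^bsup>k + 1\<^esup>) f (x)\<close> by \<open>k\<^bsup>s/\<beta> - \<theta>\<^esup>\<close> times a rapidly convergent sum of \<open>p\<close>-means of \<open>\<nabla>f\<close> over these balls, and
  averaging over balls of a fixed radius is bounded on \<open>L\<^sup>1\<close> by doubling.\<close>

section \<open>Power means and Lebesgue norms\<close>

text \<open>\<open>laplacian_power\<close> is a definite description over all polynomial sequences
  that approximate the power on the spectrum, so the binomial series becomes usable only through the
  bound of ||q(Delta) f|| by the supremum of |q| over the spectrum. That bound is proved by hand: on
  finitely supported functions, which every q(Delta) preserves, almost maximising vectors and the
  factorisation of a polynomial suffice, without spectral measures. The kernel estimate must
  interpolate because the L^2 argument gains 1/k but sees no distance, while (UE) sees the distance
  but gains nothing from the difference of two powers. Either one alone leaves the sum over k or the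
  sum over dyadic balls uncontrolled. The gap \<gamma> - s/\<beta> pays for it: one half is lost to
  \<theta> < 1, the other half makes the series in k converge. The means of the gradient carry the
  final exponent p itself. Jensen's inequality with one finite total weight over all pairs of a time
  and a scale then moves the p-th power inside, and only averaging on L^1 is left, with a bound
  uniform in the radius; no maximal function occurs.\<close>

lemma powr_sum_le:
  fixes w a :: "'i \<Rightarrow> real"
  assumes "finite S" and w: "\<And>i. i \<in> S \<Longrightarrow> 0 \<le> w i" and a: "\<And>i. i \<in> S \<Longrightarrow> 0 \<le> a i" and p: "1 \<le> p"
  shows "(\<Sum>i\<in>S. w i * a i) powr p \<le> (\<Sum>i\<in>S. w i) powr (p - 1) * (\<Sum>i\<in>S. w i * a i powr p)"
proof -
  \<comment> \<open>Terms with \<open>w i = 0\<close> or \<open>a i = 0\<close> drop out of both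
    sums. What remains has positive weights and arguments, so Jensen's inequality applies after
    division by the total weight \<open>W\<close>.\<close>
  define T where "T = {i \<in> S. 0 < w i \<and> 0 < a i}"
  have T: "finite T" "T \<subseteq> S" using assms(1) by (auto simp: T_def)
  have z: "w i = 0 \<or> a i = 0" if "i \<in> S - T" for i
    using that w[of i] a[of i] by (force simp: T_def)
  have e1: "(\<Sum>i\<in>S. w i * a i) = (\<Sum>i\<in>T. w i * a i)"
    using T assms(1) z by (intro sum.mono_neutral_right) auto
  have e2: "(\<Sum>i\<in>S. w i * a i powr p) = (\<Sum>i\<in>T. w i * a i powr p)"
    using T assms(1) by (intro sum.mono_neutral_right) (auto dest!: z)
  define W where "W = (\<Sum>i\<in>T. w i)"
  have WS: "W \<le> (\<Sum>i\<in>S. w i)" unfolding W_def using T assms(1) w by (intro sum_mono2) auto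
  show ?thesis
  proof (cases "T = {}")
    case True
    then show ?thesis using w by (simp add: e1 e2 sum_nonneg)
  next
    case False
    have W: "W > 0" unfolding W_def using False T by (intro sum_pos) (auto simp: T_def)
    have "(\<Sum>i\<in>T. (w i / W) *\<^sub>R a i) powr p \<le> (\<Sum>i\<in>T. (w i / W) * a i powr p)"
    proof (rule convex_on_sum[OF T(1) False powr_convex[OF p]])
      show "(\<Sum>i\<in>T. w i / W) = 1" using W by (simp add: W_def flip: sum_divide_distrib)
    qed (use W in \<open>auto simp: T_def\<close>)
    then have "((\<Sum>i\<in>T. w i * a i) / W) powr p \<le> (\<Sum>i\<in>T. w i * a i powr p) / W"
      by (simp add: sum_divide_distrib)
    moreover have "0 \<le> (\<Sum>i\<in>T. w i * a i)" by (intro sum_nonneg) (auto simp: T_def)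
    ultimately have "(\<Sum>i\<in>T. w i * a i) powr p \<le> W powr p * ((\<Sum>i\<in>T. w i * a i powr p) / W)"
      using W by (simp add: powr_divide divide_simps mult_ac)
    also have "\<dots> = W powr (p - 1) * (\<Sum>i\<in>T. w i * a i powr p)"
      using W by (simp add: powr_diff)
    also have "\<dots> \<le> (\<Sum>i\<in>S. w i) powr (p - 1) * (\<Sum>i\<in>T. w i * a i powr p)"
      using W WS p by (intro mult_right_mono powr_mono2 sum_nonneg) (auto simp: T_def)
    finally show ?thesis by (simp add: e1 e2)
  qed
qed

lemma power2_norm_sum_le:
  fixes u :: "'i \<Rightarrow> 'b::real_normed_vector"
  assumes "finite S" and w: "\<And>i. i \<in> S \<Longrightarrow> 0 \<le> w i"
  shows "(norm (\<Sum>i\<in>S. w i *\<^sub>R u i))\<^sup>2 \<le> (\<Sum>i\<in>S. w i) * (\<Sum>i\<in>S. w i * (norm (u i))\<^sup>2)"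
proof -
  have "norm (\<Sum>i\<in>S. w i *\<^sub>R u i) \<le> (\<Sum>i\<in>S. w i * norm (u i))"
    using w by (intro sum_norm_le) auto
  then have "(norm (\<Sum>i\<in>S. w i *\<^sub>R u i))\<^sup>2 \<le> (\<Sum>i\<in>S. w i * norm (u i))\<^sup>2"
    by (intro power_mono) auto
  also have "\<dots> = (\<Sum>i\<in>S. w i * norm (u i)) powr 2"
    using w by (simp add: sum_nonneg)
  also have "\<dots> \<le> (\<Sum>i\<in>S. w i) powr (2 - 1) * (\<Sum>i\<in>S. w i * norm (u i) powr 2)"
    using assms by (intro powr_sum_le) auto
  also have "\<dots> = (\<Sum>i\<in>S. w i) * (\<Sum>i\<in>S. w i * (norm (u i))\<^sup>2)"
    using w by (simp add: sum_nonneg)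
  finally show ?thesis .
qed

text \<open>Norm bounds below are proved on finite vertex sets, where limits and sums can be
  exchanged. Membership is recorded too, since \<open>infsum\<close> is 0 on families that are not
  summable and a bare bound on \<open>Lp_norm\<close> would then say nothing.\<close>

lemma Lp_space_bound:
  fixes f :: "'a \<Rightarrow> 'b::real_normed_vector"
  assumes "\<And>x. 0 \<le> m x" and "\<And>A. finite A \<Longrightarrow> (\<Sum>x\<in>A. norm (f x) powr p * m x) \<le> K"
  shows "f \<in> Lp_space m p" and "(\<Sum>\<^sub>\<infinity>x. norm (f x) powr p * m x) \<le> K"
proof -
  have s: "(\<lambda>x. norm (f x) powr p * m x) summable_on UNIV"
    using assms by (intro nonneg_bdd_above_summable_on) (auto intro!: bdd_aboveI[of _ K])
  then show "f \<in> Lp_space m p" by (simp add: Lp_space_def)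
  show "(\<Sum>\<^sub>\<infinity>x. norm (f x) powr p * m x) \<le> K"
    using s assms(2) by (intro infsum_le_finite_sums) auto
qed

lemma Lp_space_finite_sum_le:
  fixes f :: "'a \<Rightarrow> 'b::real_normed_vector"
  assumes "\<And>x. 0 \<le> m x" and "f \<in> Lp_space m p" and "finite A"
  shows "(\<Sum>x\<in>A. norm (f x) powr p * m x) \<le> (\<Sum>\<^sub>\<infinity>x. norm (f x) powr p * m x)"
  using assms by (intro finite_sum_le_infsum) (auto simp: Lp_space_def)

section \<open>The weighted inner product of finitely supported functions\<close>

text \<open>A real inner product, that is, the real part of the Hermitian one for complex values: it
  serves both the real heat kernel and the complex spectral theory. Summing over the support of the
  first argument makes it linear on the right for arbitrary functions there.\<close>

definition wip :: "('a \<Rightarrow> real) \<Rightarrow> ('a \<Rightarrow> 'b::real_inner) \<Rightarrow> ('a \<Rightarrow> 'b) \<Rightarrow> real" where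
  "wip m f g = (\<Sum>x | f x \<noteq> 0. inner (f x) (g x) * m x)"

abbreviation fin_supp :: "('a \<Rightarrow> 'b::zero) \<Rightarrow> bool" where
  "fin_supp f \<equiv> finite {x. f x \<noteq> 0}"

lemma wip_eq_sum:
  assumes "finite A" and "\<And>x. x \<notin> A \<Longrightarrow> f x = 0 \<or> g x = 0" and "fin_supp f"
  shows "wip m f g = (\<Sum>x\<in>A. inner (f x) (g x) * m x)"
  unfolding wip_def using assms by (intro sum.mono_neutral_cong) fastforce+

lemma wip_eq_sum_Un:
  assumes "fin_supp f" "fin_supp g"
  shows "wip m f h = (\<Sum>x\<in>{x. f x \<noteq> 0} \<union> {x. g x \<noteq> 0}. inner (f x) (h x) * m x)"
    and "wip m g h = (\<Sum>x\<in>{x. f x \<noteq> 0} \<union> {x. g x \<noteq> 0}. inner (g x) (h x) * m x)"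
  using assms by (auto intro!: wip_eq_sum)

lemma fin_supp_add: "fin_supp f \<Longrightarrow> fin_supp g \<Longrightarrow> fin_supp (\<lambda>x. f x + g x :: 'b::monoid_add)"
  by (erule (1) finite_subset[rotated, OF finite_UnI]) auto

lemma fin_supp_diff: "fin_supp f \<Longrightarrow> fin_supp g \<Longrightarrow> fin_supp (\<lambda>x. f x - g x :: 'b::group_add)"
  by (erule (1) finite_subset[rotated, OF finite_UnI]) auto

lemma fin_supp_scaleR: "fin_supp f \<Longrightarrow> fin_supp (\<lambda>x. c *\<^sub>R f x :: 'b::real_vector)"
  by (erule finite_subset[rotated]) auto

lemma fin_supp_mult: "fin_supp f \<Longrightarrow> fin_supp (\<lambda>x. c * f x :: 'b::mult_zero)"
  by (erule finite_subset[rotated]) auto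

lemma wip_commute:
  assumes "fin_supp f" "fin_supp g" shows "wip m f g = wip m g f"
  by (simp add: wip_eq_sum_Un[OF assms] inner_commute)

lemma wip_add_left:
  assumes "fin_supp f" "fin_supp g"
  shows "wip m (\<lambda>x. f x + g x) h = wip m f h + wip m g h"
proof -
  let ?A = "{x. f x \<noteq> 0} \<union> {x. g x \<noteq> 0}"
  have "wip m (\<lambda>x. f x + g x) h = (\<Sum>x\<in>?A. inner (f x + g x) (h x) * m x)"
    using assms by (intro wip_eq_sum fin_supp_add) auto
  then show ?thesis 
    by (simp add: wip_eq_sum_Un[OF assms] inner_add_left distrib_right sum.distrib)
qed

lemma wip_diff_left:
  assumes "fin_supp f" "fin_supp g"
  shows "wip m (\<lambda>x. f x - g x) h = wip m f h - wip m g h"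
proof -
  let ?A = "{x. f x \<noteq> 0} \<union> {x. g x \<noteq> 0}"
  have "wip m (\<lambda>x. f x - g x) h = (\<Sum>x\<in>?A. inner (f x - g x) (h x) * m x)"
    using assms by (intro wip_eq_sum fin_supp_diff) auto
  then show ?thesis 
    by (simp add: wip_eq_sum_Un[OF assms] inner_diff_left left_diff_distrib sum_subtractf)
qed

lemma wip_scaleR_left:
  assumes "fin_supp f"
  shows "wip m (\<lambda>x. c *\<^sub>R f x) h = c * wip m f h"
proof -
  let ?A = "{x. f x \<noteq> 0}"
  have "wip m (\<lambda>x. c *\<^sub>R f x) h = (\<Sum>x\<in>?A. inner (c *\<^sub>R f x) (h x) * m x)"
    using assms by (intro wip_eq_sum fin_supp_scaleR) auto
  then show ?thesis by (simp add: wip_def sum_distrib_left mult.assoc)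
qed

lemma wip_add_right:
  "wip m f (\<lambda>x. g x + h x) = wip m f g + wip m f h"
  by (simp add: wip_def inner_add_right distrib_right sum.distrib)

lemma wip_diff_right:
  "wip m f (\<lambda>x. g x - h x) = wip m f g - wip m f h"
  by (simp add: wip_def inner_diff_right left_diff_distrib sum_subtractf)

lemma wip_scaleR_right:
  "wip m f (\<lambda>x. c *\<^sub>R g x) = c * wip m f g"
  by (simp add: wip_def sum_distrib_left mult.assoc)

lemma wip_self: "wip m f f = (\<Sum>x | f x \<noteq> 0. (norm (f x))\<^sup>2 * m x)"
  by (simp add: wip_def power2_norm_eq_inner)

lemma wip_self_nonneg: "(\<And>x. 0 \<le> m x) \<Longrightarrow> 0 \<le> wip m f f"
  unfolding wip_self by (intro sum_nonneg) auto

lemma wip_self_pos: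
  assumes "\<And>x. 0 < m x" and "fin_supp f" and "f x \<noteq> 0"
  shows "0 < wip m f f"
  unfolding wip_self using assms by (intro sum_pos) auto

lemma wip_Cauchy_Schwarz:
  assumes "\<And>x. 0 \<le> m x" and "fin_supp f" "fin_supp g"
  shows "(wip m f g)\<^sup>2 \<le> wip m f f * wip m g g"
proof -
  let ?A = "{x. f x \<noteq> 0} \<union> {x. g x \<noteq> 0}"
  have eq: "wip m f f = (\<Sum>x\<in>?A. (norm (f x) * sqrt (m x))\<^sup>2)"
           "wip m g g = (\<Sum>x\<in>?A. (norm (g x) * sqrt (m x))\<^sup>2)"
    using assms(1) by (simp_all add: wip_eq_sum_Un[OF assms(2,3)] power_mult_distrib power2_norm_eq_inner)
  have "\<bar>wip m f g\<bar> \<le> (\<Sum>x\<in>?A. \<bar>inner (f x) (g x) * m x\<bar>)"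
    unfolding wip_eq_sum_Un(1)[OF assms(2,3)] by (rule sum_abs)
  also have "\<dots> \<le> (\<Sum>x\<in>?A. (norm (f x) * sqrt (m x)) * (norm (g x) * sqrt (m x)))"
  proof (rule sum_mono)
    fix x
    have "\<bar>inner (f x) (g x) * m x\<bar> = \<bar>inner (f x) (g x)\<bar> * (sqrt (m x) * sqrt (m x))"
      using assms(1)[of x] by (simp add: abs_mult)
    also have "\<dots> \<le> norm (f x) * norm (g x) * (sqrt (m x) * sqrt (m x))"
      using assms(1)[of x] by (intro mult_right_mono Cauchy_Schwarz_ineq2) auto
    also have "\<dots> = (norm (f x) * sqrt (m x)) * (norm (g x) * sqrt (m x))"
      by (simp only: mult_ac)
    finally show "\<bar>inner (f x) (g x) * m x\<bar> \<le> (norm (f x) * sqrt (m x)) * (norm (g x) * sqrt (m x))" .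
  qed
  finally have "\<bar>wip m f g\<bar> \<le> (\<Sum>x\<in>?A. (norm (f x) * sqrt (m x)) * (norm (g x) * sqrt (m x)))" .
  from power_mono[OF this abs_ge_zero, of 2]
  have "(wip m f g)\<^sup>2 \<le> (\<Sum>x\<in>?A. (norm (f x) * sqrt (m x)) * (norm (g x) * sqrt (m x)))\<^sup>2"
    by (simp only: power2_abs)
  also have "\<dots> \<le> wip m f f * wip m g g"
    unfolding eq by (rule Cauchy_Schwarz_ineq_sum)
  finally show ?thesis .
qed

section \<open>The Markov operator under (LB)\<close>

locale lb_graph = connected_weighted_graph \<mu> for \<mu> :: "'a \<Rightarrow> 'a \<Rightarrow> real" +
  fixes \<epsilon> :: real
  assumes eps_pos: "0 < \<epsilon>"
    and loop: "0 < \<mu> x x"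
    and lower: "0 < \<mu> x y \<Longrightarrow> \<epsilon> * vmeas \<mu> x \<le> \<mu> x y"
begin

abbreviation m :: "'a \<Rightarrow> real" where "m \<equiv> vmeas \<mu>"
abbreviation P :: "('a \<Rightarrow> 'b::real_normed_vector) \<Rightarrow> 'a \<Rightarrow> 'b" where "P \<equiv> markov \<mu>"

lemma nbrs_iff: "y \<in> nbrs \<mu> x \<longleftrightarrow> 0 < \<mu> x y"
  by (simp add: nbrs_def edges_def)

lemma nbrs_sym: "y \<in> nbrs \<mu> x \<longleftrightarrow> x \<in> nbrs \<mu> y"
  using weight_sym[of x y] by (simp add: nbrs_iff)

lemma not_nbr: "y \<notin> nbrs \<mu> x \<Longrightarrow> \<mu> x y = 0"
  using weight_nonneg[of x y] by (simp add: nbrs_iff)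

lemma sum_weight_le_nbrs: "finite F \<Longrightarrow> F \<subseteq> nbrs \<mu> x \<Longrightarrow> sum (\<mu> x) F \<le> m x"
  unfolding vmeas_def using weight_summable weight_nonneg by (intro finite_sum_le_infsum) auto

lemma m_pos: "0 < m x"
  using sum_weight_le_nbrs[of "{x}" x] loop[of x] by (simp add: nbrs_iff)

lemma m_nonneg: "0 \<le> m x" and m_nz: "m x \<noteq> 0"
  using m_pos[of x] by auto

text \<open>By (LB) each neighbour takes a share of at least \<epsilon> of the mass
  \<open>m x\<close>, so there are at most 1/\<epsilon> of them. This turns all infinite sums over
  neighbours and balls into finite ones.\<close>

lemma finite_nbrs: "finite (nbrs \<mu> x)"
proof (rule ccontr)
  assume inf: "infinite (nbrs \<mu> x)"
  obtain n :: nat where n: "1 / \<epsilon> < real n" using reals_Archimedean2 by blast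
  obtain F where F: "finite F" "card F = n" "F \<subseteq> nbrs \<mu> x"
    using infinite_arbitrarily_large[OF inf] by blast
  have "real n * (\<epsilon> * m x) = (\<Sum>y\<in>F. \<epsilon> * m x)" by (simp add: F)
  also have "\<dots> \<le> sum (\<mu> x) F" using F by (intro sum_mono lower) (auto simp: nbrs_iff)
  also have "\<dots> \<le> m x" using F by (intro sum_weight_le_nbrs)
  finally have "real n * \<epsilon> \<le> 1" using m_pos[of x] by (simp flip: mult.assoc)
  then show False using n eps_pos by (simp add: field_simps)
qed

lemma m_eq_sum: "m x = (\<Sum>y\<in>nbrs \<mu> x. \<mu> x y)"
  by (simp add: vmeas_def finite_nbrs)

lemma sum_weight_le: "finite F \<Longrightarrow> sum (\<mu> x) F \<le> m x"
proof -
  assume F: "finite F"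
  then have "sum (\<mu> x) F = sum (\<mu> x) (F \<inter> nbrs \<mu> x)"
    by (intro sum.mono_neutral_right) (auto simp: not_nbr)
  also have "\<dots> \<le> m x" using F by (intro sum_weight_le_nbrs) auto
  finally show ?thesis .
qed

lemma P_eq_sum: "P f x = (\<Sum>y\<in>nbrs \<mu> x. (\<mu> x y / m x) *\<^sub>R f y)"
  by (simp add: markov_def finite_nbrs scaleR_sum_right)

lemma sum_tr: "(\<Sum>y\<in>nbrs \<mu> x. \<mu> x y / m x) = 1"
  using m_nz[of x] by (simp add: m_eq_sum flip: sum_divide_distrib)

lemma P_add: "P (\<lambda>x. f x + g x) = (\<lambda>x. P f x + P g x)"
  by (simp add: fun_eq_iff P_eq_sum scaleR_add_right sum.distrib)

lemma P_diff: "P (\<lambda>x. f x - g x) = (\<lambda>x. P f x - P g x)"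
  by (simp add: fun_eq_iff P_eq_sum scaleR_diff_right sum_subtractf)

lemma P_mult: "P (\<lambda>x. c * f x) = (\<lambda>x. c * P f x :: 'b::real_normed_algebra)"
  by (simp add: fun_eq_iff P_eq_sum sum_distrib_left)

lemma P_const: "P (\<lambda>x. c) = (\<lambda>x. c)"
  by (simp add: fun_eq_iff P_eq_sum sum_tr flip: scaleR_sum_left)

lemma fin_supp_P: "fin_supp f \<Longrightarrow> fin_supp (P f)"
proof -
  assume f: "fin_supp f"
  have "{x. P f x \<noteq> 0} \<subseteq> (\<Union>y\<in>{y. f y \<noteq> 0}. nbrs \<mu> y)"
  proof
    fix x assume "x \<in> {x. P f x \<noteq> 0}"
    then obtain y where "y \<in> nbrs \<mu> x" "f y \<noteq> 0"
      unfolding P_eq_sum by (metis (mono_tags, lifting) mem_Collect_eq scaleR_zero_right sum.neutral)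
    then show "x \<in> (\<Union>y\<in>{y. f y \<noteq> 0}. nbrs \<mu> y)" using nbrs_sym by auto
  qed
  then show ?thesis using f finite_nbrs by (meson finite_UN finite_subset)
qed

lemma fin_supp_P_pow: "fin_supp f \<Longrightarrow> fin_supp ((P ^^ n) f)"
  by (induction n) (auto intro: fin_supp_P)

text \<open>The mass \<open>m x\<close> cancels the normalisation of P and leaves a double sum with
  the symmetric weight; self-adjointness and the lower bound for I + P are read off from it.\<close>

lemma wip_P_sum:
  assumes "finite A" and "\<And>x. x \<notin> A \<Longrightarrow> f x = 0" and "\<And>x. x \<notin> A \<Longrightarrow> g x = 0"
  shows "wip m (P f) g = (\<Sum>x\<in>A. \<Sum>y\<in>A. \<mu> x y * inner (f y) (g x))"
proof -
  have fs: "fin_supp f" using assms by (auto intro: finite_subset[of _ A])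
  have "wip m (P f) g = (\<Sum>x\<in>A. inner (P f x) (g x) * m x)"
    using assms fs by (intro wip_eq_sum fin_supp_P) auto
  also have "\<dots> = (\<Sum>x\<in>A. \<Sum>y\<in>A. \<mu> x y * inner (f y) (g x))"
  proof (rule sum.cong[OF refl])
    fix x assume "x \<in> A"
    have "inner (P f x) (g x) * m x = (\<Sum>y\<in>nbrs \<mu> x. \<mu> x y * inner (f y) (g x))"
      using m_nz[of x] by (simp add: P_eq_sum inner_sum_left sum_distrib_right)
    also have "\<dots> = (\<Sum>y\<in>A. \<mu> x y * inner (f y) (g x))"
      using assms finite_nbrs by (intro sum.mono_neutral_cong) (auto simp: not_nbr)
    finally show "inner (P f x) (g x) * m x = (\<Sum>y\<in>A. \<mu> x y * inner (f y) (g x))" .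
  qed
  finally show ?thesis .
qed

lemma P_selfadjoint:
  assumes "fin_supp f" "fin_supp g"
  shows "wip m (P f) g = wip m f (P g)"
proof -
  let ?A = "{x. f x \<noteq> 0} \<union> {x. g x \<noteq> 0}"
  have "wip m f (P g) = wip m (P g) f"
    using assms by (intro wip_commute fin_supp_P)
  also have "\<dots> = (\<Sum>x\<in>?A. \<Sum>y\<in>?A. \<mu> x y * inner (g y) (f x))"
    using assms by (intro wip_P_sum) auto
  also have "\<dots> = (\<Sum>x\<in>?A. \<Sum>y\<in>?A. \<mu> y x * inner (g x) (f y))"
    by (rule sum.swap)
  also have "\<dots> = wip m (P f) g"
    using assms by (subst wip_P_sum[of ?A]) (auto simp: weight_sym inner_commute)
  finally show ?thesis by simp
qed

lemma P_pow_selfadjoint: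
  assumes "fin_supp f" "fin_supp g"
  shows "wip m ((P ^^ n) f) g = wip m f ((P ^^ n) g)"
  using assms
proof (induction n arbitrary: g)
  case (Suc n)
  have "wip m ((P ^^ Suc n) f) g = wip m ((P ^^ n) f) (P g)"
    using Suc.prems by (simp add: P_selfadjoint fin_supp_P_pow)
  also have "\<dots> = wip m f ((P ^^ n) (P g))"
    using Suc.prems by (intro Suc.IH fin_supp_P)
  finally show ?case by (simp add: funpow_swap1)
qed auto

text \<open>Cauchy-Schwarz in each row, whose weights sum to 1, followed by summation over columns,
  whose weights sum to at most \<open>m y\<close> by symmetry. Working on a finite window and its
  neighbourhood keeps the bound available for functions of infinite support.\<close>

lemma sum_P_sq_le:
  assumes "finite A"
  shows "(\<Sum>x\<in>A. (norm (P f x))\<^sup>2 * m x) \<le> (\<Sum>y\<in>(\<Union>x\<in>A. nbrs \<mu> x). (norm (f y))\<^sup>2 * m y)"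
proof -
  let ?N = "\<Union>x\<in>A. nbrs \<mu> x"
  have N: "finite ?N" using assms finite_nbrs by auto
  have "(norm (P f x))\<^sup>2 * m x \<le> (\<Sum>y\<in>?N. \<mu> x y * (norm (f y))\<^sup>2)" if "x \<in> A" for x
  proof -
    have "(norm (P f x))\<^sup>2 \<le> (\<Sum>y\<in>nbrs \<mu> x. \<mu> x y / m x) * (\<Sum>y\<in>nbrs \<mu> x. \<mu> x y / m x * (norm (f y))\<^sup>2)"
      unfolding P_eq_sum using finite_nbrs weight_nonneg m_nonneg by (intro power2_norm_sum_le) auto
    then have "(norm (P f x))\<^sup>2 * m x \<le> (\<Sum>y\<in>nbrs \<mu> x. \<mu> x y / m x * (norm (f y))\<^sup>2) * m x"
      using m_nonneg by (intro mult_right_mono) (auto simp: sum_tr)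
    also have "\<dots> = (\<Sum>y\<in>nbrs \<mu> x. \<mu> x y * (norm (f y))\<^sup>2)"
      using m_nz[of x] by (simp add: sum_distrib_right)
    also have "\<dots> \<le> (\<Sum>y\<in>?N. \<mu> x y * (norm (f y))\<^sup>2)"
      using N that weight_nonneg by (intro sum_mono2) auto
    finally show ?thesis .
  qed
  then have "(\<Sum>x\<in>A. (norm (P f x))\<^sup>2 * m x) \<le> (\<Sum>x\<in>A. \<Sum>y\<in>?N. \<mu> x y * (norm (f y))\<^sup>2)"
    by (rule sum_mono)
  also have "\<dots> = (\<Sum>y\<in>?N. (norm (f y))\<^sup>2 * sum (\<mu> y) A)"
    unfolding sum_distrib_left by (subst sum.swap) (intro sum.cong refl, simp add: weight_sym)
  also have "\<dots> \<le> (\<Sum>y\<in>?N. (norm (f y))\<^sup>2 * m y)"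
    using assms by (intro sum_mono mult_left_mono sum_weight_le) auto
  finally show ?thesis .
qed

lemma P_contraction:
  assumes "fin_supp f"
  shows "wip m (P f) (P f) \<le> wip m f f"
proof -
  let ?A = "{x. P f x \<noteq> 0}" and ?N = "\<Union>x\<in>{x. P f x \<noteq> 0}. nbrs \<mu> x"
  have fA: "finite ?A" using assms by (rule fin_supp_P)
  then have fN: "finite ?N" using finite_nbrs by auto
  have "wip m (P f) (P f) \<le> (\<Sum>y\<in>?N. (norm (f y))\<^sup>2 * m y)"
    unfolding wip_self using fA by (rule sum_P_sq_le)
  also have "\<dots> \<le> (\<Sum>y\<in>?N \<union> {y. f y \<noteq> 0}. (norm (f y))\<^sup>2 * m y)"
    using assms fN m_nonneg by (intro sum_mono2) auto
  also have "\<dots> = wip m f f"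
    unfolding wip_self using assms fN by (intro sum.mono_neutral_right) auto
  finally show ?thesis .
qed

end

section \<open>Decay of the discrete time derivative in mean square\<close>

text \<open>Two summations by parts bound the sum of the (j + 1) \<open>b j\<close> by
  \<open>c 0\<close>. As \<open>b n\<close> is the smallest term, it is bounded by
  \<open>c 0\<close> divided by 1 + 2 + ... + (n + 1).\<close>

lemma second_difference_decay:
  fixes c :: "nat \<Rightarrow> real"
  defines "b \<equiv> \<lambda>j. c j - 2 * c (Suc j) + c (Suc (Suc j))"
  assumes "\<And>j. 0 \<le> c j" and "decseq c" and "decseq b"
  shows "b n * (real (n + 1) * real (n + 2) / 2) \<le> c 0"
proof -
  have "(\<Sum>j\<le>n. real (j + 1) * b j) = c 0 - c (Suc n) - real (n + 1) * (c (Suc n) - c (Suc (Suc n)))"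
    by (induction n) (simp_all add: b_def algebra_simps)
  also have "\<dots> \<le> c 0"
  proof -
    have "0 \<le> real (n + 1) * (c (Suc n) - c (Suc (Suc n)))"
      using decseqD[OF assms(3), of "Suc n" "Suc (Suc n)"] by (intro mult_nonneg_nonneg) auto
    then show ?thesis using assms(2)[of "Suc n"] by linarith
  qed
  finally have "(\<Sum>j\<le>n. real (j + 1) * b j) \<le> c 0" .
  moreover have "(\<Sum>j\<le>n. real (j + 1) * b n) \<le> (\<Sum>j\<le>n. real (j + 1) * b j)"
    using decseqD[OF assms(4)] by (intro sum_mono mult_left_mono) auto
  moreover have "(\<Sum>j\<le>n. real (j + 1) * b n) = b n * (real (n + 1) * real (n + 2) / 2)"
  proof -
    have "(\<Sum>j\<le>n. real (j + 1) * t) = t * (real (n + 1) * real (n + 2) / 2)" for t :: real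
      by (induction n) (simp_all add: field_simps)
    then show ?thesis .
  qed
  ultimately show ?thesis by linarith
qed

context lb_graph
begin

text \<open>Every product is at least minus the mean of the two squares, which in total gives at
  worst minus the squared norm. On the diagonal the product is the square itself, so each loop
  improves on this by twice its weight, and (LB) makes that at least 2 \<epsilon>
  \<open>m x\<close>.\<close>

lemma I_plus_P_coercive:
  assumes "fin_supp g"
  shows "2 * \<epsilon> * wip m g g \<le> wip m (\<lambda>x. g x + P g x) g"
proof -
  let ?A = "{x. g x \<noteq> 0}"
  let ?h = "\<lambda>x. (norm (g x))\<^sup>2"
  have le: "- (\<mu> x y * (?h x + ?h y) / 2) + (if x = y then 2 * \<epsilon> * m x * ?h x else 0) \<le> \<mu> x y * inner (g y) (g x)"
    for x y
  proof (cases "x = y")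
    case True
    have "\<epsilon> * m x * ?h x \<le> \<mu> x x * ?h x"
      by (intro mult_right_mono lower loop) auto
    then show ?thesis using True by (simp add: power2_norm_eq_inner)
  next
    case False
    have "0 \<le> (norm (g x + g y))\<^sup>2" by simp
    then have "0 \<le> ?h x + ?h y + 2 * inner (g y) (g x)"
      by (simp add: power2_norm_eq_inner inner_add_left inner_add_right inner_commute)
    then have "- ((?h x + ?h y) / 2) \<le> inner (g y) (g x)"
      by argo
    from mult_left_mono[OF this weight_nonneg[of x y]] False show ?thesis by (simp add: mult.commute)
  qed
  have s1: "(\<Sum>x\<in>?A. \<Sum>y\<in>?A. \<mu> x y * ?h x) \<le> wip m g g"
  proof -
    have "(\<Sum>x\<in>?A. ?h x * sum (\<mu> x) ?A) \<le> wip m g g"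
      unfolding wip_self using assms by (intro sum_mono mult_left_mono sum_weight_le) auto
    then show ?thesis by (simp add: sum_distrib_left mult.commute)
  qed
  have s2: "(\<Sum>x\<in>?A. \<Sum>y\<in>?A. \<mu> x y * ?h y) = (\<Sum>x\<in>?A. \<Sum>y\<in>?A. \<mu> x y * ?h x)"
    by (subst sum.swap) (simp add: weight_sym)
  have s3: "(\<Sum>x\<in>?A. \<Sum>y\<in>?A. if x = y then 2 * \<epsilon> * m x * ?h x else 0) = 2 * \<epsilon> * wip m g g"
    using assms by (simp add: wip_self sum_distrib_left mult_ac)
  have "2 * \<epsilon> * wip m g g - wip m g g \<le>
      - (((\<Sum>x\<in>?A. \<Sum>y\<in>?A. \<mu> x y * ?h x) + (\<Sum>x\<in>?A. \<Sum>y\<in>?A. \<mu> x y * ?h y)) / 2)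
        + (\<Sum>x\<in>?A. \<Sum>y\<in>?A. if x = y then 2 * \<epsilon> * m x * ?h x else 0)"
    using s1 unfolding s2 s3 by simp
  also have "\<dots> = (\<Sum>x\<in>?A. \<Sum>y\<in>?A. - (\<mu> x y * (?h x + ?h y) / 2) + (if x = y then 2 * \<epsilon> * m x * ?h x else 0))"
    by (simp add: sum.distrib sum_negf sum_divide_distrib distrib_left add_divide_distrib sum_subtractf)
  also have "\<dots> \<le> (\<Sum>x\<in>?A. \<Sum>y\<in>?A. \<mu> x y * inner (g y) (g x))"
    by (intro sum_mono le)
  also have "\<dots> = wip m (P g) g"
    using assms by (intro wip_P_sum[symmetric]) auto
  finally show ?thesis
    using assms by (simp add: wip_add_left fin_supp_P)
qed

lemma I_plus_P_bounded_below:
  assumes "fin_supp g"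
  shows "4 * \<epsilon>\<^sup>2 * wip m g g \<le> wip m (\<lambda>x. g x + P g x) (\<lambda>x. g x + P g x)"
proof (cases "wip m g g = 0")
  case True
  then show ?thesis using m_nonneg by (simp add: wip_self_nonneg)
next
  case False
  then have pos: "0 < wip m g g" using wip_self_nonneg[of m g] m_nonneg by force
  have "(2 * \<epsilon> * wip m g g)\<^sup>2 \<le> (wip m (\<lambda>x. g x + P g x) g)\<^sup>2"
    using I_plus_P_coercive[OF assms] pos eps_pos by (intro power_mono) auto
  also have "\<dots> \<le> wip m (\<lambda>x. g x + P g x) (\<lambda>x. g x + P g x) * wip m g g"
    using assms m_nonneg by (intro wip_Cauchy_Schwarz fin_supp_add fin_supp_P)
  finally have "(4 * \<epsilon>\<^sup>2 * wip m g g) * wip m g g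
      \<le> wip m (\<lambda>x. g x + P g x) (\<lambda>x. g x + P g x) * wip m g g"
    by (simp add: power2_eq_square mult_ac)
  then show ?thesis using pos by simp
qed

lemma P_pow_diff: "(P ^^ n) (\<lambda>x. f x - g x) = (\<lambda>x. (P ^^ n) f x - (P ^^ n) g x)"
  by (induction n) (simp_all add: P_diff)

lemma wip_diff_self:
  assumes "fin_supp f" "fin_supp g"
  shows "wip m (\<lambda>x. f x - g x) (\<lambda>x. f x - g x) = wip m f f - 2 * wip m f g + wip m g g"
  using assms by (simp add: wip_diff_left wip_diff_right wip_commute[of g f])

text \<open>Moving one P across the inner product shows that the second difference of the squared
  norms is the squared norm of P^j (I - P^2) f, which decreases because P is a contraction. Since I
  - P^2 = (I + P)(I - P), the lower bound for I + P then strips the extra factor.\<close>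

lemma wip_P_pow_diff_le:
  assumes f: "fin_supp f"
  shows "wip m (\<lambda>x. (P ^^ n) f x - (P ^^ Suc n) f x) (\<lambda>x. (P ^^ n) f x - (P ^^ Suc n) f x)
    \<le> wip m f f / (2 * \<epsilon>\<^sup>2 * (real (n + 1))\<^sup>2)"
proof -
  define c where "c j = wip m ((P ^^ j) f) ((P ^^ j) f)" for j
  define q where "q j = (\<lambda>x. (P ^^ j) f x - (P ^^ Suc (Suc j)) f x)" for j
  note fin = fin_supp_P_pow[OF f]
  have qb: "wip m (q j) (q j) = c j - 2 * c (Suc j) + c (Suc (Suc j))" for j
  proof -
    have "wip m ((P ^^ j) f) ((P ^^ Suc (Suc j)) f) = c (Suc j)"
      using fin[of j] by (simp add: c_def P_selfadjoint fin_supp_P)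
    then show ?thesis
      unfolding q_def by (subst wip_diff_self[OF fin fin]) (simp add: c_def)
  qed
  have qs: "q (Suc j) = P (q j)" for j
    by (simp add: q_def P_diff)
  have qfin: "fin_supp (q j)" for j
    unfolding q_def by (intro fin_supp_diff fin)
  have "decseq c"
    using P_contraction[OF fin] by (intro decseq_SucI) (simp add: c_def)
  moreover have "decseq (\<lambda>j. wip m (q j) (q j))"
    using P_contraction[OF qfin] by (intro decseq_SucI) (simp only: qs)
  moreover have "0 \<le> c j" for j
    unfolding c_def by (rule wip_self_nonneg[OF m_nonneg])
  ultimately have "wip m (q n) (q n) * (real (n + 1) * real (n + 2) / 2) \<le> c 0"
    unfolding qb by (rule second_difference_decay[rotated])
  moreover have "wip m (q n) (q n) * ((real (n + 1))\<^sup>2 / 2) \<le> wip m (q n) (q n) * (real (n + 1) * real (n + 2) / 2)"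
    using m_nonneg by (intro mult_left_mono wip_self_nonneg) (auto simp: power2_eq_square field_simps)
  ultimately have A: "wip m (q n) (q n) * ((real (n + 1))\<^sup>2 / 2) \<le> wip m f f"
    by (simp add: c_def)
  define g where "g = (\<lambda>x. (P ^^ n) f x - (P ^^ Suc n) f x)"
  have qn: "q n = (\<lambda>x. g x + P g x)"
    by (simp add: g_def q_def P_diff)
  have gf: "fin_supp g"
    unfolding g_def by (intro fin_supp_diff fin)
  have "4 * \<epsilon>\<^sup>2 * wip m g g \<le> wip m (q n) (q n)"
    using I_plus_P_bounded_below[OF gf] by (simp only: qn)
  then have "4 * \<epsilon>\<^sup>2 * wip m g g * ((real (n + 1))\<^sup>2 / 2) \<le> wip m f f"
    by (rule order_trans[OF mult_right_mono A]) auto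
  then show ?thesis
    unfolding g_def[symmetric] using eps_pos by (simp add: field_simps)
qed

end

section \<open>Polynomials in the Laplacian\<close>

lemma poly_op_eq_sum:
  assumes "degree q \<le> n"
  shows "poly_op q T f x = (\<Sum>i\<le>n. coeff q i * (T ^^ i) f x)"
  unfolding poly_op_def using assms by (intro sum.mono_neutral_left) (auto simp: coeff_eq_0)

lemma poly_op_add: "poly_op (p + q) T f = (\<lambda>x. poly_op p T f x + poly_op q T f x)"
proof
  fix x
  let ?n = "max (degree p) (degree q)"
  show "poly_op (p + q) T f x = poly_op p T f x + poly_op q T f x"
    using degree_add_le_max[of p q]
    by (simp add: poly_op_eq_sum[of _ ?n] distrib_right sum.distrib)
qed

lemma poly_op_smult: "poly_op (smult c p) T f = (\<lambda>x. c * poly_op p T f x)"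
  using degree_smult_le[of c p]
  by (simp add: fun_eq_iff poly_op_eq_sum[of _ "degree p"] sum_distrib_left mult.assoc)

lemma poly_op_0: "poly_op 0 T f = (\<lambda>x. 0)"
  by (simp add: fun_eq_iff poly_op_def)

lemma wip_mult_left:
  fixes f g :: "'a \<Rightarrow> complex"
  assumes "fin_supp f"
  shows "wip m (\<lambda>x. c * f x) g = wip m f (\<lambda>x. cnj c * g x)"
proof -
  have "wip m (\<lambda>x. c * f x) g = (\<Sum>x | f x \<noteq> 0. inner (c * f x) (g x) * m x)"
    using assms by (intro wip_eq_sum fin_supp_mult) auto
  then show ?thesis
    by (simp add: wip_def inner_complex_def algebra_simps)
qed

lemma wip_mult_self:
  fixes f :: "'a \<Rightarrow> complex"
  assumes "fin_supp f"
  shows "wip m (\<lambda>x. c * f x) (\<lambda>x. c * f x) = (cmod c)\<^sup>2 * wip m f f"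
proof -
  have "wip m (\<lambda>x. c * f x) (\<lambda>x. c * f x) = (\<Sum>x | f x \<noteq> 0. inner (c * f x) (c * f x) * m x)"
    using assms by (intro wip_eq_sum fin_supp_mult) auto
  then show ?thesis
    by (simp add: wip_self power2_norm_eq_inner[symmetric] norm_mult power_mult_distrib sum_distrib_left mult.assoc)
qed

lemma Lp_norm_2_fin_supp:
  assumes "fin_supp f" and nonneg: "\<And>x. 0 \<le> m x"
  shows "f \<in> Lp_space m 2" and "Lp_norm m 2 f = sqrt (wip m f f)"
proof -
  have "((\<lambda>x. norm (f x) powr 2 * m x) summable_on UNIV) \<longleftrightarrow>
      ((\<lambda>x. norm (f x) powr 2 * m x) summable_on {x. f x \<noteq> 0})"
    by (intro summable_on_cong_neutral) auto
  then show "f \<in> Lp_space m 2"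
    using assms by (simp add: Lp_space_def)
  have "(\<Sum>\<^sub>\<infinity>x. norm (f x) powr 2 * m x) = (\<Sum>\<^sub>\<infinity>x | f x \<noteq> 0. norm (f x) powr 2 * m x)"
    by (intro infsum_cong_neutral) auto
  also have "\<dots> = wip m f f"
    using assms by (simp add: wip_self)
  finally show "Lp_norm m 2 f = sqrt (wip m f f)"
    using wip_self_nonneg[of m f] nonneg by (simp only: Lp_norm_def powr_half_sqrt)
qed

context lb_graph
begin

abbreviation D :: "('a \<Rightarrow> complex) \<Rightarrow> 'a \<Rightarrow> complex" where "D \<equiv> laplacian \<mu>"

lemma D_eq: "D f = (\<lambda>x. f x - P f x)"
  by (simp add: fun_eq_iff laplacian_def)

lemma D_add: "D (\<lambda>x. f x + g x) = (\<lambda>x. D f x + D g x)"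
  by (simp add: D_eq P_add algebra_simps)

lemma D_mult: "D (\<lambda>x. c * f x) = (\<lambda>x. c * D f x)"
  by (simp add: D_eq P_mult right_diff_distrib)

lemma D_sum: "D (\<lambda>x. \<Sum>i\<le>n::nat. c i * F i x) = (\<lambda>x. \<Sum>i\<le>n. c i * D (F i) x)"
  by (induction n) (simp_all add: D_add D_mult)

lemma fin_supp_D: "fin_supp f \<Longrightarrow> fin_supp (D f)"
  unfolding D_eq by (intro fin_supp_diff fin_supp_P)

lemma D_selfadjoint:
  assumes "fin_supp f" "fin_supp g"
  shows "wip m (D f) g = wip m f (D g)"
  using assms by (simp add: D_eq wip_diff_left wip_diff_right fin_supp_P P_selfadjoint)

lemma wip_add_self_le:
  fixes f g :: "'a \<Rightarrow> 'b::real_inner"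
  assumes "fin_supp f" "fin_supp g"
  shows "wip m (\<lambda>x. f x + g x) (\<lambda>x. f x + g x) \<le> 2 * wip m f f + 2 * wip m g g"
proof -
  have "0 \<le> wip m (\<lambda>x. f x - g x) (\<lambda>x. f x - g x)"
    by (rule wip_self_nonneg[OF m_nonneg])
  then show ?thesis
    using assms by (simp add: wip_diff_self wip_add_left wip_add_right wip_commute[of g f])
qed

lemma D_bounded:
  assumes "fin_supp f"
  shows "wip m (D f) (D f) \<le> 4 * wip m f f"
proof -
  have "0 \<le> wip m (\<lambda>x. f x + P f x) (\<lambda>x. f x + P f x)"
    by (rule wip_self_nonneg[OF m_nonneg])
  then have "- 2 * wip m f (P f) \<le> wip m f f + wip m (P f) (P f)"
    using assms by (simp add: wip_add_left wip_add_right wip_commute[of "P f" f] fin_supp_P)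
  then show ?thesis
    using assms P_contraction[OF assms] by (simp add: D_eq wip_diff_self fin_supp_P)
qed

lemma poly_op_pCons: "poly_op (pCons a q) D f = (\<lambda>x. a * f x + D (poly_op q D f) x)"
proof
  fix x
  have "poly_op (pCons a q) D f x = (\<Sum>i\<le>Suc (degree q). coeff (pCons a q) i * (D ^^ i) f x)"
    by (intro poly_op_eq_sum degree_pCons_le)
  also have "\<dots> = a * f x + (\<Sum>i\<le>degree q. coeff q i * D ((D ^^ i) f) x)"
    by (subst sum.atMost_Suc_shift) simp
  also have "(\<Sum>i\<le>degree q. coeff q i * D ((D ^^ i) f) x) = D (poly_op q D f) x"
    unfolding poly_op_def by (simp add: D_sum)
  finally show "poly_op (pCons a q) D f x = a * f x + D (poly_op q D f) x" .
qed

lemma poly_op_mult: "poly_op (p * q) D f = poly_op p D (poly_op q D f)"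
proof (induction p)
  case 0
  then show ?case by (simp add: poly_op_0)
next
  case (pCons a p)
  then show ?case by (simp add: mult_pCons_left poly_op_add poly_op_smult poly_op_pCons)
qed

lemma poly_op_D: "poly_op q D (D f) = D (poly_op q D f)"
proof -
  have X: "poly_op [:0, 1:] D g = D g" for g
    by (simp add: poly_op_pCons poly_op_0 D_eq P_const)
  have "poly_op (q * [:0, 1:]) D f = poly_op ([:0, 1:] * q) D f" by (simp only: mult.commute)
  then show ?thesis by (simp only: poly_op_mult X)
qed

lemma fin_supp_poly_op: "fin_supp f \<Longrightarrow> fin_supp (poly_op q D f)"
proof (induction q)
  case (pCons a q)
  then show ?case unfolding poly_op_pCons by (intro fin_supp_add fin_supp_mult fin_supp_D)
qed (simp add: poly_op_0)

lemma poly_op_bounded: "\<exists>K\<ge>0. \<forall>f. fin_supp f \<longrightarrow> wip m (poly_op q D f) (poly_op q D f) \<le> K * wip m f f"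
proof (induction q)
  case 0
  show ?case by (intro exI[of _ 0]) (simp add: poly_op_0 wip_def)
next
  case (pCons a q)
  then obtain K where K: "K \<ge> 0" "\<And>f. fin_supp f \<Longrightarrow> wip m (poly_op q D f) (poly_op q D f) \<le> K * wip m f f"
    by blast
  have "wip m (poly_op (pCons a q) D f) (poly_op (pCons a q) D f) \<le> (2 * (cmod a)\<^sup>2 + 8 * K) * wip m f f"
    if f: "fin_supp f" for f
  proof -
    have "wip m (poly_op (pCons a q) D f) (poly_op (pCons a q) D f)
        \<le> 2 * wip m (\<lambda>x. a * f x) (\<lambda>x. a * f x) + 2 * wip m (D (poly_op q D f)) (D (poly_op q D f))"
      unfolding poly_op_pCons using f by (intro wip_add_self_le fin_supp_mult fin_supp_D fin_supp_poly_op)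
    also have "\<dots> \<le> 2 * ((cmod a)\<^sup>2 * wip m f f) + 2 * (4 * (K * wip m f f))"
      using f order_trans[OF D_bounded[OF fin_supp_poly_op[OF f]] mult_left_mono[OF K(2)[OF f], of 4]]
      by (simp add: wip_mult_self)
    finally show ?thesis by (simp add: algebra_simps)
  qed
  then show ?case using K(1) by (intro exI[of _ "2 * (cmod a)\<^sup>2 + 8 * K"]) auto
qed

lemma poly_op_adjoint:
  assumes "fin_supp f" "fin_supp g"
  shows "wip m (poly_op q D f) g = wip m f (poly_op (map_poly cnj q) D g)"
  using assms
proof (induction q arbitrary: g)
  case 0
  then show ?case by (simp add: poly_op_0 wip_def)
next
  case (pCons a q)
  have "wip m (poly_op (pCons a q) D f) g = wip m f (\<lambda>x. cnj a * g x) + wip m (poly_op q D f) (D g)"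
    using pCons.prems
    by (simp add: poly_op_pCons wip_add_left fin_supp_mult fin_supp_D fin_supp_poly_op wip_mult_left D_selfadjoint)
  also have "wip m (poly_op q D f) (D g) = wip m f (D (poly_op (map_poly cnj q) D g))"
    using pCons.prems by (simp add: pCons.IH fin_supp_D poly_op_D)
  finally show ?case
    by (simp add: map_poly_pCons poly_op_pCons wip_add_right)
qed

section \<open>The norm of q(Delta) is governed by the values of q on the spectrum\<close>

lemma resolvent_bounded_below:
  assumes "z \<notin> L2_spectrum m D"
  shows "\<exists>\<delta>>0. \<forall>f. fin_supp f \<longrightarrow> \<delta> * wip m f f \<le> wip m (\<lambda>x. z * f x - D f x) (\<lambda>x. z * f x - D f x)"
proof -
  obtain R where R: "L2_bounded m R" "\<And>f. f \<in> Lp_space m 2 \<Longrightarrow> R (\<lambda>x. z * f x - D f x) = f"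
    using assms unfolding L2_spectrum_def by blast
  then obtain K where K: "\<And>f. f \<in> Lp_space m 2 \<Longrightarrow> Lp_norm m 2 (R f) \<le> K * Lp_norm m 2 f"
    unfolding L2_bounded_def by blast
  \<comment> \<open>The bound of the resolvent carries no sign; the maximum makes it positive, so
    that it can be inverted.\<close>
  define L where "L = max K 1"
  have L: "L > 0" by (simp add: L_def)
  have "1 / L\<^sup>2 * wip m f f \<le> wip m (\<lambda>x. z * f x - D f x) (\<lambda>x. z * f x - D f x)" if f: "fin_supp f" for f
  proof -
    let ?g = "\<lambda>x. z * f x - D f x"
    have g: "fin_supp ?g" using f by (intro fin_supp_diff fin_supp_mult fin_supp_D)
    have N: "0 \<le> wip m ?g ?g" by (rule wip_self_nonneg[OF m_nonneg])
    have "sqrt (wip m f f) \<le> K * sqrt (wip m ?g ?g)"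
      using K[of ?g] R(2)[of f] Lp_norm_2_fin_supp[OF f m_nonneg] Lp_norm_2_fin_supp[OF g m_nonneg] by simp
    also have "\<dots> \<le> L * sqrt (wip m ?g ?g)"
      using N by (intro mult_right_mono) (auto simp: L_def)
    finally have "(sqrt (wip m f f))\<^sup>2 \<le> (L * sqrt (wip m ?g ?g))\<^sup>2"
      by (intro power_mono) (auto simp: wip_self_nonneg m_nonneg)
    then have "wip m f f \<le> L\<^sup>2 * wip m ?g ?g"
      using N by (simp add: power_mult_distrib wip_self_nonneg m_nonneg)
    then show ?thesis using L by (simp add: field_simps)
  qed
  then show ?thesis using L by (intro exI[of _ "1 / L\<^sup>2"]) auto
qed

text \<open>The real inner product of Delta f with i f vanishes by self-adjointness, so pairing z f
  - Delta f with i f leaves only Im z times the squared norm, and Cauchy-Schwarz concludes. This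
  handles the nonreal roots of a polynomial without reference to the spectrum.\<close>

lemma nonreal_bounded_below:
  assumes f: "fin_supp f"
  shows "(Im z)\<^sup>2 * wip m f f \<le> wip m (\<lambda>x. z * f x - D f x) (\<lambda>x. z * f x - D f x)"
proof (cases "wip m f f = 0")
  case True
  then show ?thesis using m_nonneg by (simp add: wip_self_nonneg)
next
  case False
  then have pos: "0 < wip m f f" using wip_self_nonneg[of m f] m_nonneg by force
  let ?g = "\<lambda>x. z * f x - D f x" and ?i = "\<lambda>x. \<i> * f x"
  have fi: "fin_supp ?i" using f by (rule fin_supp_mult)
  have g: "fin_supp ?g" using f by (intro fin_supp_diff fin_supp_mult fin_supp_D)
  have "wip m (D f) ?i = wip m f (\<lambda>x. \<i> * D f x)"
    by (simp only: D_selfadjoint[OF f fi] D_mult)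
  also have "\<dots> = wip m (\<lambda>x. - 1 *\<^sub>R ?i x) (D f)"
    using wip_mult_left[OF f, of m "-\<i>" "D f"] by simp
  also have "\<dots> = - wip m (D f) ?i"
    using f by (subst wip_scaleR_left[OF fi]) (simp add: wip_commute fin_supp_D fi)
  finally have "wip m (D f) ?i = 0" by simp
  then have "wip m ?g ?i = wip m (\<lambda>x. z * f x) ?i"
    using f by (simp add: wip_diff_left fin_supp_mult fin_supp_D)
  also have "\<dots> = wip m f (\<lambda>x. cnj z * (\<i> * f x))"
    using f by (rule wip_mult_left)
  also have "\<dots> = Im z * wip m f f"
    by (simp add: wip_def sum_distrib_left inner_complex_def algebra_simps)
  finally have "(Im z * wip m f f)\<^sup>2 \<le> wip m ?g ?g * wip m ?i ?i"
    using wip_Cauchy_Schwarz[of m, OF m_nonneg g fi] by simp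
  then have "(Im z)\<^sup>2 * wip m f f * wip m f f \<le> wip m ?g ?g * wip m f f"
    using f by (simp add: wip_mult_self power2_eq_square mult_ac)
  then show ?thesis using pos by simp
qed

text \<open>Lower bounds for the commuting linear factors multiply. The factors come from the
  fundamental theorem of algebra, one root at a time.\<close>

lemma poly_bounded_below:
  assumes "r \<noteq> 0"
    and "\<And>z. poly r z = 0 \<Longrightarrow> \<exists>\<delta>>0. \<forall>f. fin_supp f \<longrightarrow>
           \<delta> * wip m f f \<le> wip m (\<lambda>x. z * f x - D f x) (\<lambda>x. z * f x - D f x)"
  shows "\<exists>\<delta>>0. \<forall>f. fin_supp f \<longrightarrow> \<delta> * wip m f f \<le> wip m (poly_op r D f) (poly_op r D f)"
  using assms
proof (induction "degree r" arbitrary: r rule: less_induct)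
  case less
  show ?case
  proof (cases "degree r = 0")
    case True
    then obtain c where c: "r = [:c:]" using degree_eq_zeroE by blast
    then have "c \<noteq> 0" using less.prems by simp
    moreover have "poly_op r D f = (\<lambda>x. c * f x)" for f
      by (simp add: c poly_op_pCons poly_op_0 D_eq P_const)
    ultimately show ?thesis
      by (intro exI[of _ "(cmod c)\<^sup>2"]) (auto simp: wip_mult_self)
  next
    case False
    then obtain z where z: "poly r z = 0"
      using fundamental_theorem_of_algebra[of r] constant_degree[of r] by auto
    then obtain s where s: "r = [:- z, 1:] * s" by (auto simp: poly_eq_0_iff_dvd dvd_def)
    have s0: "s \<noteq> 0" using less.prems s by auto
    have "degree r = Suc (degree s)"
      unfolding s using s0 by (subst degree_mult_eq) auto
    then have "\<exists>\<delta>>0. \<forall>f. fin_supp f \<longrightarrow> \<delta> * wip m f f \<le> wip m (poly_op s D f) (poly_op s D f)"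
      using s0 by (intro less.hyps less.prems(2)) (auto simp: s)
    then obtain d1 where d1: "d1 > 0" "\<And>f. fin_supp f \<Longrightarrow> d1 * wip m f f \<le> wip m (poly_op s D f) (poly_op s D f)"
      by blast
    obtain d2 where d2: "d2 > 0" "\<And>f. fin_supp f \<Longrightarrow>
        d2 * wip m f f \<le> wip m (\<lambda>x. z * f x - D f x) (\<lambda>x. z * f x - D f x)"
      using less.prems(2)[OF z] by blast
    have "d2 * d1 * wip m f f \<le> wip m (poly_op r D f) (poly_op r D f)" if f: "fin_supp f" for f
    proof -
      let ?h = "poly_op s D f"
      have h: "fin_supp ?h" using f by (rule fin_supp_poly_op)
      have "poly_op r D f = (\<lambda>x. - z * ?h x + D ?h x)"
        unfolding s poly_op_mult by (simp add: poly_op_pCons poly_op_0 D_eq P_const)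
      also have "\<dots> = (\<lambda>x. (-1) * (z * ?h x - D ?h x))" by (simp add: fun_eq_iff)
      finally have "wip m (poly_op r D f) (poly_op r D f) = wip m (\<lambda>x. z * ?h x - D ?h x) (\<lambda>x. z * ?h x - D ?h x)"
        using wip_mult_self[OF fin_supp_diff[OF fin_supp_mult[OF h] fin_supp_D[OF h]], of m "-1" z] by simp
      moreover have "d2 * (d1 * wip m f f) \<le> d2 * wip m ?h ?h"
        using d1 d2 f by (intro mult_left_mono) auto
      moreover have "d2 * wip m ?h ?h \<le> wip m (\<lambda>x. z * ?h x - D ?h x) (\<lambda>x. z * ?h x - D ?h x)"
        using f by (intro d2 fin_supp_poly_op)
      ultimately show ?thesis by (simp add: mult.assoc)
    qed
    then show ?thesis using d1 d2 by (intro exI[of _ "d2 * d1"]) auto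
  qed
qed

text \<open>\<open>L\<close> is the squared operator norm on finitely supported functions, obtained
  as the infimum of all admissible constants. The supremum itself need not be attained by a vector,
  hence the margin \<eta>.\<close>

lemma poly_op_norm_attained:
  obtains L where "0 \<le> L"
    and "\<And>f. fin_supp f \<Longrightarrow> wip m (poly_op q D f) (poly_op q D f) \<le> L * wip m f f"
    and "\<And>\<eta>. 0 < \<eta> \<Longrightarrow> \<exists>f. fin_supp f \<and> 0 < wip m f f \<and>
            (L - \<eta>) * wip m f f \<le> wip m (poly_op q D f) (poly_op q D f)"
proof -
  let ?N = "\<lambda>f. wip m (poly_op q D f) (poly_op q D f)"
  define S where "S = {c. \<forall>f. fin_supp f \<longrightarrow> ?N f \<le> c * wip m f f}"
  have S0: "S \<noteq> {}" using poly_op_bounded[of q] by (auto simp: S_def)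
  obtain x0 :: 'a where True by blast
  \<comment> \<open>A point mass is a nonzero test vector; it shows that admissible constants are
    nonnegative, so that their infimum makes sense.\<close>
  define e :: "'a \<Rightarrow> complex" where "e = (\<lambda>x. if x = x0 then 1 else 0)"
  have e: "fin_supp e" "e x0 \<noteq> 0" by (auto simp: e_def)
  then have e0: "0 < wip m e e" by (rule wip_self_pos[OF m_pos])
  have S1: "0 \<le> c" if "c \<in> S" for c
  proof -
    have "0 \<le> ?N e" by (rule wip_self_nonneg[OF m_nonneg])
    also have "\<dots> \<le> c * wip m e e" using that e by (auto simp: S_def)
    finally show ?thesis using e0 by (simp add: zero_le_mult_iff)
  qed
  define L where "L = Inf S"
  have up: "?N f \<le> L * wip m f f" if f: "fin_supp f" for f
  proof (cases "wip m f f = 0")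
    case True
    then show ?thesis using S0 f by (auto simp: S_def)
  next
    case False
    then have pos: "0 < wip m f f" using wip_self_nonneg[of m f] m_nonneg by force
    have "?N f / wip m f f \<le> L"
      unfolding L_def using S0 f pos by (intro cInf_greatest) (auto simp: S_def field_simps)
    then show ?thesis using pos by (simp add: field_simps)
  qed
  show thesis
  proof (rule that)
    show "0 \<le> L" unfolding L_def using S0 S1 by (intro cInf_greatest)
    show "?N f \<le> L * wip m f f" if "fin_supp f" for f using that by (rule up)
    fix \<eta> :: real assume "0 < \<eta>"
    have "L - \<eta> \<notin> S"
    proof
      assume "L - \<eta> \<in> S"
      then have "L \<le> L - \<eta>" unfolding L_def using S1 by (intro cInf_lower bdd_belowI)
      then show False using \<open>0 < \<eta>\<close> by simp
    qed
    then obtain f where f: "fin_supp f" "(L - \<eta>) * wip m f f < ?N f" by (force simp: S_def)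
    have "wip m f f \<noteq> 0"
    proof
      assume "wip m f f = 0"
      then show False using up[OF f(1)] f(2) by simp
    qed
    then have "0 < wip m f f" using wip_self_nonneg[of m f] m_nonneg by force
    then show "\<exists>f. fin_supp f \<and> 0 < wip m f f \<and> (L - \<eta>) * wip m f f \<le> ?N f"
      using f by (intro exI[of _ f]) auto
  qed
qed

lemma map_poly_cnj_cnj: "map_poly cnj (map_poly cnj q) = q"
  by (intro poly_eqI) (simp add: coeff_map_poly)

text \<open>An almost maximising vector of \<open>\<parallel>q(\<Delta>) f\<parallel>\<close> is an approximate eigenvector of \<open>q(\<Delta>)\<^sup>* q(\<Delta>)\<close>; factoring
  the polynomial \<open>q\<^sup>* q - L\<close> turns it into an approximate eigenvector of \<open>\<Delta>\<close> itself.\<close>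

lemma spectral_value_attained:
  assumes r: "map_poly cnj q * q \<noteq> [:complex_of_real L:]"
    and L0: "0 \<le> L"
    and up: "\<And>f. fin_supp f \<Longrightarrow> wip m (poly_op q D f) (poly_op q D f) \<le> L * wip m f f"
    and appr: "\<And>\<eta>. 0 < \<eta> \<Longrightarrow> \<exists>f. fin_supp f \<and> 0 < wip m f f \<and>
            (L - \<eta>) * wip m f f \<le> wip m (poly_op q D f) (poly_op q D f)"
  shows "\<exists>z\<in>L2_spectrum m D. (cmod (poly q z))\<^sup>2 = L"
proof (rule ccontr)
  assume no: "\<not> ?thesis"
  let ?c = "map_poly cnj q"
  let ?r = "?c * q - [:complex_of_real L:]"
  have "\<exists>\<delta>>0. \<forall>f. fin_supp f \<longrightarrow> \<delta> * wip m f f \<le> wip m (poly_op ?r D f) (poly_op ?r D f)"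
  proof (rule poly_bounded_below)
    show "?r \<noteq> 0" using r by simp
    fix z assume z: "poly ?r z = 0"
    show "\<exists>\<delta>>0. \<forall>f. fin_supp f \<longrightarrow>
           \<delta> * wip m f f \<le> wip m (\<lambda>x. z * f x - D f x) (\<lambda>x. z * f x - D f x)"
    proof (cases "Im z = 0")
      case False
      then show ?thesis using nonreal_bounded_below by (intro exI[of _ "(Im z)\<^sup>2"]) auto
    next
      case True
      \<comment> \<open>At a real point the conjugate polynomial takes the conjugate value, so a
        real root of \<open>?r\<close> satisfies |q(z)|^2 = L. By the assumption for contradiction
        such a z lies outside the spectrum.\<close>
      then have "cnj z = z" by (simp add: complex_eq_iff)
      then have "cnj (poly q z) * poly q z = complex_of_real L" using z by simp
      then have "complex_of_real ((cmod (poly q z))\<^sup>2) = complex_of_real L"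
        by (simp only: complex_norm_square mult.commute)
      then have "(cmod (poly q z))\<^sup>2 = L" by (simp only: of_real_eq_iff)
      then show ?thesis using no by (intro resolvent_bounded_below) auto
    qed
  qed
  then obtain \<delta> where \<delta>: "\<delta> > 0" "\<And>f. fin_supp f \<Longrightarrow> \<delta> * wip m f f \<le> wip m (poly_op ?r D f) (poly_op ?r D f)"
    by blast
  \<comment> \<open>The expansion below gives at most 2 L \<eta> times the squared norm of f for an
    almost maximising f; this must fall below \<delta>. The summand 1 covers L = 0.\<close>
  define \<eta> where "\<eta> = \<delta> / (2 * L + 1) / 2"
  have \<eta>: "0 < \<eta>" "2 * L * \<eta> < \<delta>"
    using \<delta> L0 by (auto simp: \<eta>_def field_simps add_pos_nonneg)
  obtain f where f: "fin_supp f" "0 < wip m f f" "(L - \<eta>) * wip m f f \<le> wip m (poly_op q D f) (poly_op q D f)"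
    using appr[OF \<eta>(1)] by blast
  let ?g = "poly_op q D f"
  let ?h = "poly_op ?c D ?g"
  have g: "fin_supp ?g" and h: "fin_supp ?h" using f by (auto intro: fin_supp_poly_op)
  have "poly_op ?r D f = (\<lambda>x. ?h x - L *\<^sub>R f x)"
  proof -
    have "?r = ?c * q + [:- complex_of_real L:]" by simp
    then have "poly_op ?r D f = (\<lambda>x. ?h x + poly_op [:- complex_of_real L:] D f x)"
      by (simp only: poly_op_add poly_op_mult)
    then show ?thesis by (simp add: poly_op_pCons poly_op_0 D_eq P_const scaleR_conv_of_real)
  qed
  then have "wip m (poly_op ?r D f) (poly_op ?r D f) = wip m ?h ?h - 2 * (L * wip m ?h f) + L * (L * wip m f f)"
    using f(1) h by (simp add: wip_diff_self fin_supp_scaleR wip_scaleR_left wip_scaleR_right)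
  moreover have "wip m ?h f = wip m ?g ?g"
    using f(1) g by (simp add: poly_op_adjoint map_poly_cnj_cnj)
  \<comment> \<open>As q(Delta) commutes with its adjoint, the adjoint has the same norm at each
    vector, so the bound \<open>up\<close> applies twice.\<close>
  moreover have "wip m ?h ?h \<le> L * (L * wip m f f)"
  proof -
    have "wip m ?h ?h = wip m ?g (poly_op q D ?h)"
      using g h by (simp add: poly_op_adjoint[of ?g] map_poly_cnj_cnj)
    also have "poly_op q D ?h = poly_op ?c D (poly_op q D ?g)"
      by (metis poly_op_mult mult.commute)
    also have "wip m ?g \<dots> = wip m (poly_op q D ?g) (poly_op q D ?g)"
      using g by (simp add: poly_op_adjoint fin_supp_poly_op)
    also have "\<dots> \<le> L * wip m ?g ?g" using g by (rule up)
    also have "\<dots> \<le> L * (L * wip m f f)" using L0 f by (intro mult_left_mono up)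
    finally show ?thesis .
  qed
  moreover have "L * ((L - \<eta>) * wip m f f) \<le> L * wip m ?g ?g"
    using L0 f by (intro mult_left_mono)
  ultimately have "wip m (poly_op ?r D f) (poly_op ?r D f) \<le> 2 * L * \<eta> * wip m f f"
    by (simp add: algebra_simps)
  also have "\<dots> < \<delta> * wip m f f" using \<eta> f by simp
  also have "\<dots> \<le> wip m (poly_op ?r D f) (poly_op ?r D f)" using \<delta> f by simp
  finally show False by simp
qed

text \<open>The polynomial X already yields a spectral value. Nonemptiness is what makes a supremum
  over the spectrum control a constant polynomial, for which the factorisation argument has no root
  to offer.\<close>

lemma L2_spectrum_nonempty: "L2_spectrum m D \<noteq> {}"
proof -
  obtain L where "0 \<le> L"
    and "\<And>f. fin_supp f \<Longrightarrow> wip m (poly_op [:0, 1:] D f) (poly_op [:0, 1:] D f) \<le> L * wip m f f"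
    and "\<And>\<eta>. 0 < \<eta> \<Longrightarrow> \<exists>f. fin_supp f \<and> 0 < wip m f f \<and>
            (L - \<eta>) * wip m f f \<le> wip m (poly_op [:0, 1:] D f) (poly_op [:0, 1:] D f)"
    using poly_op_norm_attained[of "[:0, 1:]"] by blast
  then have "\<exists>z\<in>L2_spectrum m D. (cmod (poly [:0, 1:] z))\<^sup>2 = L"
    by (intro spectral_value_attained) (auto simp: map_poly_pCons)
  then show ?thesis by auto
qed

text \<open>For nonconstant q the squared norm equals |q(z)|^2 at some spectral point z. This is the
  isometry-type estimate on which the continuous functional calculus rests.\<close>

lemma poly_op_spectral_bound:
  assumes f: "fin_supp f" and M: "\<And>z. z \<in> L2_spectrum m D \<Longrightarrow> cmod (poly q z) \<le> M"
  shows "wip m (poly_op q D f) (poly_op q D f) \<le> M\<^sup>2 * wip m f f"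
proof (cases "degree q = 0")
  case True
  then obtain c where c: "q = [:c:]" using degree_eq_zeroE by blast
  then have "cmod c \<le> M" using L2_spectrum_nonempty M by force
  then have "(cmod c)\<^sup>2 * wip m f f \<le> M\<^sup>2 * wip m f f"
    by (intro mult_right_mono power_mono wip_self_nonneg m_nonneg) auto
  then show ?thesis
    using f by (simp add: c poly_op_pCons poly_op_0 D_eq P_const wip_mult_self)
next
  case False
  obtain L where L: "0 \<le> L"
    "\<And>f. fin_supp f \<Longrightarrow> wip m (poly_op q D f) (poly_op q D f) \<le> L * wip m f f"
    "\<And>\<eta>. 0 < \<eta> \<Longrightarrow> \<exists>f. fin_supp f \<and> 0 < wip m f f \<and>
            (L - \<eta>) * wip m f f \<le> wip m (poly_op q D f) (poly_op q D f)"
    using poly_op_norm_attained[of q] by blast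
  have q0: "q \<noteq> 0" using False by auto
  then have "map_poly cnj q \<noteq> 0" by (metis map_poly_cnj_cnj map_poly_0)
  then have "degree (map_poly cnj q * q) \<noteq> 0" using q0 False by (simp add: degree_mult_eq)
  then have "map_poly cnj q * q \<noteq> [:complex_of_real L:]" by auto
  then obtain z where z: "z \<in> L2_spectrum m D" "(cmod (poly q z))\<^sup>2 = L"
    using spectral_value_attained[OF _ L] by blast
  have "L \<le> M\<^sup>2" unfolding z(2)[symmetric] using M[OF z(1)] by (intro power_mono) auto
  then have "L * wip m f f \<le> M\<^sup>2 * wip m f f"
    by (intro mult_right_mono wip_self_nonneg m_nonneg)
  then show ?thesis using L(2)[OF f] by simp
qed

end

section \<open>The binomial series on the closed unit disc\<close>

text \<open>The coefficient of w^k in (1 - w)^\<gamma>. The numbers a_k of the overview are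
  \<open>bcoef (\<gamma> - 1) k\<close>.\<close>

definition bcoef :: "real \<Rightarrow> nat \<Rightarrow> real" where
  "bcoef \<gamma> k = (-1) ^ k * (\<gamma> gchoose k)"

lemma gbinomial_Suc_rec:
  fixes a :: "'a::field_char_0"
  shows "of_nat (Suc k) * (a gchoose Suc k) = (a - of_nat k) * (a gchoose k)"
  by (simp only: gbinomial_absorption gbinomial_absorb_comp)

lemma bcoef_0 [simp]: "bcoef \<gamma> 0 = 1"
  by (simp add: bcoef_def)

lemma bcoef_Suc: "bcoef \<gamma> (Suc k) = bcoef \<gamma> k * ((real k - \<gamma>) / real (Suc k))"
proof -
  have eq: "(\<gamma> gchoose Suc k) = (\<gamma> - real k) * (\<gamma> gchoose k) / real (Suc k)"
    using gbinomial_Suc_rec[of k \<gamma>] by (simp add: field_simps del: of_nat_Suc)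
  show ?thesis
    unfolding bcoef_def eq by (simp add: field_simps del: of_nat_Suc)
qed

text \<open>Compare coefficients in (1 - w)^\<gamma> = (1 - w) (1 - w)^(\<gamma> - 1). This drives
  both the telescoping of the absolute sum and the summation by parts for the fractional
  power.\<close>

lemma bcoef_Suc_diff: "bcoef \<gamma> (Suc k) = bcoef (\<gamma> - 1) (Suc k) - bcoef (\<gamma> - 1) k"
  using gbinomial_Suc_Suc[of "\<gamma> - 1" k] by (simp add: bcoef_def algebra_simps)

lemma of_real_bcoef: "complex_of_real (bcoef \<gamma> k) = (-1) ^ k * (complex_of_real \<gamma> gchoose k)"
proof (induction k)
  case (Suc k)
  have eq: "(complex_of_real \<gamma> gchoose Suc k) = (complex_of_real \<gamma> - of_nat k) * (complex_of_real \<gamma> gchoose k) / of_nat (Suc k)"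
    using gbinomial_Suc_rec[of k "complex_of_real \<gamma>"] by (simp add: field_simps del: of_nat_Suc)
  show ?case
    unfolding bcoef_Suc of_real_mult Suc.IH eq by (simp add: field_simps del: of_nat_Suc)
qed simp

lemma bcoef_nonneg:
  assumes "\<gamma> < 0" shows "0 \<le> bcoef \<gamma> k"
  using assms by (induction k) (auto simp: bcoef_Suc intro!: mult_nonneg_nonneg)

text \<open>Consecutive coefficients have quotient 1 - \<gamma>/(k + 1). It is at most ((k + 2)/(k +
  1))^(-\<gamma>) because 1 - x <= exp(-x) and ln(1 + x) <= x, and the product of these bounds
  telescopes.\<close>

lemma bcoef_decay:
  assumes "0 < \<gamma>" "\<gamma> < 1"
  shows "bcoef (\<gamma> - 1) k \<le> real (k + 1) powr (- \<gamma>)"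
proof (induction k)
  case (Suc k)
  have pos: "0 < 1 - \<gamma> / real (k + 1)" using assms by (simp add: field_simps)
  have "ln (real (k + 2) / real (k + 1)) \<le> 1 / real (k + 1)"
    using ln_add_one_self_le_self[of "1 / real (k + 1)"] by (simp add: add_divide_distrib[symmetric] field_simps)
  then have ln: "- (\<gamma> / real (k + 1)) \<le> - \<gamma> * ln (real (k + 2) / real (k + 1))"
    using assms mult_left_mono[of _ "1 / real (k + 1)" \<gamma>] by fastforce
  have "1 - \<gamma> / real (k + 1) \<le> exp (- (\<gamma> / real (k + 1)))"
    using exp_ge_add_one_self[of "- (\<gamma> / real (k + 1))"] by simp
  also have "\<dots> \<le> exp (- \<gamma> * ln (real (k + 2) / real (k + 1)))"
    using ln by simp
  also have "\<dots> = (real (k + 2) / real (k + 1)) powr - \<gamma>"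
    by (simp add: powr_def)
  finally have le: "1 - \<gamma> / real (k + 1) \<le> (real (k + 2) / real (k + 1)) powr - \<gamma>" .
  have "bcoef (\<gamma> - 1) (Suc k) = bcoef (\<gamma> - 1) k * (1 - \<gamma> / real (k + 1))"
    by (simp add: bcoef_Suc field_simps)
  also have "\<dots> \<le> real (k + 1) powr (- \<gamma>) * (real (k + 2) / real (k + 1)) powr - \<gamma>"
    using Suc le pos by (intro mult_mono) auto
  also have "\<dots> = real (Suc k + 1) powr (- \<gamma>)"
    by (subst powr_mult[symmetric]) auto
  finally show ?case .
qed simp

lemma bcoef_tendsto_0:
  assumes "0 < \<gamma>" "\<gamma> < 1"
  shows "bcoef (\<gamma> - 1) \<longlonglongrightarrow> 0"
proof (rule tendsto_sandwich[OF _ _ tendsto_const])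
  show "\<forall>\<^sub>F k in sequentially. 0 \<le> bcoef (\<gamma> - 1) k"
    using assms bcoef_nonneg by simp
  show "\<forall>\<^sub>F k in sequentially. bcoef (\<gamma> - 1) k \<le> real (k + 1) powr (- \<gamma>)"
    using assms bcoef_decay by simp
  have "filterlim (\<lambda>k. real (k + 1)) at_top sequentially"
    by (intro filterlim_compose[OF filterlim_real_sequentially filterlim_add_const_nat_at_top])
  then show "(\<lambda>k. real (k + 1) powr (- \<gamma>)) \<longlonglongrightarrow> 0"
    using assms by (intro tendsto_neg_powr) auto
qed

text \<open>After the leading 1 all coefficients are nonpositive, being differences of a decreasing
  sequence; their absolute values telescope to at most another 1.\<close>

lemma sum_abs_bcoef_le:
  assumes "0 < \<gamma>" "\<gamma> < 1"
  shows "(\<Sum>k<n. \<bar>bcoef \<gamma> k\<bar>) \<le> 2"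
proof (cases n)
  case (Suc n')
  have a: "\<bar>bcoef \<gamma> (Suc k)\<bar> = bcoef (\<gamma> - 1) k - bcoef (\<gamma> - 1) (Suc k)" for k
  proof -
    have "bcoef (\<gamma> - 1) (Suc k) \<le> bcoef (\<gamma> - 1) k"
      unfolding bcoef_Suc using assms bcoef_nonneg[of "\<gamma> - 1" k]
      by (intro mult_right_le_one_le) (auto simp: field_simps)
    then show ?thesis unfolding bcoef_Suc_diff[of \<gamma> k] by simp
  qed
  have "(\<Sum>k<n. \<bar>bcoef \<gamma> k\<bar>) = 1 + (\<Sum>k<n'. \<bar>bcoef \<gamma> (Suc k)\<bar>)"
    unfolding Suc by (subst sum.lessThan_Suc_shift) simp
  also have "\<dots> = 2 - bcoef (\<gamma> - 1) n'"
    unfolding a by (subst sum_lessThan_telescope') simp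
  also have "\<dots> \<le> 2" using assms bcoef_nonneg[of "\<gamma> - 1"] by simp
  finally show ?thesis .
qed simp

lemma summable_abs_bcoef:
  assumes "0 < \<gamma>" "\<gamma> < 1"
  shows "summable (\<lambda>k. \<bar>bcoef \<gamma> k\<bar>)"
  using sum_abs_bcoef_le[OF assms] by (intro summableI_nonneg_bounded[of _ 2]) auto

text \<open>Absolute summability gives uniform convergence up to the boundary. The identity with the
  power holds in the open disc and extends by continuity of both sides; at z = 0 this uses that the
  principal power with \<gamma> > 0 tends to its value 0.\<close>

lemma binomial_series_uniform_limit:
  assumes g: "0 < \<gamma>" "\<gamma> < 1"
  shows "uniform_limit (cball 1 1) (\<lambda>n z. \<Sum>k<n. complex_of_real (bcoef \<gamma> k) * (1 - z) ^ k)
           (\<lambda>z. z powr complex_of_real \<gamma>) sequentially"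
proof -
  let ?S = "\<lambda>w. \<Sum>k. complex_of_real (bcoef \<gamma> k) * w ^ k"
  have lim: "uniform_limit (cball 0 1) (\<lambda>n w. \<Sum>k<n. complex_of_real (bcoef \<gamma> k) * w ^ k) ?S sequentially"
  proof (rule Weierstrass_m_test)
    show "norm (complex_of_real (bcoef \<gamma> k) * w ^ k) \<le> \<bar>bcoef \<gamma> k\<bar>" if "w \<in> cball 0 1" for k w
      using that by (simp add: norm_mult norm_power mult_left_le power_le_one)
    show "summable (\<lambda>k. \<bar>bcoef \<gamma> k\<bar>)" by (rule summable_abs_bcoef[OF g])
  qed
  have cont: "continuous_on (cball 0 1) ?S"
    by (rule uniform_limit_theorem[OF _ lim]) (auto intro!: always_eventually continuous_intros)
  have inner_eq: "?S w = (1 - w) powr complex_of_real \<gamma>" if "norm w < 1" for w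
  proof -
    have "(\<lambda>k. complex_of_real (bcoef \<gamma> k) * w ^ k) sums (1 + (- w)) powr complex_of_real \<gamma>"
      using gen_binomial_complex[of "- w" "complex_of_real \<gamma>"] that
      by (simp add: of_real_bcoef power_minus[of w] mult_ac)
    then show ?thesis by (simp add: sums_iff)
  qed
  have contp: "continuous_on (cball 0 1) (\<lambda>w. (1 - w) powr complex_of_real \<gamma>)"
  proof (unfold continuous_on_def, intro ballI)
    fix w :: complex assume w: "w \<in> cball 0 1"
    \<comment> \<open>The shifted disc meets the branch cut only at its tip 0, where the power is
      still continuous.\<close>
    have "1 - w \<notin> \<real>\<^sub>\<le>\<^sub>0 \<or> 1 - w = 0"
    proof (rule disjCI)
      assume "1 - w \<noteq> 0"
      show "1 - w \<notin> \<real>\<^sub>\<le>\<^sub>0"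
      proof
        assume "1 - w \<in> \<real>\<^sub>\<le>\<^sub>0"
        then have "1 \<le> Re w" "Im w = 0" by (auto simp: complex_nonpos_Reals_iff)
        moreover have "Re w \<le> 1" using w abs_Re_le_cmod[of w] by auto
        ultimately have "w = 1" by (simp add: complex_eq_iff)
        then show False using \<open>1 - w \<noteq> 0\<close> by simp
      qed
    qed
    then show "((\<lambda>w. (1 - w) powr complex_of_real \<gamma>) \<longlongrightarrow> (1 - w) powr complex_of_real \<gamma>) (at w within cball 0 1)"
      using g by (intro tendsto_powr_complex' tendsto_intros) auto
  qed
  have eq: "?S w = (1 - w) powr complex_of_real \<gamma>" if "w \<in> cball 0 1" for w
  proof -
    have "?S w - (1 - w) powr complex_of_real \<gamma> = 0"
    proof (rule continuous_constant_on_closure[of "ball 0 1" "\<lambda>w. ?S w - (1 - w) powr complex_of_real \<gamma>"])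
      show "continuous_on (closure (ball 0 1)) (\<lambda>w. ?S w - (1 - w) powr complex_of_real \<gamma>)"
        using cont contp by (simp add: continuous_on_diff)
    qed (use inner_eq that in auto)
    then show ?thesis by simp
  qed
  show ?thesis
    unfolding uniform_limit_iff
  proof (intro allI impI)
    fix e :: real assume "0 < e"
    then have "\<forall>\<^sub>F n in sequentially. \<forall>w\<in>cball 0 1. dist (\<Sum>k<n. complex_of_real (bcoef \<gamma> k) * w ^ k) (?S w) < e"
      using lim unfolding uniform_limit_iff by blast
    then show "\<forall>\<^sub>F n in sequentially. \<forall>z\<in>cball 1 1.
        dist (\<Sum>k<n. complex_of_real (bcoef \<gamma> k) * (1 - z) ^ k) (z powr complex_of_real \<gamma>) < e"
    proof (rule eventually_mono, intro ballI)
      fix n and z :: complex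
      assume a: "\<forall>w\<in>cball 0 1. dist (\<Sum>k<n. complex_of_real (bcoef \<gamma> k) * w ^ k) (?S w) < e" and "z \<in> cball 1 1"
      then have "1 - z \<in> cball 0 1" by (simp add: dist_norm norm_minus_commute)
      then show "dist (\<Sum>k<n. complex_of_real (bcoef \<gamma> k) * (1 - z) ^ k) (z powr complex_of_real \<gamma>) < e"
        using bspec[OF a, of "1 - z"] eq[of "1 - z"] by simp
    qed
  qed
qed

section \<open>Fractional powers of the Laplacian as a binomial series\<close>

lemma Lp_norm_2_le:
  fixes f g :: "'a \<Rightarrow> 'b::real_normed_vector"
  assumes m: "\<And>x. 0 \<le> m x" and K: "0 \<le> K"
    and b: "\<And>A. finite A \<Longrightarrow> (\<Sum>x\<in>A. (norm (f x))\<^sup>2 * m x) \<le> K\<^sup>2 * N"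
  shows "f \<in> Lp_space m 2" and "Lp_norm m 2 f \<le> K * sqrt N"
proof -
  have b': "(\<Sum>x\<in>A. norm (f x) powr 2 * m x) \<le> K\<^sup>2 * N" if "finite A" for A
    using b[OF that] by simp
  show "f \<in> Lp_space m 2" using m b' by (rule Lp_space_bound(1))
  have "(\<Sum>\<^sub>\<infinity>x. norm (f x) powr 2 * m x) \<le> K\<^sup>2 * N" using m b' by (rule Lp_space_bound(2))
  moreover have "0 \<le> (\<Sum>\<^sub>\<infinity>x. norm (f x) powr 2 * m x)" using m by (intro infsum_nonneg) auto
  ultimately have "Lp_norm m 2 f \<le> sqrt (K\<^sup>2 * N)"
    by (simp add: Lp_norm_def powr_half_sqrt)
  then show "Lp_norm m 2 f \<le> K * sqrt N"
    using K by (simp add: real_sqrt_mult)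
qed

lemma Lp_norm_2_square_le:
  fixes f :: "'a \<Rightarrow> 'b::real_normed_vector"
  assumes m: "\<And>x. 0 \<le> m x" and f: "f \<in> Lp_space m 2" and "finite A"
  shows "(\<Sum>x\<in>A. (norm (f x))\<^sup>2 * m x) \<le> (Lp_norm m 2 f)\<^sup>2"
proof -
  have "0 \<le> (\<Sum>\<^sub>\<infinity>x. norm (f x) powr 2 * m x)" using m by (intro infsum_nonneg) auto
  then have "(Lp_norm m 2 f)\<^sup>2 = (\<Sum>\<^sub>\<infinity>x. norm (f x) powr 2 * m x)"
    by (simp add: Lp_norm_def powr_half_sqrt)
  then show ?thesis using Lp_space_finite_sum_le[OF m f assms(3)] by simp
qed

context lb_graph
begin

section \<open>Absolutely convergent power series in P on L^2\<close>

lemma sum_P_pow_sq_le: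
  assumes f: "f \<in> Lp_space m 2" and A: "finite A"
  shows "(\<Sum>x\<in>A. (norm ((P ^^ k) f x))\<^sup>2 * m x) \<le> (Lp_norm m 2 f)\<^sup>2"
  using A
proof (induction k arbitrary: A)
  case 0
  then show ?case using Lp_norm_2_square_le[OF m_nonneg f] by simp
next
  case (Suc k)
  have "(\<Sum>x\<in>A. (norm ((P ^^ Suc k) f x))\<^sup>2 * m x)
      \<le> (\<Sum>x\<in>(\<Union>x\<in>A. nbrs \<mu> x). (norm ((P ^^ k) f x))\<^sup>2 * m x)"
    using sum_P_sq_le[OF Suc.prems] by simp
  also have "\<dots> \<le> (Lp_norm m 2 f)\<^sup>2"
    using Suc.prems finite_nbrs by (intro Suc.IH) auto
  finally show ?case .
qed

lemma norm_P_pow_le: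
  assumes f: "f \<in> Lp_space m 2"
  shows "norm ((P ^^ k) f x) \<le> \<bar>Lp_norm m 2 f\<bar> / sqrt (m x)"
proof -
  have "(norm ((P ^^ k) f x))\<^sup>2 * m x \<le> (Lp_norm m 2 f)\<^sup>2"
    using sum_P_pow_sq_le[OF f, of "{x}"] by simp
  then have "(norm ((P ^^ k) f x))\<^sup>2 \<le> (\<bar>Lp_norm m 2 f\<bar> / sqrt (m x))\<^sup>2"
    using m_pos[of x] by (simp add: power_divide field_simps)
  then show ?thesis
    by (rule power2_le_imp_le) (simp add: m_nonneg)
qed

lemma summable_P_pow:
  fixes f :: "'a \<Rightarrow> complex"
  assumes f: "f \<in> Lp_space m 2" and c: "summable (\<lambda>k. norm (c k))"
  shows "summable (\<lambda>k. c k * (P ^^ k) f x)"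
proof (rule summable_comparison_test)
  show "\<exists>N. \<forall>k\<ge>N. norm (c k * (P ^^ k) f x) \<le> norm (c k) * (\<bar>Lp_norm m 2 f\<bar> / sqrt (m x))"
    unfolding norm_mult by (intro exI[of _ 0] allI impI mult_left_mono norm_P_pow_le f norm_ge_zero)
  show "summable (\<lambda>k. norm (c k) * (\<bar>Lp_norm m 2 f\<bar> / sqrt (m x)))"
    using c by (rule summable_mult2)
qed

text \<open>Cauchy-Schwarz with the weights |c_k| reduces partial sums to the contractivity of each
  P^k; the finite window A lets the limit in the number of terms pass through.\<close>

lemma sum_suminf_P_pow_sq_le:
  fixes f :: "'a \<Rightarrow> complex"
  assumes f: "f \<in> Lp_space m 2" and c: "summable (\<lambda>k. norm (c k))" and A: "finite A"
  shows "(\<Sum>x\<in>A. (norm (\<Sum>k. c k * (P ^^ k) f x))\<^sup>2 * m x) \<le> (\<Sum>k. norm (c k))\<^sup>2 * (Lp_norm m 2 f)\<^sup>2"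
proof (rule LIMSEQ_le_const2)
  show "(\<lambda>n. \<Sum>x\<in>A. (norm (\<Sum>k<n. c k * (P ^^ k) f x))\<^sup>2 * m x)
      \<longlonglongrightarrow> (\<Sum>x\<in>A. (norm (\<Sum>k. c k * (P ^^ k) f x))\<^sup>2 * m x)"
    by (intro tendsto_intros summable_LIMSEQ summable_P_pow f c)
  have "(\<Sum>x\<in>A. (norm (\<Sum>k<n. c k * (P ^^ k) f x))\<^sup>2 * m x) \<le> (\<Sum>k. norm (c k))\<^sup>2 * (Lp_norm m 2 f)\<^sup>2" for n
  proof -
    let ?s = "\<Sum>k<n. norm (c k)"
    have le: "(norm (\<Sum>k<n. c k * (P ^^ k) f x))\<^sup>2 \<le> ?s * (\<Sum>k<n. norm (c k) * (norm ((P ^^ k) f x))\<^sup>2)" for x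
    proof -
      \<comment> \<open>Splitting off the phase leaves a nonnegative weight |c_k|, as
        \<open>power2_norm_sum_le\<close> requires.\<close>
      have "c k * (P ^^ k) f x = norm (c k) *\<^sub>R (sgn (c k) * (P ^^ k) f x)" for k
        by (cases "c k = 0") (auto simp: sgn_eq scaleR_conv_of_real)
      then have "(norm (\<Sum>k<n. c k * (P ^^ k) f x))\<^sup>2
          \<le> ?s * (\<Sum>k<n. norm (c k) * (norm (sgn (c k) * (P ^^ k) f x))\<^sup>2)"
        by (simp only:) (intro power2_norm_sum_le, auto)
      also have "\<dots> \<le> ?s * (\<Sum>k<n. norm (c k) * (norm ((P ^^ k) f x))\<^sup>2)"
        by (intro mult_left_mono sum_mono sum_nonneg power_mono) (auto simp: norm_mult norm_sgn)
      finally show ?thesis .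
    qed
    have "(\<Sum>x\<in>A. (norm (\<Sum>k<n. c k * (P ^^ k) f x))\<^sup>2 * m x)
        \<le> (\<Sum>x\<in>A. ?s * (\<Sum>k<n. norm (c k) * (norm ((P ^^ k) f x))\<^sup>2) * m x)"
      by (intro sum_mono mult_right_mono le m_nonneg)
    also have "\<dots> = ?s * (\<Sum>k<n. norm (c k) * (\<Sum>x\<in>A. (norm ((P ^^ k) f x))\<^sup>2 * m x))"
      unfolding sum_distrib_left sum_distrib_right
      by (subst sum.swap) (simp add: mult_ac)
    also have "\<dots> \<le> ?s * (\<Sum>k<n. norm (c k) * (Lp_norm m 2 f)\<^sup>2)"
      using f A by (intro mult_left_mono sum_mono sum_P_pow_sq_le sum_nonneg) auto
    also have "\<dots> = ?s\<^sup>2 * (Lp_norm m 2 f)\<^sup>2"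
      by (simp add: power2_eq_square mult.assoc flip: sum_distrib_right)
    also have "\<dots> \<le> (\<Sum>k. norm (c k))\<^sup>2 * (Lp_norm m 2 f)\<^sup>2"
      using c by (intro mult_right_mono power_mono sum_le_suminf sum_nonneg) auto
    finally show ?thesis .
  qed
  then show "\<exists>N. \<forall>n\<ge>N. (\<Sum>x\<in>A. (norm (\<Sum>k<n. c k * (P ^^ k) f x))\<^sup>2 * m x)
      \<le> (\<Sum>k. norm (c k))\<^sup>2 * (Lp_norm m 2 f)\<^sup>2" by blast
qed

lemma P_suminf_P_pow:
  fixes f :: "'a \<Rightarrow> complex"
  assumes f: "f \<in> Lp_space m 2" and c: "summable (\<lambda>k. norm (c k))"
  shows "(\<lambda>k. c k * (P ^^ Suc k) f x) sums P (\<lambda>x. \<Sum>k. c k * (P ^^ k) f x) x"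
proof -
  have "(\<lambda>k. \<Sum>y\<in>nbrs \<mu> x. (\<mu> x y / m x) *\<^sub>R (c k * (P ^^ k) f y))
      sums (\<Sum>y\<in>nbrs \<mu> x. (\<mu> x y / m x) *\<^sub>R (\<Sum>k. c k * (P ^^ k) f y))"
    by (intro sums_sum sums_scaleR_right summable_sums summable_P_pow f c)
  moreover have "(\<Sum>y\<in>nbrs \<mu> x. (\<mu> x y / m x) *\<^sub>R (c k * (P ^^ k) f y)) = c k * (P ^^ Suc k) f x" for k
    by (simp add: P_eq_sum sum_distrib_left)
  ultimately show ?thesis by (simp add: P_eq_sum[of "\<lambda>x. \<Sum>k. c k * (P ^^ k) f x"])
qed

text \<open>The Neumann series in \<open>P = 1 - \<Delta>\<close>.\<close>

lemma L2_spectrum_subset: "L2_spectrum m D \<subseteq> cball 1 1"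
proof
  fix z assume z: "z \<in> L2_spectrum m D"
  show "z \<in> cball 1 1"
  proof (rule ccontr)
    assume "z \<notin> cball 1 1"
    \<comment> \<open>With z = 1 + w one has z - Delta = w + P, and |w| > 1. The inverse is
      therefore 1/w times the series of (-P/w)^k, built as \<open>R\<close> from
      \<open>G\<close>.\<close>
    define w where "w = z - 1"
    have w: "norm w > 1"
      using \<open>z \<notin> cball 1 1\<close> by (simp add: w_def dist_norm norm_minus_commute)
    then have w0: "w \<noteq> 0" by auto
    define c where "c k = (-1 / w) ^ k" for k
    define G where "G f = (\<lambda>x. \<Sum>k. c k * (P ^^ k) f x)" for f
    define R where "R f = (\<lambda>x. G f x / w)" for f :: "'a \<Rightarrow> complex"
    have "norm (norm (- 1 / w)) < 1" using w by (simp add: norm_divide divide_simps)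
    then have cs: "summable (\<lambda>k. norm (c k))"
      unfolding c_def norm_power by (rule summable_geometric)
    have cSuc: "w * c (Suc k) = - c k" for k using w0 by (simp add: c_def)
    have zD: "(\<lambda>x. z * f x - D f x) = (\<lambda>x. w * f x + P f x)" for f
      by (simp add: D_eq w_def algebra_simps)
    have sumsG: "(\<lambda>k. c k * (P ^^ k) f x) sums G f x" if "f \<in> Lp_space m 2" for f x
      unfolding G_def using that cs by (intro summable_sums summable_P_pow)
    have head: "(\<lambda>k. c (Suc k) * (P ^^ Suc k) f x) sums (G f x - f x)" if "f \<in> Lp_space m 2" for f x
      using sumsG[OF that, of x] by (subst sums_Suc_iff) (simp add: c_def)
    have shift: "(\<lambda>k. c k * (P ^^ Suc k) f x) sums (w * f x - w * G f x)" if "f \<in> Lp_space m 2" for f x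
    proof -
      have "(\<lambda>k. (- w) * (c (Suc k) * (P ^^ Suc k) f x)) sums ((- w) * (G f x - f x))"
        by (rule sums_mult[OF head[OF that]])
      moreover have "(- w) * (c (Suc k) * (P ^^ Suc k) f x) = c k * (P ^^ Suc k) f x" for k
        using cSuc[of k] by (metis mult.assoc mult_minus_left minus_minus)
      ultimately show ?thesis by (simp add: algebra_simps)
    qed
    have PG: "P (G f) x = w * f x - w * G f x" if "f \<in> Lp_space m 2" for f x
      using P_suminf_P_pow[OF that cs, of x] shift[OF that, of x] unfolding G_def by (rule sums_unique2)
    have inv2: "(\<lambda>x. z * R f x - D (R f) x) = f" if "f \<in> Lp_space m 2" for f
    proof -
      have PR: "P (R f) = (\<lambda>x. P (G f) x / w)"
        using P_mult[of "1 / w" "G f"] by (simp add: R_def)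
      have "w * R f x + P (R f) x = f x" for x
        using w0 by (simp only: PR PG[OF that]) (simp add: R_def field_simps)
      then show ?thesis unfolding zD by blast
    qed
    have inv1: "R (\<lambda>x. z * f x - D f x) = f" if f: "f \<in> Lp_space m 2" for f
    proof -
      have Pk: "(P ^^ k) (\<lambda>x. w * f x + P f x) = (\<lambda>x. w * (P ^^ k) f x + (P ^^ Suc k) f x)" for k
        by (induction k) (simp_all add: P_add P_mult funpow_swap1)
      have "(\<lambda>k. w * (c k * (P ^^ k) f x) + c k * (P ^^ Suc k) f x) sums (w * G f x + (w * f x - w * G f x))" for x
        by (intro sums_add sums_mult sumsG shift f)
      then have "G (\<lambda>x. w * f x + P f x) x = w * f x" for x
        unfolding G_def Pk by (simp add: sums_iff algebra_simps)
      then show ?thesis unfolding zD R_def using w0 by (simp add: fun_eq_iff)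
    qed
    have "L2_bounded m R"
      unfolding L2_bounded_def
    proof (intro exI ballI)
      fix f :: "'a \<Rightarrow> complex" assume f: "f \<in> Lp_space m 2"
      let ?K = "(\<Sum>k. norm (c k)) / norm w"
      have b: "(\<Sum>x\<in>A. (norm (R f x))\<^sup>2 * m x) \<le> ?K\<^sup>2 * (Lp_norm m 2 f)\<^sup>2" if "finite A" for A
      proof -
        have "(\<Sum>x\<in>A. (norm (R f x))\<^sup>2 * m x) = (\<Sum>x\<in>A. (norm (G f x))\<^sup>2 * m x) / (norm w)\<^sup>2"
          by (simp add: R_def norm_divide power_divide sum_divide_distrib)
        also have "\<dots> \<le> (\<Sum>k. norm (c k))\<^sup>2 * (Lp_norm m 2 f)\<^sup>2 / (norm w)\<^sup>2"
          unfolding G_def by (intro divide_right_mono sum_suminf_P_pow_sq_le f cs that) auto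
        finally show ?thesis by (simp add: power_divide)
      qed
      have "0 \<le> Lp_norm m 2 f" by (simp add: Lp_norm_def)
      moreover have "0 \<le> ?K" using cs by (intro divide_nonneg_nonneg suminf_nonneg) auto
      ultimately show "R f \<in> Lp_space m 2 \<and> Lp_norm m 2 (R f) \<le> ?K * Lp_norm m 2 f"
        using Lp_norm_2_le[where f = "R f", OF m_nonneg _ b] by simp
    qed
    then show False using z inv1 inv2 unfolding L2_spectrum_def by blast
  qed
qed

text \<open>Partial sums of the binomial series at w = 1 - z, expressed in z so that inserting Delta
  turns 1 - z into P.\<close>

definition spoly :: "real \<Rightarrow> nat \<Rightarrow> complex poly" where
  "spoly \<gamma> n = (\<Sum>k<n. smult (complex_of_real (bcoef \<gamma> k)) ([:1, -1:] ^ k))"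

lemma poly_spoly: "poly (spoly \<gamma> n) z = (\<Sum>k<n. complex_of_real (bcoef \<gamma> k) * (1 - z) ^ k)"
  by (simp add: spoly_def poly_sum)

lemma poly_op_spoly: "poly_op (spoly \<gamma> n) D f = (\<lambda>x. \<Sum>k<n. complex_of_real (bcoef \<gamma> k) * (P ^^ k) f x)"
proof -
  have X: "poly_op [:1, -1:] D g = P g" for g
  proof -
    have "D (\<lambda>x. 0) = (\<lambda>x. 0)" by (simp add: D_eq P_const)
    moreover have "D (\<lambda>x. - g x) = (\<lambda>x. - D g x)" using D_mult[of "-1" g] by simp
    ultimately show ?thesis by (simp add: poly_op_pCons poly_op_0) (simp add: D_eq)
  qed
  have pow: "poly_op ([:1, -1:] ^ k) D f = (P ^^ k) f" for k
  proof (induction k)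
    case 0
    then show ?case by (simp add: poly_op_def)
  next
    case (Suc k)
    then show ?case by (simp only: power_Suc poly_op_mult X) simp
  qed
  show ?thesis
    unfolding spoly_def by (induction n) (simp_all add: poly_op_0 poly_op_add poly_op_smult pow)
qed

lemma cmod_spoly_le:
  assumes "0 < \<gamma>" "\<gamma> < 1" "z \<in> cball 1 1"
  shows "cmod (poly (spoly \<gamma> n) z) \<le> 2"
proof -
  have "cmod (poly (spoly \<gamma> n) z) \<le> (\<Sum>k<n. \<bar>bcoef \<gamma> k\<bar>)"
    unfolding poly_spoly using assms(3)
    by (intro sum_norm_le) (auto simp: norm_mult norm_power dist_norm intro!: mult_left_le power_le_one)
  then show ?thesis using sum_abs_bcoef_le[OF assms(1,2), of n] by simp
qed

text \<open>The spectral bound for p minus a partial sum, passed to the limit on finite vertex sets.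
  The polynomial p is arbitrary because the functional calculus quantifies over all approximating
  sequences, and only eventual closeness is asked of the partial sums.\<close>

lemma poly_op_diff_series_bound:
  assumes g: "0 < \<gamma>" "\<gamma> < 1" and f: "fin_supp f" and M: "0 \<le> M"
    and ev: "\<forall>\<^sub>F n in sequentially. \<forall>z\<in>L2_spectrum m D. cmod (poly p z - poly (spoly \<gamma> n) z) \<le> M"
  defines "h \<equiv> \<lambda>x. poly_op p D f x - (\<Sum>k. complex_of_real (bcoef \<gamma> k) * (P ^^ k) f x)"
  shows "h \<in> Lp_space m 2" and "Lp_norm m 2 h \<le> M * sqrt (wip m f f)"
proof -
  have f2: "f \<in> Lp_space m 2" using f m_nonneg by (rule Lp_norm_2_fin_supp)
  have cs: "summable (\<lambda>k. norm (complex_of_real (bcoef \<gamma> k)))"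
    using summable_abs_bcoef[OF g] by simp
  have "(\<Sum>x\<in>A. (norm (h x))\<^sup>2 * m x) \<le> M\<^sup>2 * wip m f f" if A: "finite A" for A
  proof (rule tendsto_upperbound)
    show "((\<lambda>n. \<Sum>x\<in>A. (norm (poly_op p D f x - poly_op (spoly \<gamma> n) D f x))\<^sup>2 * m x)
        \<longlongrightarrow> (\<Sum>x\<in>A. (norm (h x))\<^sup>2 * m x)) sequentially"
      unfolding h_def poly_op_spoly by (intro tendsto_intros summable_LIMSEQ summable_P_pow f2 cs)
    show "\<forall>\<^sub>F n in sequentially.
        (\<Sum>x\<in>A. (norm (poly_op p D f x - poly_op (spoly \<gamma> n) D f x))\<^sup>2 * m x) \<le> M\<^sup>2 * wip m f f"
      using ev
    proof (rule eventually_mono)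
      fix n assume n: "\<forall>z\<in>L2_spectrum m D. cmod (poly p z - poly (spoly \<gamma> n) z) \<le> M"
      let ?q = "p + smult (-1) (spoly \<gamma> n)"
      have eq: "poly_op ?q D f = (\<lambda>x. poly_op p D f x - poly_op (spoly \<gamma> n) D f x)"
        unfolding poly_op_add poly_op_smult by simp
      have fq: "fin_supp (poly_op ?q D f)" using f by (rule fin_supp_poly_op)
      have "(\<Sum>x\<in>A. (norm (poly_op ?q D f x))\<^sup>2 * m x)
          \<le> (\<Sum>x\<in>A \<union> {x. poly_op ?q D f x \<noteq> 0}. (norm (poly_op ?q D f x))\<^sup>2 * m x)"
        using A fq m_nonneg by (intro sum_mono2) auto
      also have "\<dots> = wip m (poly_op ?q D f) (poly_op ?q D f)"
        unfolding wip_self using A fq by (intro sum.mono_neutral_right) auto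
      also have "\<dots> \<le> M\<^sup>2 * wip m f f"
        using f n by (intro poly_op_spectral_bound) auto
      finally show "(\<Sum>x\<in>A. (norm (poly_op p D f x - poly_op (spoly \<gamma> n) D f x))\<^sup>2 * m x) \<le> M\<^sup>2 * wip m f f"
        unfolding eq .
    qed
  qed simp
  note b = this
  show "h \<in> Lp_space m 2"
    by (rule Lp_norm_2_le(1)[where f = h and m = m, OF m_nonneg M b])
  show "Lp_norm m 2 h \<le> M * sqrt (wip m f f)"
    by (rule Lp_norm_2_le(2)[where f = h and m = m, OF m_nonneg M b])
qed

text \<open>The definite description is resolved in two halves: the series is a limit along every
  admissible sequence, and the single sequence \<open>spoly\<close> determines the limit
  uniquely.\<close>

lemma laplacian_power_eq_series:
  assumes g: "0 < \<gamma>" "\<gamma> < 1" and f: "fin_supp f"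
  shows "laplacian_power \<mu> \<gamma> f = (\<lambda>x. \<Sum>k. complex_of_real (bcoef \<gamma> k) * (P ^^ k) f x)"
    (is "_ = ?g")
proof -
  let ?h = "\<lambda>z. z powr complex_of_real \<gamma>"
  have f2: "f \<in> Lp_space m 2" using f m_nonneg by (rule Lp_norm_2_fin_supp)
  have cs: "summable (\<lambda>k. norm (complex_of_real (bcoef \<gamma> k)))"
    using summable_abs_bcoef[OF g] by simp
  have sp: "uniform_limit (L2_spectrum m D) (\<lambda>n. poly (spoly \<gamma> n)) ?h sequentially"
    using uniform_limit_on_subset[OF binomial_series_uniform_limit[OF g] L2_spectrum_subset]
    by (simp add: poly_spoly[abs_def])
  \<comment> \<open>Comparison with the zero polynomial: the partial sums are bounded by 2 on the
    disc, so the series lies in L^2.\<close>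
  have "(\<lambda>x. poly_op 0 D f x - ?g x) \<in> Lp_space m 2"
    using cmod_spoly_le[OF g] L2_spectrum_subset
    by (intro poly_op_diff_series_bound(1)[OF g f, of 2]) (auto intro!: always_eventually)
  then have g2: "?g \<in> Lp_space m 2" by (simp add: poly_op_0 Lp_space_def)
  show ?thesis
    unfolding laplacian_power_def L2_fun_calc_def
  proof (rule the_equality, intro conjI allI impI)
    show "?g \<in> Lp_space m 2" by (rule g2)
  next
    fix q n assume "uniform_limit (L2_spectrum m D) (\<lambda>n. poly (q n)) ?h sequentially"
    have "bounded (poly (q n) ` cball 1 1)"
      by (intro compact_imp_bounded compact_continuous_image continuous_intros) auto
    then obtain B where "\<forall>y\<in>poly (q n) ` cball 1 1. cmod y \<le> B"
      unfolding bounded_iff by blast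
    then have B: "cmod (poly (q n) z) \<le> B" if "z \<in> cball 1 1" for z
      using that by blast
    have "0 \<le> B" using B[of 1] norm_ge_zero[of "poly (q n) 1"] by (simp del: norm_ge_zero)
    have "cmod (poly (q n) z - poly (spoly \<gamma> k) z) \<le> B + 2" if "z \<in> cball 1 1" for z k
      using norm_triangle_ineq4[of "poly (q n) z" "poly (spoly \<gamma> k) z"] B[OF that] cmod_spoly_le[OF g that, of k] by simp
    then show "(\<lambda>x. poly_op (q n) D f x - ?g x) \<in> Lp_space m 2"
      using \<open>0 \<le> B\<close> L2_spectrum_subset
      by (intro poly_op_diff_series_bound(1)[OF g f, of "B + 2"]) (auto intro!: always_eventually)
  next
    fix q assume q: "uniform_limit (L2_spectrum m D) (\<lambda>n. poly (q n)) ?h sequentially"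
    show "(\<lambda>n. Lp_norm m 2 (\<lambda>x. poly_op (q n) D f x - ?g x)) \<longlonglongrightarrow> 0"
    proof (rule LIMSEQ_I)
      fix r :: real assume r: "0 < r"
      define t where "t = sqrt (wip m f f) + 1"
      have t: "0 < t" by (simp add: t_def add_nonneg_pos wip_self_nonneg m_nonneg)
      define e where "e = r / (2 * t)"
      have e: "0 < e" using r t by (simp add: e_def)
      have "2 * e * t = r" using t by (simp add: e_def)
      then have re: "2 * e * sqrt (wip m f f) < r"
        using e by (simp add: t_def distrib_left)
      have ev: "\<forall>\<^sub>F n in sequentially. \<forall>z\<in>L2_spectrum m D. dist (poly (spoly \<gamma> n) z) (?h z) < e"
        using sp e unfolding uniform_limit_iff by blast
      obtain N where N: "\<And>n z. n \<ge> N \<Longrightarrow> z \<in> L2_spectrum m D \<Longrightarrow> dist (poly (q n) z) (?h z) < e"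
        using q e unfolding uniform_limit_iff eventually_sequentially by blast
      have "norm (Lp_norm m 2 (\<lambda>x. poly_op (q n) D f x - ?g x) - 0) < r" if n: "n \<ge> N" for n
      proof -
        have "\<forall>\<^sub>F k in sequentially. \<forall>z\<in>L2_spectrum m D. cmod (poly (q n) z - poly (spoly \<gamma> k) z) \<le> 2 * e"
          using ev
        proof (rule eventually_mono, intro ballI)
          fix k z assume k: "\<forall>z\<in>L2_spectrum m D. dist (poly (spoly \<gamma> k) z) (?h z) < e" and z: "z \<in> L2_spectrum m D"
          have "dist (poly (q n) z) (poly (spoly \<gamma> k) z) < e + e"
            using N[OF n z] bspec[OF k z] by (intro dist_triangle_less_add)
          then show "cmod (poly (q n) z - poly (spoly \<gamma> k) z) \<le> 2 * e" by (simp add: dist_norm)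
        qed
        then have "Lp_norm m 2 (\<lambda>x. poly_op (q n) D f x - ?g x) \<le> 2 * e * sqrt (wip m f f)"
          using e by (intro poly_op_diff_series_bound(2)[OF g f]) auto
        moreover have "0 \<le> Lp_norm m 2 (\<lambda>x. poly_op (q n) D f x - ?g x)"
          by (simp add: Lp_norm_def)
        ultimately show ?thesis using re by simp
      qed
      then show "\<exists>N. \<forall>n\<ge>N. norm (Lp_norm m 2 (\<lambda>x. poly_op (q n) D f x - ?g x) - 0) < r" by blast
    qed
  next
    fix u assume u: "u \<in> Lp_space m 2 \<and>
      (\<forall>q. uniform_limit (L2_spectrum m D) (\<lambda>n. poly (q n)) ?h sequentially \<longrightarrow>
        (\<forall>n. (\<lambda>x. poly_op (q n) D f x - u x) \<in> Lp_space m 2) \<and>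
        (\<lambda>n. Lp_norm m 2 (\<lambda>x. poly_op (q n) D f x - u x)) \<longlonglongrightarrow> 0)"
    \<comment> \<open>Uniqueness: vertices have positive mass, so convergence in L^2 forces
      pointwise convergence, and two pointwise limits agree.\<close>
    let ?d = "\<lambda>n x. poly_op (spoly \<gamma> n) D f x - u x"
    have d: "?d n \<in> Lp_space m 2" "(\<lambda>n. Lp_norm m 2 (?d n)) \<longlonglongrightarrow> 0" for n
      using u sp by blast+
    show "u = ?g"
    proof
      fix x
      have "(\<lambda>n. ?d n x) \<longlonglongrightarrow> 0"
      proof (rule Lim_null_comparison)
        show "\<forall>\<^sub>F n in sequentially. norm (?d n x) \<le> \<bar>Lp_norm m 2 (?d n)\<bar> / sqrt (m x)"
          using norm_P_pow_le[OF d(1), of 0 _ x] by simp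
        show "(\<lambda>n. \<bar>Lp_norm m 2 (?d n)\<bar> / sqrt (m x)) \<longlonglongrightarrow> 0"
          using tendsto_divide_zero[OF tendsto_rabs_zero[OF d(2)]] by simp
      qed
      then have "(\<lambda>n. poly_op (spoly \<gamma> n) D f x) \<longlonglongrightarrow> u x"
        by (rule LIM_zero_cancel)
      moreover have "(\<lambda>n. poly_op (spoly \<gamma> n) D f x) \<longlonglongrightarrow> ?g x"
        unfolding poly_op_spoly by (intro summable_LIMSEQ summable_P_pow f2 cs)
      ultimately show "u x = ?g x" by (rule LIMSEQ_unique)
    qed
  qed
qed

text \<open>Summation by parts. The boundary term vanishes because the coefficients tend to 0 while
  P^n f stays bounded at each vertex.\<close>

lemma laplacian_power_sums:
  assumes g: "0 < \<gamma>" "\<gamma> < 1" and f: "fin_supp f"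
  shows "(\<lambda>k. complex_of_real (bcoef (\<gamma> - 1) k) * ((P ^^ k) f x - (P ^^ Suc k) f x)) sums laplacian_power \<mu> \<gamma> f x"
proof -
  have f2: "f \<in> Lp_space m 2" using f m_nonneg by (rule Lp_norm_2_fin_supp)
  have cs: "summable (\<lambda>k. norm (complex_of_real (bcoef \<gamma> k)))"
    using summable_abs_bcoef[OF g] by simp
  have parts: "(\<Sum>k<Suc n. complex_of_real (bcoef \<gamma> k) * (P ^^ k) f x)
      = (\<Sum>k<n. complex_of_real (bcoef (\<gamma> - 1) k) * ((P ^^ k) f x - (P ^^ Suc k) f x))
        + complex_of_real (bcoef (\<gamma> - 1) n) * (P ^^ n) f x" for n
  proof (induction n)
    case (Suc n)
    show ?case
      by (subst sum.lessThan_Suc, subst Suc) (simp add: bcoef_Suc_diff[of \<gamma> n] algebra_simps)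
  qed simp
  have "(\<lambda>n. \<Sum>k<n. complex_of_real (bcoef \<gamma> k) * (P ^^ k) f x) \<longlonglongrightarrow> laplacian_power \<mu> \<gamma> f x"
    unfolding laplacian_power_eq_series[OF assms] by (intro summable_LIMSEQ summable_P_pow f2 cs)
  then have L1: "(\<lambda>n. \<Sum>k<Suc n. complex_of_real (bcoef \<gamma> k) * (P ^^ k) f x) \<longlonglongrightarrow> laplacian_power \<mu> \<gamma> f x"
    by (rule LIMSEQ_Suc)
  have L2: "(\<lambda>n. complex_of_real (bcoef (\<gamma> - 1) n) * (P ^^ n) f x) \<longlonglongrightarrow> 0"
  proof (rule Lim_null_comparison)
    show "\<forall>\<^sub>F n in sequentially. norm (complex_of_real (bcoef (\<gamma> - 1) n) * (P ^^ n) f x)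
        \<le> bcoef (\<gamma> - 1) n * (\<bar>Lp_norm m 2 f\<bar> / sqrt (m x))"
    proof (intro always_eventually allI)
      fix n
      have "norm (complex_of_real (bcoef (\<gamma> - 1) n)) = bcoef (\<gamma> - 1) n"
        using bcoef_nonneg[of "\<gamma> - 1" n] g by simp
      then show "norm (complex_of_real (bcoef (\<gamma> - 1) n) * (P ^^ n) f x)
          \<le> bcoef (\<gamma> - 1) n * (\<bar>Lp_norm m 2 f\<bar> / sqrt (m x))"
        unfolding norm_mult using mult_left_mono[OF norm_P_pow_le[OF f2], of "bcoef (\<gamma> - 1) n" n x]
          bcoef_nonneg[of "\<gamma> - 1" n] g by simp
    qed
    show "(\<lambda>n. bcoef (\<gamma> - 1) n * (\<bar>Lp_norm m 2 f\<bar> / sqrt (m x))) \<longlonglongrightarrow> 0"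
      using bcoef_tendsto_0[OF g] by (rule tendsto_mult_left_zero)
  qed
  have "(\<lambda>n. (\<Sum>k<Suc n. complex_of_real (bcoef \<gamma> k) * (P ^^ k) f x)
      - complex_of_real (bcoef (\<gamma> - 1) n) * (P ^^ n) f x) \<longlonglongrightarrow> laplacian_power \<mu> \<gamma> f x - 0"
    by (rule tendsto_diff[OF L1 L2])
  then show ?thesis unfolding parts sums_def by simp
qed

end

section \<open>Balls and volumes\<close>

context lb_graph
begin

lemma gdist_le: "(x, y) \<in> edges \<mu> ^^ n \<Longrightarrow> gdist \<mu> x y \<le> n"
  unfolding gdist_def by (rule Least_le)

lemma gdist_path: "(x, y) \<in> edges \<mu> ^^ gdist \<mu> x y"
proof -
  obtain n where "(x, y) \<in> edges \<mu> ^^ n" using connected rtrancl_imp_relpow by metis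
  then show ?thesis unfolding gdist_def by (rule LeastI)
qed

lemma gdist_triangle: "gdist \<mu> x z \<le> gdist \<mu> x y + gdist \<mu> y z"
  using gdist_path[of x y] gdist_path[of y z] by (intro gdist_le) (auto simp: relpow_add)

lemma gdist_self [simp]: "gdist \<mu> x x = 0"
  using gdist_le[of x x 0] by simp

lemma edge_path_sym: "(x, y) \<in> edges \<mu> ^^ n \<Longrightarrow> (y, x) \<in> edges \<mu> ^^ n"
proof (induction n arbitrary: y)
  case (Suc n)
  then obtain z where z: "(x, z) \<in> edges \<mu> ^^ n" "(z, y) \<in> edges \<mu>" by auto
  then have "(y, z) \<in> edges \<mu>" using weight_sym[of y z] by (simp add: edges_def)
  then show ?case using Suc.IH[OF z(1)] by (metis relpow_Suc_I2)
qed auto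

lemma gdist_sym: "gdist \<mu> x y = gdist \<mu> y x"
  using gdist_path edge_path_sym gdist_le by (metis order_antisym)

lemma gdist_nbr: "y \<in> nbrs \<mu> x \<Longrightarrow> gdist \<mu> x y \<le> 1"
  by (intro gdist_le) (simp add: nbrs_def)

lemma finite_path_end: "finite {y. (x, y) \<in> edges \<mu> ^^ n}"
proof (induction n)
  case 0
  then show ?case by simp
next
  case (Suc n)
  have "{y. (x, y) \<in> edges \<mu> ^^ Suc n} = (\<Union>z\<in>{z. (x, z) \<in> edges \<mu> ^^ n}. nbrs \<mu> z)"
    by (auto simp: nbrs_def)
  then show ?case using Suc finite_nbrs by simp
qed

lemma finite_gdist_le: "finite {y. gdist \<mu> x y \<le> n}"
proof -
  have "{y. gdist \<mu> x y \<le> n} \<subseteq> (\<Union>i\<in>{..n}. {y. (x, y) \<in> edges \<mu> ^^ i})"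
    using gdist_path[of x] by auto
  then show ?thesis using finite_path_end by (meson finite_UN finite_atMost finite_subset)
qed

lemma finite_gball: "finite (gball \<mu> x r)"
proof -
  have "gball \<mu> x r \<subseteq> {y. gdist \<mu> x y \<le> nat \<lceil>r\<rceil>}"
    unfolding gball_def by (auto, linarith)
  then show ?thesis using finite_gdist_le by (rule finite_subset)
qed

lemma gball_center: "0 < r \<Longrightarrow> x \<in> gball \<mu> x r"
  by (simp add: gball_def)

lemma gball_mono: "r \<le> r' \<Longrightarrow> gball \<mu> x r \<subseteq> gball \<mu> x r'"
  by (auto simp: gball_def)

lemma gball_shift:
  assumes "y \<in> gball \<mu> x r'"
  shows "gball \<mu> x r \<subseteq> gball \<mu> y (r' + r)"
proof
  fix z assume "z \<in> gball \<mu> x r"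
  moreover have "real (gdist \<mu> y z) \<le> real (gdist \<mu> x y) + real (gdist \<mu> x z)"
    using gdist_triangle[of y z x] gdist_sym[of x y] by (simp flip: of_nat_add)
  ultimately show "z \<in> gball \<mu> y (r' + r)" using assms by (simp add: gball_def)
qed

lemma gball_sym: "y \<in> gball \<mu> x r \<longleftrightarrow> x \<in> gball \<mu> y r"
  by (simp add: gball_def gdist_sym)

lemma vol_eq_sum: "vol \<mu> x r = (\<Sum>y\<in>gball \<mu> x r. m y)"
  by (simp add: vol_def finite_gball)

lemma vol_pos: "0 < r \<Longrightarrow> 0 < vol \<mu> x r"
  unfolding vol_eq_sum using gball_center[of r x] m_pos finite_gball by (intro sum_pos) auto

lemma vol_le_vol: "gball \<mu> x r \<subseteq> gball \<mu> y r' \<Longrightarrow> vol \<mu> x r \<le> vol \<mu> y r'"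
  unfolding vol_eq_sum using m_nonneg finite_gball by (intro sum_mono2) auto

end

section \<open>The heat kernel and its discrete time derivative\<close>

context lb_graph
begin

abbreviation p :: "nat \<Rightarrow> 'a \<Rightarrow> 'a \<Rightarrow> real" where "p \<equiv> heat_kernel \<mu>"

abbreviation pt :: "'a \<Rightarrow> 'a \<Rightarrow> real" where "pt y \<equiv> indicator {y}"

lemma fin_supp_pt: "fin_supp (pt y)"
  by (rule finite_subset[of _ "{y}"]) (auto simp: indicator_def)

lemma P_pow_pt: "(P ^^ k) (pt y) x = p k x y * m y"
  using m_nz[of y] by (simp add: heat_kernel_def)

lemma wip_pt: "fin_supp f \<Longrightarrow> wip m f (pt x) = f x * m x"
  by (subst wip_eq_sum[of "{x}"]) (auto simp: indicator_def)

lemma p_nonneg: "0 \<le> p k x y"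
proof -
  have "0 \<le> (P ^^ k) (pt y) x" for x
  proof (induction k arbitrary: x)
    case (Suc k)
    then show ?case using weight_nonneg m_nonneg by (auto simp: P_eq_sum intro!: sum_nonneg)
  qed simp
  then show ?thesis using m_nonneg[of y] by (simp add: heat_kernel_def)
qed

lemma p_finite_range: "k < gdist \<mu> x y \<Longrightarrow> p k x y = 0"
proof -
  have "k < gdist \<mu> x y \<Longrightarrow> (P ^^ k) (pt y) x = 0" for x
  proof (induction k arbitrary: x)
    case 0
    then have "x \<noteq> y" by auto
    then show ?case by simp
  next
    case (Suc k)
    have "(P ^^ k) (pt y) z = 0" if "z \<in> nbrs \<mu> x" for z
      using gdist_nbr[OF that] gdist_triangle[of x y z] Suc.prems by (intro Suc.IH) simp
    then show ?case by (simp add: P_eq_sum[of "(P ^^ k) (pt y)"])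
  qed
  then show "k < gdist \<mu> x y \<Longrightarrow> p k x y = 0" by (simp add: heat_kernel_def)
qed

lemma P_pow_eq_kernel_sum:
  fixes u :: "'a \<Rightarrow> real"
  assumes "k \<le> n"
  shows "(P ^^ k) u x = (\<Sum>y | gdist \<mu> x y \<le> n. p k x y * u y * m y)"
proof -
  have "(P ^^ k) u x = (\<Sum>\<^sub>\<infinity>y. p k x y * u y * m y)"
    using finite_nbrs m_nz by (intro markov_power_kernel) auto
  also have "\<dots> = (\<Sum>\<^sub>\<infinity>y | gdist \<mu> x y \<le> n. p k x y * u y * m y)"
    using assms p_finite_range by (intro infsum_cong_neutral) (auto simp: not_le)
  finally show ?thesis using finite_gdist_le by simp
qed

definition kernel_diff :: "nat \<Rightarrow> 'a \<Rightarrow> 'a \<Rightarrow> real" where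
  "kernel_diff k x y = p k x y - p (Suc k) x y"

lemma P_pow_diff_eq_kernel_sum:
  fixes u :: "'a \<Rightarrow> real"
  shows "(P ^^ k) u x - (P ^^ Suc k) u x = (\<Sum>y | gdist \<mu> x y \<le> Suc k. kernel_diff k x y * (u y - c) * m y)"
proof -
  have *: "(P ^^ k) u x - (P ^^ Suc k) u x = (\<Sum>y | gdist \<mu> x y \<le> Suc k. kernel_diff k x y * u y * m y)" for u :: "'a \<Rightarrow> real"
    by (subst (1 2) P_pow_eq_kernel_sum[of _ "Suc k"])
      (auto simp: kernel_diff_def left_diff_distrib simp flip: sum_subtractf)
  have "(P ^^ k) (\<lambda>x. c) = (\<lambda>x. c)" for k
    by (induction k) (simp_all add: P_const)
  then have "(\<Sum>y | gdist \<mu> x y \<le> Suc k. kernel_diff k x y * c * m y) = 0"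
    using *[of "\<lambda>x. c"] by (simp add: P_const)
  then show ?thesis
    unfolding * by (simp add: right_diff_distrib left_diff_distrib sum_subtractf)
qed

lemma wip_P_pow_pt: "wip m ((P ^^ j) (pt x)) ((P ^^ j) (pt x)) = p (2 * j) x x * (m x)\<^sup>2"
proof -
  have "wip m ((P ^^ j) (pt x)) ((P ^^ j) (pt x)) = wip m ((P ^^ j) ((P ^^ j) (pt x))) (pt x)"
    using fin_supp_pt by (intro P_pow_selfadjoint[symmetric] fin_supp_P_pow)
  also have "(P ^^ j) ((P ^^ j) (pt x)) = (P ^^ (2 * j)) (pt x)"
    by (simp add: mult_2 funpow_add)
  also have "wip m ((P ^^ (2 * j)) (pt x)) (pt x) = (P ^^ (2 * j)) (pt x) x * m x"
    by (rule wip_pt[OF fin_supp_P_pow[OF fin_supp_pt]])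
  also have "\<dots> = p (2 * j) x x * (m x)\<^sup>2"
    by (simp only: P_pow_pt) (simp add: power2_eq_square)
  finally show ?thesis .
qed

text \<open>Write P^k (I - P) as P^j P^l (I - P) P^j and apply Cauchy-Schwarz between the point
  masses at x and y. The outer factors become on-diagonal kernels at time 2j, and the inner one
  supplies the decay in l.\<close>

lemma kernel_diff_square_le:
  assumes k: "k = 2 * j + l"
  shows "(kernel_diff k x y)\<^sup>2 \<le> p (2 * j) x x * p (2 * j) y y / (2 * \<epsilon>\<^sup>2 * (real (l + 1))\<^sup>2)"
proof -
  let ?g = "(P ^^ j) (pt y)" and ?e = "(P ^^ j) (pt x)"
  let ?d = "\<lambda>z. (P ^^ l) ?g z - (P ^^ Suc l) ?g z"
  have fs: "fin_supp ?g" "fin_supp ?e" "fin_supp ?d"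
    by (intro fin_supp_diff fin_supp_P_pow fin_supp_pt)+
  have "(P ^^ j) ?d = (\<lambda>z. (P ^^ k) (pt y) z - (P ^^ Suc k) (pt y) z)"
  proof -
    have "(P ^^ j) ((P ^^ l) ((P ^^ j) f)) = (P ^^ k) f" for f :: "'a \<Rightarrow> real"
      unfolding k by (simp add: mult_2 funpow_add flip: funpow_mult) (metis comp_apply funpow_add add.commute add.left_commute)
    from this[of "pt y"] this[of "P (pt y)"] show ?thesis
      unfolding P_pow_diff by (simp add: funpow_swap1)
  qed
  then have "(P ^^ j) ?d x = kernel_diff k x y * m y"
    by (simp only: P_pow_pt kernel_diff_def left_diff_distrib)
  then have "kernel_diff k x y * m x * m y = (P ^^ j) ?d x * m x" by simp
  also have "\<dots> = wip m ((P ^^ j) ?d) (pt x)"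
    using fs(3) by (intro wip_pt[symmetric] fin_supp_P_pow)
  also have "\<dots> = wip m ?d ?e"
    using fs fin_supp_pt by (intro P_pow_selfadjoint)
  finally have "(kernel_diff k x y * m x * m y)\<^sup>2 \<le> wip m ?d ?d * wip m ?e ?e"
    using wip_Cauchy_Schwarz[of m, OF m_nonneg fs(3,2)] by simp
  also have "\<dots> \<le> wip m ?g ?g / (2 * \<epsilon>\<^sup>2 * (real (l + 1))\<^sup>2) * wip m ?e ?e"
    using fs by (intro mult_right_mono wip_P_pow_diff_le wip_self_nonneg m_nonneg)
  also have "\<dots> = p (2 * j) x x * p (2 * j) y y / (2 * \<epsilon>\<^sup>2 * (real (l + 1))\<^sup>2) * (m x * m y)\<^sup>2"
    unfolding wip_P_pow_pt by (simp add: power_mult_distrib)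
  finally have "(kernel_diff k x y)\<^sup>2 * (m x * m y)\<^sup>2
      \<le> p (2 * j) x x * p (2 * j) y y / (2 * \<epsilon>\<^sup>2 * (real (l + 1))\<^sup>2) * (m x * m y)\<^sup>2"
    by (simp add: power_mult_distrib mult.assoc)
  moreover have "0 < (m x * m y)\<^sup>2" using m_nz by simp
  ultimately show ?thesis by (simp only: mult_le_cancel_right_pos)
qed

end

locale doubling_graph = lb_graph +
  fixes A :: real
  assumes A_ge_1: "1 \<le> A" and doubling: "0 < r \<Longrightarrow> vol \<mu> x (2 * r) \<le> A * vol \<mu> x r"
begin

lemma vol_dyadic: "0 < r \<Longrightarrow> vol \<mu> x (2 ^ j * r) \<le> A ^ j * vol \<mu> x r"
proof (induction j)
  case (Suc j)
  have "vol \<mu> x (2 ^ Suc j * r) \<le> A * vol \<mu> x (2 ^ j * r)"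
    using doubling[of "2 ^ j * r" x] Suc.prems by (simp add: mult.assoc)
  also have "\<dots> \<le> A * (A ^ j * vol \<mu> x r)"
    using Suc A_ge_1 by (intro mult_left_mono) auto
  finally show ?case by simp
qed simp

lemma vol_nearby:
  assumes "0 < r" "y \<in> gball \<mu> x (2 ^ i * r)"
  shows "vol \<mu> x r \<le> A ^ (i + 1) * vol \<mu> y r"
proof -
  have "2 ^ i * r + r \<le> 2 ^ (i + 1) * r" using assms(1) by simp
  then have "gball \<mu> x r \<subseteq> gball \<mu> y (2 ^ (i + 1) * r)"
    using gball_shift[OF assms(2), of r] gball_mono by blast
  then show ?thesis
    using vol_le_vol vol_dyadic[OF assms(1), of y "i + 1"] order_trans by blast
qed

end

locale ue_graph = doubling_graph +
  fixes \<beta> CU cU :: real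
  assumes beta: "2 \<le> \<beta>" and CU: "0 < CU" and cU: "0 < cU"
    and UE: "p k x y \<le> CU / vol \<mu> x (real (k + 1) powr (1 / \<beta>)) *
       exp (- cU * (real (gdist \<mu> x y) powr \<beta> / real (k + 1)) powr (1 / (\<beta> - 1)))"
begin

text \<open>The scale k^(1/\<beta>) of the overview with k + 1 for k, since (UE) bounds
  \<open>p (k - 1)\<close> in terms of k; hence it is at least 1.\<close>

definition rad :: "nat \<Rightarrow> real" where "rad k = real (k + 1) powr (1 / \<beta>)"

lemma rad_ge_1: "1 \<le> rad k" and rad_pos: "0 < rad k"
proof -
  show "1 \<le> rad k" unfolding rad_def using beta by (intro ge_one_powr_ge_zero) auto
  then show "0 < rad k" by simp
qed

lemma rad_mono: "j \<le> k \<Longrightarrow> rad j \<le> rad k"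
  unfolding rad_def using beta by (intro powr_mono2) auto

text \<open>Times within a factor 3 have radii within a factor 3^(1/\<beta>) <= 4, which costs two
  doublings and so the constant A^2.\<close>

lemma p_diag_le:
  assumes "k + 1 \<le> 3 * (n + 1)"
  shows "p n x x \<le> CU * A\<^sup>2 / vol \<mu> x (rad k)"
proof -
  have "rad k \<le> (3 * real (n + 1)) powr (1 / \<beta>)"
    unfolding rad_def using beta assms by (intro powr_mono2) auto
  also have "\<dots> = 3 powr (1 / \<beta>) * rad n"
    unfolding rad_def by (rule powr_mult)
  also have "\<dots> \<le> 2\<^sup>2 * rad n"
    using beta powr_mono[of "1 / \<beta>" 1 3] rad_pos[of n] by (intro mult_right_mono) auto
  finally have "vol \<mu> x (rad k) \<le> vol \<mu> x (2\<^sup>2 * rad n)"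
    by (intro vol_le_vol gball_mono)
  also have "\<dots> \<le> A\<^sup>2 * vol \<mu> x (rad n)" by (rule vol_dyadic[OF rad_pos])
  finally have v: "vol \<mu> x (rad k) \<le> A\<^sup>2 * vol \<mu> x (rad n)" .
  have "p n x x \<le> CU / vol \<mu> x (rad n) *
      exp (- cU * (real (gdist \<mu> x x) powr \<beta> / real (n + 1)) powr (1 / (\<beta> - 1)))"
    unfolding rad_def by (rule UE)
  also have "\<dots> = CU / vol \<mu> x (rad n)" using beta by simp
  also have "\<dots> \<le> CU * A\<^sup>2 / vol \<mu> x (rad k)"
    using v CU vol_pos[OF rad_pos, of x] mult_left_mono[OF v, of CU]
    by (simp add: field_simps)
  finally show ?thesis .
qed

lemma kernel_diff_le_L2:
  assumes y: "y \<in> gball \<mu> x (2 ^ i * rad k)"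
  shows "\<bar>kernel_diff k x y\<bar> \<le> 3 * CU * A\<^sup>2 / \<epsilon> * A ^ (i + 1) / (real (k + 1) * vol \<mu> x (rad k))"
proof -
  \<comment> \<open>Time is cut into three nearly equal pieces: two outer ones of length j and an
    inner one of length l = j + r. Then 2j + 1 and l + 1 are both at least (k + 1)/3.\<close>
  obtain j r where k: "k = 3 * j + r" "r < 3"
    using mult_div_mod_eq[of 3 k] mod_less_divisor[of 3 k] by (metis zero_less_numeral)
  define l where "l = j + r"
  have jl: "k = 2 * j + l" and j3: "k + 1 \<le> 3 * (2 * j + 1)" and l3: "k + 1 \<le> 3 * (l + 1)"
    using k by (auto simp: l_def)
  let ?V = "vol \<mu> x (rad k)" and ?W = "vol \<mu> y (rad k)"
  have V: "0 < ?V" and W: "0 < ?W" by (auto intro: vol_pos rad_pos)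
  have VW: "?V \<le> A ^ (i + 1) * ?W" by (rule vol_nearby[OF rad_pos y])
  have A1: "1 \<le> A ^ (i + 1)" using A_ge_1 by (rule one_le_power)
  have "1 / ?W \<le> A ^ (i + 1) / ?V" using VW V W by (simp add: field_simps)
  \<comment> \<open>A second factor is given away to make the final product a perfect
    square.\<close>
  also have "\<dots> \<le> A ^ (i + 1) * A ^ (i + 1) / ?V"
    using A1 V mult_right_mono[OF A1, of "A ^ (i + 1)"] by (intro divide_right_mono) auto
  finally have "CU * A\<^sup>2 * (1 / ?W) \<le> CU * A\<^sup>2 * (A ^ (i + 1) * A ^ (i + 1) / ?V)"
    using CU by (intro mult_left_mono) auto
  then have yy: "p (2 * j) y y \<le> CU * A\<^sup>2 * (A ^ (i + 1) * A ^ (i + 1) / ?V)"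
    using p_diag_le[OF j3, of y] by simp
  have xx: "p (2 * j) x x \<le> CU * A\<^sup>2 / ?V" by (rule p_diag_le[OF j3])
  have le: "(\<epsilon> * (real (k + 1) / 3))\<^sup>2 \<le> 2 * \<epsilon>\<^sup>2 * (real (l + 1))\<^sup>2"
  proof -
    have "(\<epsilon> * (real (k + 1) / 3))\<^sup>2 \<le> (\<epsilon> * real (l + 1))\<^sup>2"
      using l3 eps_pos by (intro power_mono mult_left_mono) auto
    also have "\<dots> \<le> 2 * (\<epsilon> * real (l + 1))\<^sup>2" by simp
    finally show ?thesis by (simp only: power_mult_distrib mult.assoc)
  qed
  have "(kernel_diff k x y)\<^sup>2 \<le> p (2 * j) x x * p (2 * j) y y / (2 * \<epsilon>\<^sup>2 * (real (l + 1))\<^sup>2)"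
    by (rule kernel_diff_square_le[OF jl])
  also have "\<dots> \<le> (CU * A\<^sup>2 / ?V) * (CU * A\<^sup>2 * (A ^ (i + 1) * A ^ (i + 1) / ?V)) / (\<epsilon> * (real (k + 1) / 3))\<^sup>2"
    using xx yy le CU V A_ge_1 eps_pos p_nonneg by (intro frac_le mult_mono) auto
  also have "\<dots> = (3 * CU * A\<^sup>2 / \<epsilon> * A ^ (i + 1) / (real (k + 1) * ?V))\<^sup>2"
    using eps_pos V by (simp add: power2_eq_square divide_simps)
  finally have "\<bar>kernel_diff k x y\<bar>\<^sup>2 \<le> (3 * CU * A\<^sup>2 / \<epsilon> * A ^ (i + 1) / (real (k + 1) * ?V))\<^sup>2"
    by simp
  then show ?thesis
    by (rule power2_le_imp_le) (use CU A_ge_1 eps_pos V in auto)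
qed

text \<open>Beyond half the radius 2^i \<open>rad k\<close> the quantity in the exponential of (UE)
  is at least 2^i / 2, because \<beta>/(\<beta> - 1) >= 1. Passing from time k to k + 1 at most
  halves it, whence the rate cU/4; the factor exp(cU/2) absorbs the scale i = 0.\<close>

lemma kernel_diff_le_exp:
  assumes far: "i = 0 \<or> 2 ^ i * rad k / 2 \<le> real (gdist \<mu> x y)"
  shows "\<bar>kernel_diff k x y\<bar> \<le> CU * exp (cU / 2) * exp (- (cU / 4 * 2 ^ i)) / vol \<mu> x (rad k)"
proof -
  let ?V = "vol \<mu> x (rad k)" and ?d = "real (gdist \<mu> x y)" and ?b = "1 / (\<beta> - 1)"
  let ?X = "\<lambda>n. (?d powr \<beta> / real (n + 1)) powr ?b"
  have V: "0 < ?V" by (rule vol_pos[OF rad_pos])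
  have b: "0 < ?b" "?b \<le> 1" using beta by auto
  \<comment> \<open>Subtracting 1 makes the left side negative for i = 0, where nothing is known
    about the distance.\<close>
  have X: "2 ^ i / 2 - 1 \<le> ?X k"
  proof (cases "i = 0")
    case False
    have i1: "(1::real) \<le> 2 ^ i / 2" using False by (cases i) auto
    have "2 ^ i / 2 * rad k \<le> ?d" using far False by simp
    then have "(2 ^ i / 2 * rad k) powr \<beta> \<le> ?d powr \<beta>"
      using beta rad_pos[of k] by (intro powr_mono2) auto
    moreover have "(2 ^ i / 2 * rad k) powr \<beta> = (2 ^ i / 2) powr \<beta> * real (k + 1)"
    proof -
      have "(2 ^ i / 2 * rad k) powr \<beta> = (2 ^ i / 2) powr \<beta> * rad k powr \<beta>"
        by (rule powr_mult)
      also have "rad k powr \<beta> = real (k + 1)" using beta by (simp add: rad_def powr_powr)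
      finally show ?thesis .
    qed
    ultimately have "(2 ^ i / 2) powr \<beta> \<le> ?d powr \<beta> / real (k + 1)"
      by (simp add: field_simps)
    then have "((2 ^ i / 2) powr \<beta>) powr ?b \<le> ?X k"
      using b by (intro powr_mono2) auto
    moreover have "(2 ^ i / 2) powr 1 \<le> (2 ^ i / 2 :: real) powr (\<beta> * ?b)"
      using i1 beta by (intro powr_mono) (auto simp: field_simps)
    ultimately have "2 ^ i / 2 \<le> ?X k" using i1 by (simp add: powr_powr)
    then show ?thesis by simp
  next
    case True
    then show ?thesis by (intro order_trans[OF _ powr_ge_zero]) simp
  qed
  have bound: "p n x y \<le> CU * exp (cU / 2) * exp (- (cU / 4 * 2 ^ i)) / ?V" if n: "k \<le> n" "n \<le> Suc k" for n
  proof -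
    \<comment> \<open>Here n + 1 <= 2 (k + 1), and the exponent 1/(\<beta> - 1) is at most 1 as
      \<beta> >= 2.\<close>
    have "?X k * (1 / 2) \<le> ?X n"
    proof -
      have "?X k * (1 / 2) \<le> ?X k * (1 / 2) powr ?b"
        using b powr_mono'[of ?b 1 "1 / 2"] by (intro mult_left_mono) auto
      also have "\<dots> = (?d powr \<beta> / real (k + 1) * (1 / 2)) powr ?b"
        by (subst powr_mult) auto
      also have "\<dots> \<le> ?X n"
      proof (intro powr_mono2)
        have "real (n + 1) \<le> real (k + 1) * 2" using n by simp
        then have "?d powr \<beta> / (real (k + 1) * 2) \<le> ?d powr \<beta> / real (n + 1)"
          by (intro divide_left_mono) auto
        then show "?d powr \<beta> / real (k + 1) * (1 / 2) \<le> ?d powr \<beta> / real (n + 1)" by simp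
      qed (use b in auto)
      finally show ?thesis .
    qed
    then have "2 ^ i / 4 - 1 / 2 \<le> ?X n" using X by linarith
    then have e: "- cU * ?X n \<le> cU / 2 + - (cU / 4 * 2 ^ i)"
      using mult_left_mono[of "2 ^ i / 4 - 1 / 2" "?X n" cU] cU by (simp add: algebra_simps)
    have "p n x y \<le> CU / vol \<mu> x (rad n) * exp (- cU * ?X n)"
      unfolding rad_def by (rule UE)
    also have "\<dots> \<le> CU / ?V * exp (cU / 2 + - (cU / 4 * 2 ^ i))"
      using e CU V n by (intro mult_mono divide_left_mono vol_le_vol gball_mono rad_mono mult_pos_pos vol_pos rad_pos)
        (auto intro: less_imp_le)
    finally show ?thesis by (simp only: exp_add) (simp add: mult_ac)
  qed
  have "\<bar>kernel_diff k x y\<bar> \<le> max (p k x y) (p (Suc k) x y)"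
    unfolding kernel_diff_def using p_nonneg[of k x y] p_nonneg[of "Suc k" x y] by linarith
  also have "\<dots> \<le> CU * exp (cU / 2) * exp (- (cU / 4 * 2 ^ i)) / ?V"
    using bound[of k] bound[of "Suc k"] by simp
  finally show ?thesis .
qed

text \<open>The constants of the two kernel bounds, raised to at least 1: their powers with
  exponents \<theta> and 1 - \<theta> are then at most the constants themselves, so
  \<open>KU\<close> serves every \<theta>.\<close>

definition KU :: real where
  "KU = max 1 (3 * CU * A\<^sup>2 / \<epsilon>) * max 1 (CU * exp (cU / 2))"

definition dyadic_weight :: "real \<Rightarrow> nat \<Rightarrow> real" where
  "dyadic_weight \<theta> i = KU * A ^ (i + 1) * exp (- ((1 - \<theta>) * (cU / 4) * 2 ^ i))"

lemma KU_pos: "0 < KU"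
  unfolding KU_def by (intro mult_pos_pos) auto

lemma dyadic_weight_nonneg: "0 \<le> dyadic_weight \<theta> i"
  unfolding dyadic_weight_def using KU_pos A_ge_1 by auto

text \<open>The geometric mean of the on-diagonal decay in time, which gains a full power of \<open>k\<close>, and
  the off-diagonal decay in space, which gains none. The loss \<open>k\<^bsup>1 - \<theta>\<^esup>\<close> is affordable because
  \<open>s / \<beta> < \<gamma>\<close> is strict.\<close>

lemma kernel_diff_bound:
  assumes th: "0 < \<theta>" "\<theta> < 1"
    and y: "y \<in> gball \<mu> x (2 ^ i * rad k)"
    and far: "i = 0 \<or> 2 ^ i * rad k / 2 \<le> real (gdist \<mu> x y)"
  shows "\<bar>kernel_diff k x y\<bar> \<le> real (k + 1) powr (- \<theta>) * dyadic_weight \<theta> i / vol \<mu> x (rad k)"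
proof -
  let ?V = "vol \<mu> x (rad k)" and ?h = "\<bar>kernel_diff k x y\<bar>"
  let ?a = "max 1 (3 * CU * A\<^sup>2 / \<epsilon>)" and ?c = "max 1 (CU * exp (cU / 2))" and ?e = "exp (- (cU / 4 * 2 ^ i))"
  have V: "0 < ?V" by (rule vol_pos[OF rad_pos])
  have A1: "1 \<le> A ^ (i + 1)" using A_ge_1 by (rule one_le_power)
  have h1: "?h * ?V \<le> ?a * A ^ (i + 1) * (1 / real (k + 1))"
  proof -
    have "?h * ?V \<le> 3 * CU * A\<^sup>2 / \<epsilon> * (A ^ (i + 1) * (1 / real (k + 1)))"
      using mult_right_mono[OF kernel_diff_le_L2[OF y], of ?V] V by simp
    also have "\<dots> \<le> ?a * (A ^ (i + 1) * (1 / real (k + 1)))"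
      using A1 by (intro mult_right_mono) auto
    finally show ?thesis by (simp only: mult.assoc)
  qed
  have h2: "?h * ?V \<le> ?c * ?e"
  proof -
    have "?h * ?V \<le> CU * exp (cU / 2) * ?e"
      using mult_right_mono[OF kernel_diff_le_exp[OF far], of ?V] V by simp
    also have "\<dots> \<le> ?c * ?e" by (intro mult_right_mono) auto
    finally show ?thesis .
  qed
  have "?h * ?V = (?h * ?V) powr \<theta> * (?h * ?V) powr (1 - \<theta>)"
    using V by (simp flip: powr_add)
  also have "\<dots> \<le> (?a * A ^ (i + 1) * (1 / real (k + 1))) powr \<theta> * (?c * ?e) powr (1 - \<theta>)"
  proof (rule mult_mono)
    show "(?h * ?V) powr \<theta> \<le> (?a * A ^ (i + 1) * (1 / real (k + 1))) powr \<theta>"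
      using V th by (intro powr_mono2 h1) auto
    show "(?h * ?V) powr (1 - \<theta>) \<le> (?c * ?e) powr (1 - \<theta>)"
      using V th by (intro powr_mono2 h2) auto
  qed auto
  also have "\<dots> = ((?a * A ^ (i + 1)) powr \<theta> * ?c powr (1 - \<theta>))
      * ((1 / real (k + 1)) powr \<theta> * ?e powr (1 - \<theta>))"
    by (simp only: powr_mult mult_ac)
  also have "\<dots> \<le> ((?a * A ^ (i + 1)) * ?c) * ((1 / real (k + 1)) powr \<theta> * ?e powr (1 - \<theta>))"
  proof (intro mult_right_mono mult_mono)
    have one: "1 \<le> ?a * A ^ (i + 1)" using mult_mono[of 1 ?a 1 "A ^ (i + 1)"] A1 by simp
    show "(?a * A ^ (i + 1)) powr \<theta> \<le> ?a * A ^ (i + 1)"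
      using powr_mono[of \<theta> 1, OF _ one] one th by simp
    show "?c powr (1 - \<theta>) \<le> ?c"
      using powr_mono[of "1 - \<theta>" 1 ?c] th by simp
    show "0 \<le> ?a * A ^ (i + 1)" using one by linarith
  qed auto
  also have "\<dots> = real (k + 1) powr (- \<theta>) * dyadic_weight \<theta> i"
    by (simp add: dyadic_weight_def KU_def powr_def ln_div mult_ac)
  finally show ?thesis using V by (simp add: field_simps)
qed

text \<open>Each y is charged to the smallest dyadic ball containing it, for which the distance
  condition of \<open>kernel_diff_bound\<close> holds. Nonnegativity then allows summation over
  whole balls instead of annuli, which is the form needed for ball means.\<close>

lemma P_pow_diff_le_dyadic:
  fixes u :: "'a \<Rightarrow> real"
  assumes th: "0 < \<theta>" "\<theta> < 1"
  shows "\<bar>(P ^^ k) u x - (P ^^ Suc k) u x\<bar>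
    \<le> (\<Sum>i\<le>Suc k. real (k + 1) powr (- \<theta>) * dyadic_weight \<theta> i / vol \<mu> x (rad k)
          * (\<Sum>y\<in>gball \<mu> x (2 ^ i * rad k). \<bar>u y - c\<bar> * m y))"
proof -
  let ?w = "\<lambda>i. real (k + 1) powr (- \<theta>) * dyadic_weight \<theta> i / vol \<mu> x (rad k)"
  let ?N = "{y. gdist \<mu> x y \<le> Suc k}"
  let ?B = "\<lambda>i. gball \<mu> x (2 ^ i * rad k)"
  have w: "0 \<le> ?w i" for i
    using dyadic_weight_nonneg vol_pos[OF rad_pos, of x k] by (intro divide_nonneg_pos mult_nonneg_nonneg) auto
  have pw: "\<bar>kernel_diff k x y\<bar> \<le> (\<Sum>i\<le>Suc k. if y \<in> ?B i then ?w i else 0)" if y: "y \<in> ?N" for y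
  proof -
    define i where "i = (LEAST i. y \<in> ?B i)"
    \<comment> \<open>The kernel has range k + 1 < 2^(k + 1), so the dyadic scales stop at
      \<open>Suc k\<close>.\<close>
    have "real (gdist \<mu> x y) \<le> real (Suc k)" using y by simp
    also have "\<dots> < 2 ^ Suc k * 1" unfolding mult_1_right by (rule of_nat_less_two_power)
    also have "\<dots> \<le> 2 ^ Suc k * rad k" using rad_ge_1 by (intro mult_left_mono) auto
    finally have ex: "y \<in> ?B (Suc k)" by (simp add: gball_def)
    have i1: "y \<in> ?B i" unfolding i_def using ex by (rule LeastI)
    have i2: "i \<le> Suc k" unfolding i_def using ex by (rule Least_le)
    have i3: "i = 0 \<or> 2 ^ i * rad k / 2 \<le> real (gdist \<mu> x y)"
    proof (cases i)
      case (Suc j)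
      then have "y \<notin> ?B j" using not_less_Least[of j "\<lambda>i. y \<in> ?B i"] by (simp add: i_def)
      then show ?thesis using Suc by (simp add: gball_def)
    qed simp
    have "\<bar>kernel_diff k x y\<bar> \<le> ?w i" using th i1 i3 by (rule kernel_diff_bound)
    also have "\<dots> = (if y \<in> ?B i then ?w i else 0)" using i1 by simp
    also have "\<dots> \<le> (\<Sum>i\<le>Suc k. if y \<in> ?B i then ?w i else 0)"
      using i2 w by (intro member_le_sum) auto
    finally show ?thesis .
  qed
  have "\<bar>(P ^^ k) u x - (P ^^ Suc k) u x\<bar> \<le> (\<Sum>y\<in>?N. \<bar>kernel_diff k x y * (u y - c) * m y\<bar>)"
    unfolding P_pow_diff_eq_kernel_sum[of k u x c] by (rule sum_abs)
  also have "\<dots> \<le> (\<Sum>y\<in>?N. (\<Sum>i\<le>Suc k. if y \<in> ?B i then ?w i else 0) * (\<bar>u y - c\<bar> * m y))"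
  proof (rule sum_mono)
    fix y assume "y \<in> ?N"
    from mult_right_mono[OF pw[OF this], of "\<bar>u y - c\<bar> * m y"] m_nonneg[of y]
    show "\<bar>kernel_diff k x y * (u y - c) * m y\<bar>
        \<le> (\<Sum>i\<le>Suc k. if y \<in> ?B i then ?w i else 0) * (\<bar>u y - c\<bar> * m y)"
      by (simp only: abs_mult abs_of_nonneg mult.assoc) simp
  qed
  also have "\<dots> = (\<Sum>i\<le>Suc k. \<Sum>y\<in>?N. if y \<in> ?B i then ?w i * (\<bar>u y - c\<bar> * m y) else 0)"
    unfolding sum_distrib_right by (subst sum.swap) (intro sum.cong refl, simp)
  also have "\<dots> \<le> (\<Sum>i\<le>Suc k. \<Sum>y\<in>?B i. ?w i * (\<bar>u y - c\<bar> * m y))"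
  proof (rule sum_mono)
    fix i
    have "(\<Sum>y\<in>?N. if y \<in> ?B i then ?w i * (\<bar>u y - c\<bar> * m y) else 0)
        = (\<Sum>y\<in>?N \<inter> ?B i. ?w i * (\<bar>u y - c\<bar> * m y))"
      by (rule sum.inter_restrict[OF finite_gdist_le, symmetric])
    also have "\<dots> \<le> (\<Sum>y\<in>?B i. ?w i * (\<bar>u y - c\<bar> * m y))"
      by (intro sum_mono2 finite_gball mult_nonneg_nonneg w abs_ge_zero m_nonneg) auto
    finally show "(\<Sum>y\<in>?N. if y \<in> ?B i then ?w i * (\<bar>u y - c\<bar> * m y) else 0)
        \<le> (\<Sum>y\<in>?B i. ?w i * (\<bar>u y - c\<bar> * m y))" .
  qed
  finally show ?thesis by (simp only: sum_distrib_left)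
qed

end

section \<open>Ball averages and the Poincare inequality\<close>

context lb_graph
begin

definition ball_mean :: "'a \<Rightarrow> real \<Rightarrow> ('a \<Rightarrow> real) \<Rightarrow> real" where
  "ball_mean x r g = (\<Sum>y\<in>gball \<mu> x r. m y * g y) / vol \<mu> x r"

lemma ball_mean_nonneg: "(\<And>y. 0 \<le> g y) \<Longrightarrow> 0 \<le> ball_mean x r g"
  unfolding ball_mean_def vol_eq_sum by (intro divide_nonneg_nonneg sum_nonneg) (auto simp: m_nonneg)

lemma ball_mean_mono: "(\<And>y. g y \<le> h y) \<Longrightarrow> ball_mean x r g \<le> ball_mean x r h"
  unfolding ball_mean_def vol_eq_sum
  by (intro divide_right_mono sum_mono mult_left_mono sum_nonneg) (auto simp: m_nonneg)

lemma ball_mean_powr_le: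
  assumes r: "0 < r" and g: "\<And>y. 0 \<le> g y" and t: "1 \<le> t"
  shows "ball_mean x r g powr t \<le> ball_mean x r (\<lambda>y. g y powr t)"
proof -
  let ?V = "vol \<mu> x r" and ?s = "\<Sum>y\<in>gball \<mu> x r. m y * g y"
  have V: "0 < ?V" by (rule vol_pos[OF r])
  have "?s powr t \<le> ?V powr (t - 1) * (\<Sum>y\<in>gball \<mu> x r. m y * g y powr t)"
    unfolding vol_eq_sum using g t m_nonneg finite_gball by (intro powr_sum_le) auto
  then have "?s powr t / ?V powr t \<le> ?V powr (t - 1) * (\<Sum>y\<in>gball \<mu> x r. m y * g y powr t) / ?V powr t"
    by (intro divide_right_mono) auto
  then show ?thesis
    unfolding ball_mean_def using V by (simp add: powr_divide powr_diff)
qed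

lemma ball_mean_powr_mono:
  assumes r: "0 < r" and g: "\<And>y. 0 \<le> g y" and q: "0 < q" "q \<le> t"
  shows "ball_mean x r (\<lambda>y. g y powr q) powr (1 / q) \<le> ball_mean x r (\<lambda>y. g y powr t) powr (1 / t)"
proof -
  have "ball_mean x r (\<lambda>y. g y powr q) powr (t / q) \<le> ball_mean x r (\<lambda>y. (g y powr q) powr (t / q))"
    using r q by (intro ball_mean_powr_le) auto
  also have "(\<lambda>y. (g y powr q) powr (t / q)) = (\<lambda>y. g y powr t)"
    using q by (simp add: powr_powr)
  finally have "(ball_mean x r (\<lambda>y. g y powr q) powr (t / q)) powr (1 / t) \<le> ball_mean x r (\<lambda>y. g y powr t) powr (1 / t)"
    using q by (intro powr_mono2) auto
  then show ?thesis using q by (simp add: powr_powr)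
qed

lemma ball_norm_eq_ball_mean:
  assumes r: "0 < r" and q: "0 < q"
  shows "ball_norm \<mu> (ereal q) x r g
    = vol \<mu> x r powr (1 / q) * ball_mean x r (\<lambda>y. \<bar>g y\<bar> powr q) powr (1 / q)"
proof -
  have "ball_norm \<mu> (ereal q) x r g = (vol \<mu> x r * ball_mean x r (\<lambda>y. \<bar>g y\<bar> powr q)) powr (1 / q)"
    using vol_pos[OF r, of x] by (simp add: ball_norm_def ball_mean_def finite_gball mult.commute)
  then show ?thesis by (simp only: powr_mult)
qed

end

text \<open>After exchanging sums, y receives the total of m(x)/V(x, r) over x in B(y, r), and V(y,
  r) <= A V(x, r) there. The constant A is independent of r, so all times and scales can share
  it.\<close>

lemma (in doubling_graph) sum_ball_mean_le:
  assumes r: "0 < r" and F: "finite F" and S: "finite S" "\<And>y. y \<notin> S \<Longrightarrow> g y = 0" and g: "\<And>y. 0 \<le> g y"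
  shows "(\<Sum>x\<in>F. ball_mean x r g * m x) \<le> A * (\<Sum>y\<in>S. g y * m y)"
proof -
  have ball_mean: "ball_mean x r g = (\<Sum>y\<in>S. if y \<in> gball \<mu> x r then m y * g y / vol \<mu> x r else 0)" for x
  proof -
    have "(\<Sum>y\<in>gball \<mu> x r. m y * g y / vol \<mu> x r) = (\<Sum>y\<in>S \<inter> gball \<mu> x r. m y * g y / vol \<mu> x r)"
      using S finite_gball by (intro sum.mono_neutral_right) auto
    then show ?thesis by (simp add: ball_mean_def sum_divide_distrib sum.inter_restrict[OF S(1)])
  qed
  have w: "(\<Sum>x\<in>F. if y \<in> gball \<mu> x r then m x / vol \<mu> x r else 0) \<le> A" for y
  proof -
    let ?V = "vol \<mu> y r"
    have V: "0 < ?V" by (rule vol_pos[OF r])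
    have "(\<Sum>x\<in>F. if y \<in> gball \<mu> x r then m x / vol \<mu> x r else 0)
        \<le> (\<Sum>x\<in>F. if x \<in> gball \<mu> y r then A * m x / ?V else 0)"
    proof (rule sum_mono)
      fix x
      have "m x / vol \<mu> x r \<le> A * m x / ?V" if "x \<in> gball \<mu> y r"
      proof -
        have "?V \<le> A * vol \<mu> x r" using vol_nearby[OF r, of x y 0] that by simp
        from mult_left_mono[OF this m_nonneg[of x]] show ?thesis
          using V vol_pos[OF r, of x] by (simp add: field_simps)
      qed
      then show "(if y \<in> gball \<mu> x r then m x / vol \<mu> x r else 0)
          \<le> (if x \<in> gball \<mu> y r then A * m x / ?V else 0)"
        using gball_sym by auto
    qed
    also have "\<dots> = (\<Sum>x\<in>F \<inter> gball \<mu> y r. A * m x / ?V)"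
      by (rule sum.inter_restrict[OF F, symmetric])
    also have "\<dots> \<le> (\<Sum>x\<in>gball \<mu> y r. A * m x / ?V)"
      using finite_gball A_ge_1 m_nonneg V by (intro sum_mono2) auto
    also have "\<dots> = A"
      using V by (simp add: vol_eq_sum flip: sum_divide_distrib sum_distrib_left)
    finally show ?thesis .
  qed
  have "(\<Sum>x\<in>F. ball_mean x r g * m x)
      = (\<Sum>y\<in>S. \<Sum>x\<in>F. (if y \<in> gball \<mu> x r then m y * g y / vol \<mu> x r else 0) * m x)"
    unfolding ball_mean sum_distrib_right by (rule sum.swap)
  also have "\<dots> = (\<Sum>y\<in>S. g y * m y * (\<Sum>x\<in>F. if y \<in> gball \<mu> x r then m x / vol \<mu> x r else 0))"
    unfolding sum_distrib_left by (intro sum.cong refl) simp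
  also have "\<dots> \<le> (\<Sum>y\<in>S. g y * m y * A)"
    using g m_nonneg by (intro sum_mono mult_left_mono w) auto
  also have "\<dots> = A * (\<Sum>y\<in>S. g y * m y)"
    by (simp add: sum_distrib_left mult_ac)
  finally show ?thesis .
qed

locale poincare_graph = ue_graph +
  fixes q s CP :: real
  assumes q: "1 \<le> q" and s: "1 \<le> s" and CP: "0 < CP"
    and poincare: "0 < r \<Longrightarrow> ball_norm \<mu> (ereal q) x r (\<lambda>z. u z - ball_avg \<mu> u x r)
           \<le> CP * r powr s * ball_norm \<mu> (ereal q) x r (grad \<mu> u)"
begin

lemma grad_nonneg: "0 \<le> grad \<mu> f x"
  unfolding grad_def using m_nonneg weight_nonneg by (auto intro!: infsum_nonneg divide_nonneg_nonneg mult_nonneg_nonneg)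

text \<open>Jensen raises the L^1 mean of the oscillation to a q-mean, Poincare passes to the
  gradient with equal volume factors on both sides, and Jensen raises q to t. The majorant
  \<open>G\<close> lets real and imaginary parts share the gradient of one complex function.\<close>

lemma oscillation_le:
  assumes r: "0 < r" and t: "q \<le> t" and G: "\<And>y. grad \<mu> u y \<le> G y"
  shows "(\<Sum>y\<in>gball \<mu> x r. \<bar>u y - ball_avg \<mu> u x r\<bar> * m y)
    \<le> vol \<mu> x r * (CP * r powr s * ball_mean x r (\<lambda>y. G y powr t) powr (1 / t))"
proof -
  let ?V = "vol \<mu> x r" and ?g = "\<lambda>y. u y - ball_avg \<mu> u x r"
  have V: "0 < ?V" by (rule vol_pos[OF r])
  have q0: "0 < q" using q by simp
  have "?V powr (1 / q) * ball_mean x r (\<lambda>y. \<bar>?g y\<bar> powr q) powr (1 / q)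
      \<le> CP * r powr s * (?V powr (1 / q) * ball_mean x r (\<lambda>y. \<bar>grad \<mu> u y\<bar> powr q) powr (1 / q))"
    using poincare[OF r, of x u] unfolding ball_norm_eq_ball_mean[OF r q0] .
  then have "?V powr (1 / q) * ball_mean x r (\<lambda>y. \<bar>?g y\<bar> powr q) powr (1 / q)
      \<le> ?V powr (1 / q) * (CP * r powr s * ball_mean x r (\<lambda>y. \<bar>grad \<mu> u y\<bar> powr q) powr (1 / q))"
    by (simp only: mult_ac)
  then have le: "ball_mean x r (\<lambda>y. \<bar>?g y\<bar> powr q) powr (1 / q)
      \<le> CP * r powr s * ball_mean x r (\<lambda>y. \<bar>grad \<mu> u y\<bar> powr q) powr (1 / q)"
    by (rule mult_left_le_imp_le) (use V in simp)
  have "ball_mean x r (\<lambda>y. \<bar>?g y\<bar>) = ball_mean x r (\<lambda>y. \<bar>?g y\<bar> powr 1) powr (1 / 1)"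
    by (simp add: ball_mean_nonneg)
  also have "\<dots> \<le> ball_mean x r (\<lambda>y. \<bar>?g y\<bar> powr q) powr (1 / q)"
    using r q by (intro ball_mean_powr_mono) auto
  also note le
  also have "ball_mean x r (\<lambda>y. \<bar>grad \<mu> u y\<bar> powr q) powr (1 / q) \<le> ball_mean x r (\<lambda>y. G y powr q) powr (1 / q)"
    using q G grad_nonneg[of u] by (intro powr_mono2 ball_mean_mono ball_mean_nonneg) auto
  also have "\<dots> \<le> ball_mean x r (\<lambda>y. G y powr t) powr (1 / t)"
    using order_trans[OF grad_nonneg G] by (intro ball_mean_powr_mono r q0 t)
  finally have "ball_mean x r (\<lambda>y. \<bar>?g y\<bar>) \<le> CP * r powr s * ball_mean x r (\<lambda>y. G y powr t) powr (1 / t)"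
    using CP by (simp add: mult_left_mono)
  then have "?V * ball_mean x r (\<lambda>y. \<bar>?g y\<bar>) \<le> ?V * (CP * r powr s * ball_mean x r (\<lambda>y. G y powr t) powr (1 / t))"
    using V by (intro mult_left_mono) auto
  moreover have "?V * ball_mean x r (\<lambda>y. \<bar>?g y\<bar>) = (\<Sum>y\<in>gball \<mu> x r. \<bar>?g y\<bar> * m y)"
    using V by (simp add: ball_mean_def mult.commute)
  ultimately show ?thesis by simp
qed

text \<open>Changing the average from the large ball to the small one costs at most the oscillation
  times the volume ratio, hence one \<open>A ^ i\<close>. Rewriting the large volume by the small
  one costs the other.\<close>

lemma dyadic_oscillation_le:
  assumes r: "0 < r" and t: "q \<le> t" and G: "\<And>y. grad \<mu> u y \<le> G y"
  shows "(\<Sum>y\<in>gball \<mu> x (2 ^ i * r). \<bar>u y - ball_avg \<mu> u x r\<bar> * m y)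
    \<le> 2 * A ^ (2 * i) * vol \<mu> x r * (CP * (2 ^ i * r) powr s * ball_mean x (2 ^ i * r) (\<lambda>y. G y powr t) powr (1 / t))"
proof -
  let ?R = "2 ^ i * r" and ?V = "vol \<mu> x r" and ?c = "ball_avg \<mu> u x r" and ?d = "ball_avg \<mu> u x (2 ^ i * r)"
  let ?M = "CP * ?R powr s * ball_mean x ?R (\<lambda>y. G y powr t) powr (1 / t)"
  define S where "S = (\<Sum>y\<in>gball \<mu> x ?R. \<bar>u y - ?d\<bar> * m y)"
  have V: "0 < ?V" by (rule vol_pos[OF r])
  have R: "0 < ?R" "r \<le> ?R" using r by auto
  have Ai: "1 \<le> A ^ i" using A_ge_1 by (rule one_le_power)
  have S0: "0 \<le> S" unfolding S_def using m_nonneg by (intro sum_nonneg) auto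
  have M0: "0 \<le> ?M" using CP by simp
  have "\<bar>?d - ?c\<bar> * ?V \<le> S"
  proof -
    have "(?d - ?c) * ?V = (\<Sum>y\<in>gball \<mu> x r. (?d - u y) * m y)"
      using V by (simp add: ball_avg_def[of _ _ _ r] finite_gball left_diff_distrib sum_subtractf)
        (simp add: vol_eq_sum sum_distrib_left)
    then have "\<bar>?d - ?c\<bar> * ?V = \<bar>\<Sum>y\<in>gball \<mu> x r. (?d - u y) * m y\<bar>"
      using V by (metis abs_mult abs_of_pos)
    also have "\<dots> \<le> (\<Sum>y\<in>gball \<mu> x r. \<bar>(?d - u y) * m y\<bar>)" by (rule sum_abs)
    also have "\<dots> = (\<Sum>y\<in>gball \<mu> x r. \<bar>u y - ?d\<bar> * m y)"
      using m_nonneg by (simp add: abs_mult abs_minus_commute)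
    also have "\<dots> \<le> S"
      unfolding S_def using gball_mono[OF R(2)] finite_gball m_nonneg by (intro sum_mono2) auto
    finally show ?thesis .
  qed
  then have dc: "A ^ i * (\<bar>?d - ?c\<bar> * ?V) \<le> A ^ i * S"
    using Ai by (intro mult_left_mono) auto
  have "(\<Sum>y\<in>gball \<mu> x ?R. \<bar>u y - ?c\<bar> * m y) \<le> (\<Sum>y\<in>gball \<mu> x ?R. (\<bar>u y - ?d\<bar> + \<bar>?d - ?c\<bar>) * m y)"
    using m_nonneg by (intro sum_mono mult_right_mono) auto
  also have "\<dots> = S + \<bar>?d - ?c\<bar> * vol \<mu> x ?R"
    by (simp add: S_def distrib_right sum.distrib vol_eq_sum sum_distrib_left)
  also have "\<dots> \<le> S + \<bar>?d - ?c\<bar> * (A ^ i * ?V)"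
    by (intro add_left_mono mult_left_mono vol_dyadic r) auto
  also have "\<dots> \<le> A ^ i * S + A ^ i * S"
    using dc mult_right_mono[OF Ai S0] by (simp add: mult_ac)
  also have "\<dots> \<le> 2 * A ^ i * (A ^ i * ?V * ?M)"
  proof -
    have "S \<le> vol \<mu> x ?R * ?M" unfolding S_def by (rule oscillation_le[OF R(1) t G])
    also have "\<dots> \<le> A ^ i * ?V * ?M" by (intro mult_right_mono vol_dyadic r M0)
    finally have "2 * A ^ i * S \<le> 2 * A ^ i * (A ^ i * ?V * ?M)"
      using Ai by (intro mult_left_mono) auto
    moreover have "2 * A ^ i * S = A ^ i * S + A ^ i * S" by simp
    ultimately show ?thesis by (simp only:)
  qed
  finally show ?thesis unfolding mult_2[of i] power_add by (simp only: mult_ac)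
qed

definition poincare_weight :: "real \<Rightarrow> nat \<Rightarrow> real" where
  "poincare_weight \<theta> i = dyadic_weight \<theta> i * (2 * A ^ (2 * i) * CP * (2 ^ i) powr s)"

lemma poincare_weight_nonneg: "0 \<le> poincare_weight \<theta> i"
  unfolding poincare_weight_def using dyadic_weight_nonneg A_ge_1 CP by (intro mult_nonneg_nonneg) auto

text \<open>The double exponential decay beats all geometric growth. In the ratio \<open>?B\<close>,
  one A comes from the kernel bound, two from the dyadic oscillation, and 2^s from the Poincare
  scaling.\<close>

lemma summable_poincare_weight:
  assumes "\<theta> < 1"
  shows "summable (poincare_weight \<theta>)"
proof -
  let ?c = "(1 - \<theta>) * (cU / 4)"
  let ?B = "A ^ 3 * 2 powr s"
  have c: "0 < ?c" using assms cU by simp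
  have ratio: "poincare_weight \<theta> (Suc i) = ?B * exp (- (?c * 2 ^ i)) * poincare_weight \<theta> i" for i
  proof -
    have "exp (- (?c * 2 ^ Suc i)) = exp (- (?c * 2 ^ i)) * exp (- (?c * 2 ^ i))"
      by (simp flip: exp_add)
    moreover have "(2 ^ Suc i :: real) powr s = 2 powr s * (2 ^ i) powr s"
      by (simp only: power_Suc powr_mult)
    ultimately show ?thesis
      by (simp only: poincare_weight_def dyadic_weight_def) (simp add: power_add power2_eq_square power3_eq_cube mult_ac)
  qed
  have "(\<lambda>i. ?B * exp (- (?c * 2 ^ i))) \<longlonglongrightarrow> ?B * 0"
  proof (intro tendsto_intros filterlim_compose[OF exp_at_bot] filterlim_uminus_at_bot[THEN iffD2])
    have "filterlim (\<lambda>i. 2 ^ i :: real) at_top sequentially"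
      by (rule filterlim_at_top_mono[OF filterlim_real_sequentially])
        (intro always_eventually allI less_imp_le of_nat_less_two_power)
    then have "filterlim (\<lambda>i. ?c * 2 ^ i) at_top sequentially"
      by (rule filterlim_tendsto_pos_mult_at_top[OF tendsto_const c])
    then show "filterlim (\<lambda>i. - (- (?c * 2 ^ i))) at_top sequentially" by simp
  qed
  then have "\<forall>\<^sub>F i in sequentially. ?B * exp (- (?c * 2 ^ i)) < 1 / 2"
    by (rule order_tendstoD(2)) simp
  then obtain N where N: "\<And>i. i \<ge> N \<Longrightarrow> ?B * exp (- (?c * 2 ^ i)) < 1 / 2"
    unfolding eventually_sequentially by blast
  show ?thesis
  proof (rule summable_ratio_test[of "1 / 2" N])
    fix i assume "N \<le> i"
    then have "poincare_weight \<theta> (Suc i) \<le> 1 / 2 * poincare_weight \<theta> i"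
      unfolding ratio using N[of i] poincare_weight_nonneg by (intro mult_right_mono) auto
    then show "norm (poincare_weight \<theta> (Suc i)) \<le> 1 / 2 * norm (poincare_weight \<theta> i)"
      using poincare_weight_nonneg by simp
  qed simp
qed

lemma P_pow_diff_pointwise:
  fixes u :: "'a \<Rightarrow> real"
  assumes th: "0 < \<theta>" "\<theta> < 1" and t: "q \<le> t" and G: "\<And>y. grad \<mu> u y \<le> G y"
  shows "\<bar>(P ^^ k) u x - (P ^^ Suc k) u x\<bar>
    \<le> real (k + 1) powr (s / \<beta> - \<theta>) *
        (\<Sum>i\<le>Suc k. poincare_weight \<theta> i * ball_mean x (2 ^ i * rad k) (\<lambda>y. G y powr t) powr (1 / t))"
proof -
  let ?V = "vol \<mu> x (rad k)" and ?k = "real (k + 1) powr (- \<theta>)"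
  let ?M = "\<lambda>i. ball_mean x (2 ^ i * rad k) (\<lambda>y. G y powr t) powr (1 / t)"
  have V: "0 < ?V" by (rule vol_pos[OF rad_pos])
  have "\<bar>(P ^^ k) u x - (P ^^ Suc k) u x\<bar>
      \<le> (\<Sum>i\<le>Suc k. ?k * dyadic_weight \<theta> i / ?V *
          (\<Sum>y\<in>gball \<mu> x (2 ^ i * rad k). \<bar>u y - ball_avg \<mu> u x (rad k)\<bar> * m y))"
    by (rule P_pow_diff_le_dyadic[OF th])
  also have "\<dots> \<le> (\<Sum>i\<le>Suc k. ?k * dyadic_weight \<theta> i / ?V *
          (2 * A ^ (2 * i) * ?V * (CP * (2 ^ i * rad k) powr s * ?M i)))"
    using dyadic_weight_nonneg V
    by (intro sum_mono mult_left_mono dyadic_oscillation_le[OF rad_pos t G] divide_nonneg_pos mult_nonneg_nonneg) auto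
  also have "\<dots> = (\<Sum>i\<le>Suc k. real (k + 1) powr (s / \<beta> - \<theta>) * (poincare_weight \<theta> i * ?M i))"
  proof (rule sum.cong[OF refl])
    fix i
    have "rad k powr s = real (k + 1) powr (s / \<beta>)" by (simp add: rad_def powr_powr)
    then have "real (k + 1) powr (s / \<beta> - \<theta>) = ?k * rad k powr s"
      by (simp flip: powr_add)
    then show "?k * dyadic_weight \<theta> i / ?V * (2 * A ^ (2 * i) * ?V * (CP * (2 ^ i * rad k) powr s * ?M i))
        = real (k + 1) powr (s / \<beta> - \<theta>) * (poincare_weight \<theta> i * ?M i)"
      using V by (simp only: powr_mult poincare_weight_def) (simp add: mult_ac)
  qed
  finally show ?thesis by (simp only: sum_distrib_left)
qed

end

section \<open>Fractional powers of the Laplacian on Lebesgue spaces\<close>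

context lb_graph
begin

lemma Re_P_pow: "Re ((P ^^ k) f x) = (P ^^ k) (\<lambda>x. Re (f x)) x"
  by (induction k arbitrary: x)
    (simp_all add: P_eq_sum[of "(P ^^ k) f" for k] P_eq_sum[of "(P ^^ k) (\<lambda>x. Re (f x))" for k])

lemma Im_P_pow: "Im ((P ^^ k) f x) = (P ^^ k) (\<lambda>x. Im (f x)) x"
  by (induction k arbitrary: x)
    (simp_all add: P_eq_sum[of "(P ^^ k) f" for k] P_eq_sum[of "(P ^^ k) (\<lambda>x. Im (f x))" for k])

lemma grad_le_grad:
  fixes f :: "'a \<Rightarrow> 'b::real_normed_vector" and g :: "'a \<Rightarrow> 'c::real_normed_vector"
  assumes "\<And>x y. norm (g x - g y) \<le> norm (f x - f y)"
  shows "grad \<mu> g x \<le> grad \<mu> f x"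
  unfolding grad_def using assms finite_nbrs m_nonneg weight_nonneg
  by (auto intro!: mult_left_mono sum_mono power_mono divide_right_mono)

lemma grad_Re_le: "grad \<mu> (\<lambda>x. Re (f x)) x \<le> grad \<mu> f x"
  and grad_Im_le: "grad \<mu> (\<lambda>x. Im (f x)) x \<le> grad \<mu> f x"
  using abs_Re_le_cmod[of "f x - f y" for x y] abs_Im_le_cmod[of "f x - f y" for x y]
  by (intro grad_le_grad; simp)+

lemma fin_supp_grad:
  assumes "fin_supp f" shows "fin_supp (grad \<mu> f)"
proof (rule finite_subset)
  show "{x. grad \<mu> f x \<noteq> 0} \<subseteq> {x. f x \<noteq> 0} \<union> (\<Union>y\<in>{y. f y \<noteq> 0}. nbrs \<mu> y)"
  proof (rule subsetI, rule ccontr)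
    fix x assume x: "x \<in> {x. grad \<mu> f x \<noteq> 0}" and no: "x \<notin> {x. f x \<noteq> 0} \<union> (\<Union>y\<in>{y. f y \<noteq> 0}. nbrs \<mu> y)"
    then have "f x - f y = 0" if "y \<in> nbrs \<mu> x" for y
      using that nbrs_sym[of x y] by auto
    then have "grad \<mu> f x = 0" by (simp add: grad_def finite_nbrs)
    then show False using x by simp
  qed
  show "finite ({x. f x \<noteq> 0} \<union> (\<Union>y\<in>{y. f y \<noteq> 0}. nbrs \<mu> y))"
    using assms finite_nbrs by auto
qed

end

context poincare_graph
begin

text \<open>The partial sums of the difference series are bounded by a finite weighted sum, over
  times k and scales i, of roots of ball means of the t-th power of the gradient. The bound is
  uniform in the number of terms and passes to the limit on finite vertex sets.\<close>

lemma laplacian_power_Lp_bound: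
  assumes t: "q \<le> t" and g: "s / \<beta> < \<gamma>" "\<gamma> < 1"
  shows "\<exists>C>0. \<forall>f :: 'a \<Rightarrow> complex. fin_supp f \<longrightarrow>
    laplacian_power \<mu> \<gamma> f \<in> Lp_space m t \<and>
    Lp_norm m t (laplacian_power \<mu> \<gamma> f) \<le> C * Lp_norm m t (grad \<mu> f)"
proof -
  have t1: "1 \<le> t" using q t by simp
  have sb: "0 < s / \<beta>" using s beta by simp
  then have g0: "0 < \<gamma>" using g by simp
  \<comment> \<open>This balances the exponents: -\<gamma> + s/\<beta> - \<theta> = -1 - (\<gamma> -
    s/\<beta>)/2, so decay faster than 1/k survives.\<close>
  define \<theta> where "\<theta> = 1 - (\<gamma> - s / \<beta>) / 2"
  have th: "0 < \<theta>" "\<theta> < 1" using g sb by (auto simp: \<theta>_def field_simps)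
  \<comment> \<open>The factor 2 adds the bounds for the real and imaginary parts.\<close>
  define b where "b k = 2 * real (k + 1) powr (- 1 - (\<gamma> - s / \<beta>) / 2)" for k
  have b0: "0 \<le> b k" for k by (simp add: b_def)
  have bs: "summable b"
  proof -
    have "summable (\<lambda>k. real k powr (- 1 - (\<gamma> - s / \<beta>) / 2))"
      using g by (simp add: summable_real_powr_iff)
    then have "summable (\<lambda>k. real (k + 1) powr (- 1 - (\<gamma> - s / \<beta>) / 2))"
      by (subst summable_iff_shift)
    then show ?thesis unfolding b_def by (rule summable_mult)
  qed
  define W where "W = suminf b * suminf (poincare_weight \<theta>)"
  have W0: "0 \<le> W"
    unfolding W_def using bs b0 summable_poincare_weight[OF th(2)] poincare_weight_nonneg by (intro mult_nonneg_nonneg suminf_nonneg)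
  \<comment> \<open>Jensen with unnormalised weights yields W^(t - 1), the total weight yields W,
    and averaging over balls yields A.\<close>
  define K where "K = W powr (t - 1) * W * A"
  have K0: "0 \<le> K" unfolding K_def using W0 A_ge_1 by auto
  have main: "laplacian_power \<mu> \<gamma> f \<in> Lp_space m t \<and>
      Lp_norm m t (laplacian_power \<mu> \<gamma> f) \<le> (K powr (1 / t) + 1) * Lp_norm m t (grad \<mu> f)"
    if f: "fin_supp f" for f :: "'a \<Rightarrow> complex"
  proof -
    let ?G = "grad \<mu> f"
    let ?S = "{x. ?G x \<noteq> 0}"
    define N where "N = (\<Sum>y\<in>?S. ?G y powr t * m y)"
    have Sf: "finite ?S" using f by (rule fin_supp_grad)
    have N: "(\<Sum>\<^sub>\<infinity>x. norm (?G x) powr t * m x) = N"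
    proof -
      have "(\<Sum>\<^sub>\<infinity>x. norm (?G x) powr t * m x) = (\<Sum>\<^sub>\<infinity>x\<in>?S. ?G x powr t * m x)"
        using grad_nonneg[of f] by (intro infsum_cong_neutral) auto
      then show ?thesis using Sf by (simp add: N_def)
    qed
    have N0: "0 \<le> N" unfolding N_def using m_nonneg by (intro sum_nonneg) auto
    define d where "d k x = (P ^^ k) f x - (P ^^ Suc k) f x" for k x
    define F where "F n x = (\<Sum>k<n. complex_of_real (bcoef (\<gamma> - 1) k) * d k x)" for n x
    define v where "v k i x = ball_mean x (2 ^ i * rad k) (\<lambda>y. ?G y powr t)" for k i x
    have v0: "0 \<le> v k i x" for k i x unfolding v_def by (intro ball_mean_nonneg) auto
    have dk: "cmod (d k x) \<le> 2 * (real (k + 1) powr (s / \<beta> - \<theta>) * (\<Sum>i\<le>Suc k. poincare_weight \<theta> i * v k i x powr (1 / t)))"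
      for k x
    proof -
      have re: "Re (d k x) = (P ^^ k) (\<lambda>x. Re (f x)) x - (P ^^ Suc k) (\<lambda>x. Re (f x)) x"
        and im: "Im (d k x) = (P ^^ k) (\<lambda>x. Im (f x)) x - (P ^^ Suc k) (\<lambda>x. Im (f x)) x"
        unfolding d_def by (simp_all only: minus_complex.simps Re_P_pow Im_P_pow)
      show ?thesis
        using cmod_le[of "d k x"] P_pow_diff_pointwise[OF th t grad_Re_le[of f], of k x]
          P_pow_diff_pointwise[OF th t grad_Im_le[of f], of k x]
        unfolding re im v_def by linarith
    qed
    define I where "I n = Sigma {..<n} (\<lambda>k. {..Suc k})" for n
    define w where "w = (\<lambda>(k, i). b k * poincare_weight \<theta> i)"
    have w0: "0 \<le> w z" for z unfolding w_def using b0 poincare_weight_nonneg by (cases z) auto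
    have FI: "cmod (F n x) \<le> (\<Sum>(k, i)\<in>I n. w (k, i) * v k i x powr (1 / t))" for n x
    proof -
      have "cmod (F n x) \<le> (\<Sum>k<n. b k * (\<Sum>i\<le>Suc k. poincare_weight \<theta> i * v k i x powr (1 / t)))"
        unfolding F_def
      proof (rule sum_norm_le)
        fix k
        let ?s = "\<Sum>i\<le>Suc k. poincare_weight \<theta> i * v k i x powr (1 / t)"
        have s0: "0 \<le> ?s" using poincare_weight_nonneg by (intro sum_nonneg mult_nonneg_nonneg) auto
        have bc: "0 \<le> bcoef (\<gamma> - 1) k" using g by (intro bcoef_nonneg) simp
        have "cmod (complex_of_real (bcoef (\<gamma> - 1) k) * d k x) = bcoef (\<gamma> - 1) k * cmod (d k x)"
          using bc by (simp add: norm_mult)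
        also have "\<dots> \<le> real (k + 1) powr (- \<gamma>) * (2 * (real (k + 1) powr (s / \<beta> - \<theta>) * ?s))"
          using bc s0 by (intro mult_mono bcoef_decay dk g0 g) auto
        also have "\<dots> = 2 * (real (k + 1) powr (- \<gamma>) * real (k + 1) powr (s / \<beta> - \<theta>)) * ?s"
          by (simp only: mult_ac)
        also have "real (k + 1) powr (- \<gamma>) * real (k + 1) powr (s / \<beta> - \<theta>)
            = real (k + 1) powr (- 1 - (\<gamma> - s / \<beta>) / 2)"
          by (simp add: \<theta>_def field_simps flip: powr_add)
        finally show "cmod (complex_of_real (bcoef (\<gamma> - 1) k) * d k x) \<le> b k * ?s"
          unfolding b_def .
      qed
      also have "\<dots> = (\<Sum>(k, i)\<in>I n. w (k, i) * v k i x powr (1 / t))"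
        unfolding I_def w_def by (subst sum.Sigma[symmetric]) (auto simp: sum_distrib_left mult.assoc simp del: sum.atMost_Suc)
      finally show ?thesis .
    qed
    have Iw: "sum w (I n) \<le> W" for n
    proof -
      have "sum w (I n) \<le> sum w ({..<n} \<times> {..n})"
        unfolding I_def using w0 by (intro sum_mono2) auto
      also have "\<dots> = (\<Sum>k<n. b k) * (\<Sum>i\<le>n. poincare_weight \<theta> i)"
        by (simp add: w_def sum_product sum.cartesian_product)
      also have "\<dots> \<le> W"
        unfolding W_def using b0 poincare_weight_nonneg bs summable_poincare_weight[OF th(2)]
        by (intro mult_mono sum_le_suminf sum_nonneg suminf_nonneg) auto
      finally show ?thesis .
    qed
    have bound: "(\<Sum>x\<in>E. cmod (F n x) powr t * m x) \<le> K * N" if E: "finite E" for E n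
    proof -
      have If: "finite (I n)" by (simp add: I_def)
      \<comment> \<open>Jensen over the pairs (k, i): the t-th power cancels the root in each term,
        leaving plain ball means that are summed over vertices by
        \<open>sum_ball_mean_le\<close>.\<close>
      have pt: "cmod (F n x) powr t \<le> W powr (t - 1) * (\<Sum>(k, i)\<in>I n. w (k, i) * v k i x)" for x
      proof -
        have "cmod (F n x) powr t \<le> (\<Sum>z\<in>I n. w z * v (fst z) (snd z) x powr (1 / t)) powr t"
          using FI[of n x] t1 by (intro powr_mono2) (auto simp: case_prod_beta)
        also have "\<dots> \<le> sum w (I n) powr (t - 1) * (\<Sum>z\<in>I n. w z * (v (fst z) (snd z) x powr (1 / t)) powr t)"
          using If w0 t1 by (intro powr_sum_le) auto
        also have "\<dots> = sum w (I n) powr (t - 1) * (\<Sum>z\<in>I n. w z * v (fst z) (snd z) x)"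
          using t1 v0 by (simp add: powr_powr)
        also have "\<dots> \<le> W powr (t - 1) * (\<Sum>z\<in>I n. w z * v (fst z) (snd z) x)"
          using Iw w0 v0 t1 by (intro mult_right_mono powr_mono2 sum_nonneg mult_nonneg_nonneg) auto
        finally show ?thesis by (simp add: case_prod_beta)
      qed
      have "(\<Sum>x\<in>E. cmod (F n x) powr t * m x)
          \<le> (\<Sum>x\<in>E. W powr (t - 1) * (\<Sum>(k, i)\<in>I n. w (k, i) * v k i x) * m x)"
        by (intro sum_mono mult_right_mono pt m_nonneg)
      also have "\<dots> = (\<Sum>x\<in>E. \<Sum>z\<in>I n. W powr (t - 1) * (w z * (v (fst z) (snd z) x * m x)))"
        by (simp add: case_prod_beta sum_distrib_left sum_distrib_right mult.assoc)
      also have "\<dots> = (\<Sum>z\<in>I n. \<Sum>x\<in>E. W powr (t - 1) * (w z * (v (fst z) (snd z) x * m x)))"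
        by (rule sum.swap)
      also have "\<dots> = W powr (t - 1) * (\<Sum>z\<in>I n. w z * (\<Sum>x\<in>E. v (fst z) (snd z) x * m x))"
        by (simp only: sum_distrib_left)
      also have "\<dots> \<le> W powr (t - 1) * (\<Sum>z\<in>I n. w z * (A * N))"
        unfolding v_def N_def using w0 E Sf rad_pos
        by (intro mult_left_mono sum_mono sum_ball_mean_le) auto
      also have "\<dots> = W powr (t - 1) * (sum w (I n) * (A * N))"
        by (simp only: sum_distrib_right)
      also have "\<dots> \<le> W powr (t - 1) * (W * (A * N))"
        using Iw A_ge_1 N0 by (intro mult_left_mono mult_right_mono mult_nonneg_nonneg) auto
      finally show ?thesis by (simp add: K_def mult_ac)
    qed
    have lim: "(\<lambda>n. F n x) \<longlonglongrightarrow> laplacian_power \<mu> \<gamma> f x" for x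
      using laplacian_power_sums[OF g0 g(2) f, of x] unfolding sums_def F_def d_def .
    \<comment> \<open>Fatou's lemma in finite form: on a finite set pointwise convergence of the
      partial sums is enough.\<close>
    have fatou: "(\<Sum>x\<in>E. cmod (laplacian_power \<mu> \<gamma> f x) powr t * m x) \<le> K * N" if E: "finite E" for E
    proof (rule LIMSEQ_le_const2)
      show "(\<lambda>n. \<Sum>x\<in>E. cmod (F n x) powr t * m x)
          \<longlonglongrightarrow> (\<Sum>x\<in>E. cmod (laplacian_power \<mu> \<gamma> f x) powr t * m x)"
        using t1 by (intro tendsto_sum tendsto_mult_right tendsto_powr' tendsto_norm lim tendsto_const) auto
      show "\<exists>N'. \<forall>n\<ge>N'. (\<Sum>x\<in>E. cmod (F n x) powr t * m x) \<le> K * N"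
        using bound[OF E] by blast
    qed
    have L: "laplacian_power \<mu> \<gamma> f \<in> Lp_space m t"
      "(\<Sum>\<^sub>\<infinity>x. cmod (laplacian_power \<mu> \<gamma> f x) powr t * m x) \<le> K * N"
      using Lp_space_bound[of m, OF m_nonneg fatou] by auto
    have "Lp_norm m t (laplacian_power \<mu> \<gamma> f) \<le> (K * N) powr (1 / t)"
      unfolding Lp_norm_def using t1 L(2) m_nonneg by (intro powr_mono2 infsum_nonneg) auto
    also have "\<dots> = K powr (1 / t) * N powr (1 / t)" by (rule powr_mult)
    also have "\<dots> \<le> (K powr (1 / t) + 1) * N powr (1 / t)" by (intro mult_right_mono) auto
    also have "N powr (1 / t) = Lp_norm m t ?G" by (simp only: Lp_norm_def N)
    finally show ?thesis using L(1) by blast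
  qed
  \<comment> \<open>Adding 1 yields the strictly positive constant demanded, \<open>K\<close> being
    known only to be nonnegative.\<close>
  have "0 < K powr (1 / t) + 1" by (intro add_nonneg_pos) auto
  then show ?thesis using main by blast
qed

end

theorem theorem1p4:
  fixes \<mu> :: "'a \<Rightarrow> 'a \<Rightarrow> real" and \<beta> s p \<gamma> :: real and q :: ereal
  assumes "connected_weighted_graph \<mu>"
    and "cond_LB \<mu>"
    and "cond_D \<mu>"
    and "\<beta> \<ge> 2" and "cond_UE \<mu> \<beta>"
    and "1 \<le> q" and "s \<ge> 1" and "cond_P \<mu> q s"
    and "q < ereal p"
    and "s / \<beta> < \<gamma>" and "\<gamma> < 1"
  shows "\<exists>C>0. \<forall>f :: 'a \<Rightarrow> complex. finite {x. f x \<noteq> 0} \<longrightarrow>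
           laplacian_power \<mu> \<gamma> f \<in> Lp_space (vmeas \<mu>) p \<and>
           Lp_norm (vmeas \<mu>) p (laplacian_power \<mu> \<gamma> f) \<le> C * Lp_norm (vmeas \<mu>) p (grad \<mu> f)"
proof -
  obtain \<epsilon> where eps: "0 < \<epsilon>" "\<And>x y. (x, y) \<in> edges \<mu> \<Longrightarrow> \<epsilon> * vmeas \<mu> x \<le> \<mu> x y"
    and loops: "\<And>x. (x, x) \<in> edges \<mu>"
    using assms(2) unfolding cond_LB_def by blast
  interpret lb_graph \<mu> \<epsilon>
    by (intro lb_graph.intro assms(1) lb_graph_axioms.intro) (use eps loops in \<open>auto simp: edges_def\<close>)
  obtain A0 where A0: "0 < A0" "\<And>x r. 0 < r \<Longrightarrow> vol \<mu> x (2 * r) \<le> A0 * vol \<mu> x r"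
    using assms(3) unfolding cond_D_def by blast
  define A where "A = max 1 A0"
  interpret doubling_graph \<mu> \<epsilon> A
  proof
    fix r :: real and x assume r: "0 < r"
    have "A0 * vol \<mu> x r \<le> A * vol \<mu> x r"
      unfolding A_def using vol_pos[OF r, of x] by (intro mult_right_mono) auto
    then show "vol \<mu> x (2 * r) \<le> A * vol \<mu> x r" using A0(2)[OF r, of x] by linarith
  qed (simp add: A_def)
  obtain CU cU where U: "0 < CU" "0 < cU"
    "\<And>x y k. 1 \<le> k \<Longrightarrow> heat_kernel \<mu> (k - 1) x y \<le> CU / vol \<mu> x (real k powr (1 / \<beta>)) *
       exp (- cU * (real (gdist \<mu> x y) powr \<beta> / real k) powr (1 / (\<beta> - 1)))"
    using assms(5) unfolding cond_UE_def by blast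
  interpret ue_graph \<mu> \<epsilon> A \<beta> CU cU
  proof
    fix k x y
    show "heat_kernel \<mu> k x y \<le> CU / vol \<mu> x (real (k + 1) powr (1 / \<beta>)) *
       exp (- cU * (real (gdist \<mu> x y) powr \<beta> / real (k + 1)) powr (1 / (\<beta> - 1)))"
      using U(3)[of "k + 1" x y] by simp
  qed (use U assms(4) in auto)
  \<comment> \<open>The condition q < p < \<infinity> makes q finite, so the Poincare norms are
    genuine power sums.\<close>
  obtain q' where q': "q = ereal q'" using assms(6,9) by (cases q) auto
  obtain CP where CP: "0 < CP" "\<And>x r u. 0 < r \<Longrightarrow>
     ball_norm \<mu> q x r (\<lambda>z. u z - ball_avg \<mu> u x r) \<le> CP * r powr s * ball_norm \<mu> q x r (grad \<mu> u)"
    using assms(8) unfolding cond_P_def by blast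
  interpret poincare_graph \<mu> \<epsilon> A \<beta> CU cU q' s CP
    by unfold_locales (use CP q' assms(6,7) in auto)
  show ?thesis
    using assms(9-11) q' by (intro laplacian_power_Lp_bound) auto
qed

end
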